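(* Let $G_1\triangleleft G_2$ be finite subgroups of $\mathrm{SL}(2,\mathbb{C})$ with $G_1$ normal in $G_2$, let $c\in Z(\mathbb{C}[G_1])\cap Z(\mathbb{C}[G_2])$, and let $\mathcal{O}_c^1$ and $\mathcal{O}_c^2$ be the CBH algebras with parameter $c$ for the groups $G_1$ and $G_2$ respectively. Then there exists an embedding of $\mathcal{O}_c^2$ into $\mathcal{O}_c^1$ which is a filtered deformation of the inclusion $\mathbb{C}[u,v]^{G_2}\subset\mathbb{C}[u,v]^{G_1}$.
   Context: All algebras are associative unital $\mathbb{C}$-algebras. $\mathrm{SL}(2,\mathbb{C})$ acts linearly on $\mathrm{Span}(u,v)=\mathbb{C}^2$; $\deg u=\deg v=1$. A filtered deformation of a graded algebra $A$ is a pair $(\mathcal{A},\chi)$, where $\mathcal{A}$ is a filtered algebra and $\chi\colon\mathrm{gr}\,\mathcal{A}\to A$ is an isomorphism of graded algebras. A filtered deformation of an inclusion of graded algebras $A_2\subset A_1$ is a triple $(\mathcal{A}_2,\mathcal{A}_1,\chi_1)$, where $(\mathcal{A}_1,\chi_1)$ is a filtered deformation of $A_1$ and $\mathcal{A}_2\subset\mathcal{A}_1$ is an inclusion of filtered algebras with $\chi_1(\mathrm{gr}\,\mathcal{A}_2)=A_2$. For a finite group $\Gamma$ acting on an algebra $A$, the smash product $A\#\Gamma$ is $A\otimes\mathbb{C}[\Gamma]$ with product $(a\otimes g)(b\otimes h)=a\,g(b)\otimes gh$. For a finite subgroup $\Gamma\subset\mathrm{SL}(2,\mathbb{C})$ and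 $c\in Z(\mathbb{C}[\Gamma])$, put $e_\Gamma=\frac1{|\Gamma|}\sum_{g\in\Gamma}g$. The CBH algebra of $\Gamma$ with parameter $c$ is $\mathcal{O}_c=e_\Gamma\big(\mathbb{C}\langle u,v\rangle\#\Gamma/(uv-vu-c)\big)e_\Gamma$, with unit $e_\Gamma$, filtered by $\deg u=\deg v=1$, $\deg g=0$ for $g\in\Gamma$. It is a filtered deformation of $\mathbb{C}[u,v]^\Gamma$ via $\mathrm{gr}\,\mathcal{O}_c\cong e_\Gamma(\mathbb{C}[u,v]\#\Gamma)e_\Gamma\cong\mathbb{C}[u,v]^\Gamma$, where $a\in\mathbb{C}[u,v]^\Gamma$ corresponds to $ae_\Gamma$. *)

theory Defs
  imports
    "HOL-Analysis.Determinants"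
    "HOL-Algebra.Coset"
    "HOL-Algebra.Module"
    "HOL-Algebra.QuotRing"
    "HOL-Library.Poly_Mapping"
    "HOL-Library.Product_Plus"
begin

section \<open>Associative unital algebras over the complex numbers\<close>

definition complex_field :: "complex ring" where
  "complex_field = \<lparr>carrier = UNIV, mult = (*), one = 1, zero = 0, add = (+)\<rparr>"

text \<open>The locale \<open>algebra\<close> of HOL-Algebra is restricted to commutative algebras.\<close>

locale C_algebra = ring A + Module.module complex_field A
  for A :: "(complex, 'a) module" (structure) +
  assumes smult_mult_left:
      "\<lbrakk>x \<in> carrier A; y \<in> carrier A\<rbrakk> \<Longrightarrow> (z \<odot> x) \<otimes> y = z \<odot> (x \<otimes> y)"
    and smult_mult_right:
      "\<lbrakk>x \<in> carrier A; y \<in> carrier A\<rbrakk> \<Longrightarrow> x \<otimes> (z \<odot> y) = z \<odot> (x \<otimes> y)"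

definition C_algebra_hom ::
    "(complex, 'a) module \<Rightarrow> (complex, 'b) module \<Rightarrow> ('a \<Rightarrow> 'b) set" where
  "C_algebra_hom A B =
     {\<phi> \<in> ring_hom A B. \<forall>z. \<forall>x \<in> carrier A. \<phi> (z \<odot>\<^bsub>A\<^esub> x) = z \<odot>\<^bsub>B\<^esub> \<phi> x}"

definition algebra_center :: "(complex, 'a) module \<Rightarrow> 'a set" where
  "algebra_center A =
     {z \<in> carrier A. \<forall>x \<in> carrier A. z \<otimes>\<^bsub>A\<^esub> x = x \<otimes>\<^bsub>A\<^esub> z}"

definition quotient_algebra ::
    "(complex, 'a) module \<Rightarrow> 'a set \<Rightarrow> (complex, 'a set) module" where
  "quotient_algebra A I =
     \<lparr>carrier = carrier (A Quot I), mult = mult (A Quot I), one = one (A Quot I),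
      zero = zero (A Quot I), add = add (A Quot I),
      smult = (\<lambda>z X. \<Union>x\<in>X. I +>\<^bsub>A\<^esub> (z \<odot>\<^bsub>A\<^esub> x))\<rparr>"

definition corner_algebra ::
    "(complex, 'a) module \<Rightarrow> 'a \<Rightarrow> (complex, 'a) module" where
  "corner_algebra A e =
     A\<lparr>carrier := {e \<otimes>\<^bsub>A\<^esub> x \<otimes>\<^bsub>A\<^esub> e | x. x \<in> carrier A}, one := e\<rparr>"


section \<open>Graded and filtered algebras\<close>

locale graded_algebra = C_algebra A
  for A :: "(complex, 'a) module" (structure) and D :: "nat \<Rightarrow> 'a set" +
  assumes D_submodule: "submodule (D n) complex_field A"
    and D_one: "\<one> \<in> D 0"
    and D_mult: "\<lbrakk>x \<in> D m; y \<in> D n\<rbrakk> \<Longrightarrow> x \<otimes> y \<in> D (m + n)"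
    and D_direct_sum:
      "x \<in> carrier A \<Longrightarrow>
         \<exists>!f. (\<forall>n. f n \<in> D n) \<and> finite {n. f n \<noteq> \<zero>} \<and> x = (\<Oplus>n\<in>{n. f n \<noteq> \<zero>}. f n)"

locale filtered_algebra = C_algebra A
  for A :: "(complex, 'a) module" (structure) and F :: "nat \<Rightarrow> 'a set" +
  assumes F_submodule: "submodule (F n) complex_field A"
    and F_mono: "F n \<subseteq> F (Suc n)"
    and F_one: "\<one> \<in> F 0"
    and F_mult: "\<lbrakk>x \<in> F m; y \<in> F n\<rbrakk> \<Longrightarrow> x \<otimes> y \<in> F (m + n)"
    and F_exhaustive: "(\<Union>n. F n) = carrier A"

definition graded_algebra_iso ::
    "(complex, 'a) module \<Rightarrow> (nat \<Rightarrow> 'a set) \<Rightarrow>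
     (complex, 'b) module \<Rightarrow> (nat \<Rightarrow> 'b set) \<Rightarrow> ('a \<Rightarrow> 'b) \<Rightarrow> bool" where
  "graded_algebra_iso A D B E chi \<longleftrightarrow>
     graded_algebra A D \<and> graded_algebra B E \<and>
     chi \<in> C_algebra_hom A B \<and> bij_betw chi (carrier A) (carrier B) \<and>
     (\<forall>n. chi ` D n = E n)"

definition graded_inclusion ::
    "(complex, 'a) module \<Rightarrow> (nat \<Rightarrow> 'a set) \<Rightarrow>
     (complex, 'a) module \<Rightarrow> (nat \<Rightarrow> 'a set) \<Rightarrow> bool" where
  "graded_inclusion A2 D2 A1 D1 \<longleftrightarrow>
     graded_algebra A2 D2 \<and> graded_algebra A1 D1 \<and>
     carrier A2 \<subseteq> carrier A1 \<and> (\<lambda>x. x) \<in> C_algebra_hom A2 A1 \<and>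
     (\<forall>n. D2 n = carrier A2 \<inter> D1 n)"

text \<open>An embedding identifies the source with a subalgebra carrying the induced filtration;
  this is what makes the associated graded algebra of the source a subalgebra of the
  associated graded algebra of the target.\<close>

definition filtered_embedding ::
    "(complex, 'a) module \<Rightarrow> (nat \<Rightarrow> 'a set) \<Rightarrow>
     (complex, 'b) module \<Rightarrow> (nat \<Rightarrow> 'b set) \<Rightarrow> ('a \<Rightarrow> 'b) \<Rightarrow> bool" where
  "filtered_embedding A F B G \<phi> \<longleftrightarrow>
     filtered_algebra A F \<and> filtered_algebra B G \<and>
     \<phi> \<in> C_algebra_hom A B \<and> inj_on \<phi> (carrier A) \<and>
     (\<forall>n. \<phi> ` F n = \<phi> ` carrier A \<inter> G n)"

subsection \<open>The associated graded algebra\<close>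

text \<open>\<open>below A F n\<close> is \<open>F (n - 1)\<close>, with the convention \<open>F (-1) = 0\<close>.\<close>

definition below :: "(complex, 'a) module \<Rightarrow> (nat \<Rightarrow> 'a set) \<Rightarrow> nat \<Rightarrow> 'a set" where
  "below A F n = (case n of 0 \<Rightarrow> {\<zero>\<^bsub>A\<^esub>} | Suc m \<Rightarrow> F m)"

text \<open>An element of the direct sum of the \<open>F n / F (n - 1)\<close> is the sequence \<open>X\<close> of its
  homogeneous components, \<open>X n\<close> being a coset of \<open>F (n - 1)\<close> in \<open>F n\<close>. Operations are carried
  out on representatives.\<close>

definition gr :: "(complex, 'a) module \<Rightarrow> (nat \<Rightarrow> 'a set) \<Rightarrow> (complex, nat \<Rightarrow> 'a set) module"
  where
  "gr A F =
     \<lparr>carrier = {X. (\<forall>n. \<exists>x \<in> F n. X n = below A F n +>\<^bsub>A\<^esub> x) \<and>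
                    finite {n. X n \<noteq> below A F n}},
      mult = (\<lambda>X Y n. \<Union>{below A F n +>\<^bsub>A\<^esub> (\<Oplus>\<^bsub>A\<^esub>i\<in>{..n}. x i \<otimes>\<^bsub>A\<^esub> y (n - i)) | x y.
                    (\<forall>i. x i \<in> X i) \<and> (\<forall>i. y i \<in> Y i)}),
      one = (\<lambda>n. if n = 0 then below A F 0 +>\<^bsub>A\<^esub> \<one>\<^bsub>A\<^esub> else below A F n),
      zero = below A F,
      add = (\<lambda>X Y n. X n <+>\<^bsub>A\<^esub> Y n),
      smult = (\<lambda>z X n. \<Union>x \<in> X n. below A F n +>\<^bsub>A\<^esub> (z \<odot>\<^bsub>A\<^esub> x))\<rparr>"

definition gr_component ::
    "(complex, 'a) module \<Rightarrow> (nat \<Rightarrow> 'a set) \<Rightarrow> nat \<Rightarrow> (nat \<Rightarrow> 'a set) set" where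
  "gr_component A F n = {X \<in> carrier (gr A F). \<forall>m. m \<noteq> n \<longrightarrow> X m = below A F m}"

definition gr_map ::
    "(complex, 'b) module \<Rightarrow> (nat \<Rightarrow> 'b set) \<Rightarrow> ('a \<Rightarrow> 'b) \<Rightarrow> (nat \<Rightarrow> 'a set) \<Rightarrow> nat \<Rightarrow> 'b set" where
  "gr_map B G \<phi> X n = (\<Union>x \<in> X n. below B G n +>\<^bsub>B\<^esub> \<phi> x)"

subsection \<open>Filtered deformations\<close>

definition filtered_deformation ::
    "(complex, 'a) module \<Rightarrow> (nat \<Rightarrow> 'a set) \<Rightarrow> ((nat \<Rightarrow> 'a set) \<Rightarrow> 'b) \<Rightarrow>
     (complex, 'b) module \<Rightarrow> (nat \<Rightarrow> 'b set) \<Rightarrow> bool" where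
  "filtered_deformation \<A> F chi A D \<longleftrightarrow>
     filtered_algebra \<A> F \<and> graded_algebra_iso (gr \<A> F) (gr_component \<A> F) A D chi"

text \<open>\<open>(\<A>\<^sub>2, \<A>\<^sub>1, \<chi>\<^sub>1)\<close> is a filtered deformation of \<open>A\<^sub>2 \<subseteq> A\<^sub>1\<close>, where the inclusion of
  \<open>\<A>\<^sub>2\<close> into \<open>\<A>\<^sub>1\<close> is realised by an embedding \<open>\<phi>\<close>.\<close>

definition filtered_deformation_of_inclusion ::
    "(complex, 'c) module \<Rightarrow> (nat \<Rightarrow> 'c set) \<Rightarrow>
     (complex, 'a) module \<Rightarrow> (nat \<Rightarrow> 'a set) \<Rightarrow>
     ('c \<Rightarrow> 'a) \<Rightarrow> ((nat \<Rightarrow> 'a set) \<Rightarrow> 'b) \<Rightarrow>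
     (complex, 'b) module \<Rightarrow> (nat \<Rightarrow> 'b set) \<Rightarrow>
     (complex, 'b) module \<Rightarrow> (nat \<Rightarrow> 'b set) \<Rightarrow> bool" where
  "filtered_deformation_of_inclusion \<A>2 F2 \<A>1 F1 \<phi> chi1 A2 D2 A1 D1 \<longleftrightarrow>
     graded_inclusion A2 D2 A1 D1 \<and>
     filtered_deformation \<A>1 F1 chi1 A1 D1 \<and>
     filtered_embedding \<A>2 F2 \<A>1 F1 \<phi> \<and>
     chi1 ` gr_map \<A>1 F1 \<phi> ` carrier (gr \<A>2 F2) = carrier A2"


section \<open>Group algebras and smash products\<close>

text \<open>The function \<open>x\<close>, vanishing outside \<open>\<Gamma>\<close>, stands for the sum of all \<open>x g \<cdot> g\<close>. Thus the
  group algebra of a subgroup is literally a subset of the group algebra of the group.\<close>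

definition group_algebra :: "'g monoid \<Rightarrow> (complex, 'g \<Rightarrow> complex) module" where
  "group_algebra \<Gamma> =
     \<lparr>carrier = {x. \<forall>g. g \<notin> carrier \<Gamma> \<longrightarrow> x g = 0},
      mult = (\<lambda>x y k. \<Sum>(g, h) \<in> {(g, h) \<in> carrier \<Gamma> \<times> carrier \<Gamma>. g \<otimes>\<^bsub>\<Gamma>\<^esub> h = k}. x g * y h),
      one = (\<lambda>g. if g = \<one>\<^bsub>\<Gamma>\<^esub> then 1 else 0),
      zero = (\<lambda>g. 0),
      add = (\<lambda>x y g. x g + y g),
      smult = (\<lambda>z x g. z * x g)\<rparr>"

text \<open>Likewise \<open>a\<close> stands for the sum of all \<open>a g \<otimes> g\<close>; \<open>\<rho>\<close> is the action of \<open>\<Gamma>\<close> on \<open>A\<close>.\<close>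

definition smash_product ::
    "(complex, 'a) module \<Rightarrow> 'g monoid \<Rightarrow> ('g \<Rightarrow> 'a \<Rightarrow> 'a) \<Rightarrow> (complex, 'g \<Rightarrow> 'a) module" where
  "smash_product A \<Gamma> \<rho> =
     \<lparr>carrier = {a. (\<forall>g \<in> carrier \<Gamma>. a g \<in> carrier A) \<and> (\<forall>g. g \<notin> carrier \<Gamma> \<longrightarrow> a g = \<zero>\<^bsub>A\<^esub>)},
      mult = (\<lambda>a b k. finsum A (\<lambda>(g, h). a g \<otimes>\<^bsub>A\<^esub> \<rho> g (b h))
                        {(g, h) \<in> carrier \<Gamma> \<times> carrier \<Gamma>. g \<otimes>\<^bsub>\<Gamma>\<^esub> h = k}),
      one = (\<lambda>g. if g = \<one>\<^bsub>\<Gamma>\<^esub> then \<one>\<^bsub>A\<^esub> else \<zero>\<^bsub>A\<^esub>),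
      zero = (\<lambda>g. \<zero>\<^bsub>A\<^esub>),
      add = (\<lambda>a b g. a g \<oplus>\<^bsub>A\<^esub> b g),
      smult = (\<lambda>z a g. z \<odot>\<^bsub>A\<^esub> a g)\<rparr>"

definition smash_of_algebra ::
    "(complex, 'a) module \<Rightarrow> 'g monoid \<Rightarrow> 'a \<Rightarrow> 'g \<Rightarrow> 'a" where
  "smash_of_algebra A \<Gamma> a = (\<lambda>g. if g = \<one>\<^bsub>\<Gamma>\<^esub> then a else \<zero>\<^bsub>A\<^esub>)"

definition smash_of_group ::
    "(complex, 'a) module \<Rightarrow> ('g \<Rightarrow> complex) \<Rightarrow> 'g \<Rightarrow> 'a" where
  "smash_of_group A x = (\<lambda>g. x g \<odot>\<^bsub>A\<^esub> \<one>\<^bsub>A\<^esub>)"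

definition averaging_idempotent :: "'g monoid \<Rightarrow> 'g \<Rightarrow> complex" where
  "averaging_idempotent \<Gamma> =
     (\<lambda>g. if g \<in> carrier \<Gamma> then 1 / of_nat (card (carrier \<Gamma>)) else 0)"


section \<open>Polynomials in two variables and the action of SL(2)\<close>

definition SL2 :: "(complex^2^2) monoid" where
  "SL2 = \<lparr>carrier = {g. det g = 1}, mult = (**), one = mat 1\<rparr>"

abbreviation SL2_sub :: "(complex^2^2) set \<Rightarrow> (complex^2^2) monoid" where
  "SL2_sub \<Gamma> \<equiv> SL2\<lparr>carrier := \<Gamma>\<rparr>"

datatype var = U | V

text \<open>The free monoid on the two variables, written additively in order that finitely supported
  functions on it become the free algebra under the convolution product of
  \<^theory>\<open>HOL-Library.Poly_Mapping\<close>.\<close>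

datatype word = Word (letters: "var list")

instantiation word :: monoid_add
begin

definition zero_word :: word where
  "0 = Word []"

definition plus_word :: "word \<Rightarrow> word \<Rightarrow> word" where
  "v + w = Word (letters v @ letters w)"

instance
  by standard (auto simp: zero_word_def plus_word_def)

end

type_synonym nc_poly = "word \<Rightarrow>\<^sub>0 complex"

text \<open>The exponent \<open>(i, j)\<close> stands for the monomial \<open>u\<^sup>i v\<^sup>j\<close>.\<close>

type_synonym c_poly = "(nat \<times> nat) \<Rightarrow>\<^sub>0 complex"

definition scale :: "complex \<Rightarrow> ('m \<Rightarrow>\<^sub>0 complex) \<Rightarrow> ('m \<Rightarrow>\<^sub>0 complex)" where
  "scale z = Poly_Mapping.map ((*) z)"

definition poly_algebra ::
    "('m::monoid_add \<Rightarrow>\<^sub>0 complex) set \<Rightarrow> (complex, 'm \<Rightarrow>\<^sub>0 complex) module" where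
  "poly_algebra S =
     \<lparr>carrier = S, mult = (*), one = 1, zero = 0, add = (+), smult = scale\<rparr>"

definition nc_var :: "var \<Rightarrow> nc_poly" where
  "nc_var x = Poly_Mapping.single (Word [x]) 1"

definition c_var :: "var \<Rightarrow> c_poly" where
  "c_var x = Poly_Mapping.single (case x of U \<Rightarrow> (1, 0) | V \<Rightarrow> (0, 1)) 1"

text \<open>Matrices act on column vectors, with \<open>u\<close> and \<open>v\<close> the standard basis.\<close>

definition linear_image ::
    "(var \<Rightarrow> 'm \<Rightarrow>\<^sub>0 complex) \<Rightarrow> complex^2^2 \<Rightarrow> var \<Rightarrow> ('m \<Rightarrow>\<^sub>0 complex)" where
  "linear_image X g x = (case x of
       U \<Rightarrow> scale (g $ 1 $ 1) (X U) + scale (g $ 2 $ 1) (X V)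
     | V \<Rightarrow> scale (g $ 1 $ 2) (X U) + scale (g $ 2 $ 2) (X V))"

definition nc_act :: "complex^2^2 \<Rightarrow> nc_poly \<Rightarrow> nc_poly" where
  "nc_act g p = (\<Sum>w \<in> Poly_Mapping.keys p.
     scale (Poly_Mapping.lookup p w) (prod_list (map (linear_image nc_var g) (letters w))))"

definition c_act :: "complex^2^2 \<Rightarrow> c_poly \<Rightarrow> c_poly" where
  "c_act g f = (\<Sum>(i, j) \<in> Poly_Mapping.keys f.
     scale (Poly_Mapping.lookup f (i, j))
       (linear_image c_var g U ^ i * linear_image c_var g V ^ j))"

definition abelianize :: "nc_poly \<Rightarrow> c_poly" where
  "abelianize p = (\<Sum>w \<in> Poly_Mapping.keys p.
     scale (Poly_Mapping.lookup p w) (prod_list (map c_var (letters w))))"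

definition hom_part :: "('m \<Rightarrow> nat) \<Rightarrow> nat \<Rightarrow> ('m \<Rightarrow>\<^sub>0 complex) \<Rightarrow> ('m \<Rightarrow>\<^sub>0 complex)" where
  "hom_part deg n p = (\<Sum>m \<in> {m \<in> Poly_Mapping.keys p. deg m = n}.
     Poly_Mapping.single m (Poly_Mapping.lookup p m))"

definition nc_deg :: "word \<Rightarrow> nat" where
  "nc_deg w = length (letters w)"

definition c_deg :: "nat \<times> nat \<Rightarrow> nat" where
  "c_deg m = fst m + snd m"

definition invariants :: "(complex^2^2) set \<Rightarrow> (complex, c_poly) module" where
  "invariants \<Gamma> = poly_algebra {f. \<forall>g \<in> \<Gamma>. c_act g f = f}"

definition invariants_component :: "(complex^2^2) set \<Rightarrow> nat \<Rightarrow> c_poly set" where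
  "invariants_component \<Gamma> n =
     {f \<in> carrier (invariants \<Gamma>). \<forall>m \<in> Poly_Mapping.keys f. c_deg m = n}"


section \<open>CBH algebras\<close>

definition nc_smash :: "(complex^2^2) set \<Rightarrow> (complex, complex^2^2 \<Rightarrow> nc_poly) module" where
  "nc_smash \<Gamma> = smash_product (poly_algebra UNIV) (SL2_sub \<Gamma>) nc_act"

definition c_smash :: "(complex^2^2) set \<Rightarrow> (complex, complex^2^2 \<Rightarrow> c_poly) module" where
  "c_smash \<Gamma> = smash_product (poly_algebra UNIV) (SL2_sub \<Gamma>) c_act"

definition nc_smash_filtration :: "(complex^2^2) set \<Rightarrow> nat \<Rightarrow> (complex^2^2 \<Rightarrow> nc_poly) set" where
  "nc_smash_filtration \<Gamma> n =
     {a \<in> carrier (nc_smash \<Gamma>). \<forall>g. \<forall>w \<in> Poly_Mapping.keys (a g). nc_deg w \<le> n}"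

definition cbh_relator ::
    "(complex^2^2) set \<Rightarrow> (complex^2^2 \<Rightarrow> complex) \<Rightarrow> complex^2^2 \<Rightarrow> nc_poly" where
  "cbh_relator \<Gamma> c =
     smash_of_algebra (poly_algebra UNIV) (SL2_sub \<Gamma>)
       (nc_var U * nc_var V - nc_var V * nc_var U)
     \<ominus>\<^bsub>nc_smash \<Gamma>\<^esub> smash_of_group (poly_algebra UNIV) c"

definition cbh_ideal ::
    "(complex^2^2) set \<Rightarrow> (complex^2^2 \<Rightarrow> complex) \<Rightarrow> (complex^2^2 \<Rightarrow> nc_poly) set" where
  "cbh_ideal \<Gamma> c = Idl\<^bsub>nc_smash \<Gamma>\<^esub> {cbh_relator \<Gamma> c}"

definition cbh_class ::
    "(complex^2^2) set \<Rightarrow> (complex^2^2 \<Rightarrow> complex) \<Rightarrow>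
     (complex^2^2 \<Rightarrow> nc_poly) \<Rightarrow> (complex^2^2 \<Rightarrow> nc_poly) set" where
  "cbh_class \<Gamma> c a = cbh_ideal \<Gamma> c +>\<^bsub>nc_smash \<Gamma>\<^esub> a"

definition CBH ::
    "(complex^2^2) set \<Rightarrow> (complex^2^2 \<Rightarrow> complex) \<Rightarrow>
     (complex, (complex^2^2 \<Rightarrow> nc_poly) set) module" where
  "CBH \<Gamma> c =
     corner_algebra (quotient_algebra (nc_smash \<Gamma>) (cbh_ideal \<Gamma> c))
       (cbh_class \<Gamma> c (smash_of_group (poly_algebra UNIV) (averaging_idempotent (SL2_sub \<Gamma>))))"

definition CBH_filtration ::
    "(complex^2^2) set \<Rightarrow> (complex^2^2 \<Rightarrow> complex) \<Rightarrow> nat \<Rightarrow> (complex^2^2 \<Rightarrow> nc_poly) set set" where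
  "CBH_filtration \<Gamma> c n = carrier (CBH \<Gamma> c) \<inter> cbh_class \<Gamma> c ` nc_smash_filtration \<Gamma> n"

text \<open>The canonical isomorphism from \<open>gr (CBH \<Gamma> c)\<close> to the invariant polynomials. The principal
  symbol of a representative \<open>a\<close> of an element of filtration degree \<open>n\<close> is the image in
  \<open>\<complex>[u,v] # \<Gamma>\<close> of the degree \<open>n\<close> part of \<open>a\<close>; it has the form \<open>f e\<close>, with \<open>f\<close> invariant
  and \<open>e\<close> the averaging idempotent of \<open>\<Gamma>\<close>, and \<open>CBH_symbol\<close> returns \<open>f\<close>.\<close>

definition principal_symbol ::
    "nat \<Rightarrow> (complex^2^2 \<Rightarrow> nc_poly) \<Rightarrow> complex^2^2 \<Rightarrow> c_poly" where
  "principal_symbol n a = (\<lambda>g. abelianize (hom_part nc_deg n (a g)))"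

definition CBH_symbol ::
    "(complex^2^2) set \<Rightarrow> (complex^2^2 \<Rightarrow> complex) \<Rightarrow>
     (nat \<Rightarrow> (complex^2^2 \<Rightarrow> nc_poly) set set) \<Rightarrow> c_poly" where
  "CBH_symbol \<Gamma> c X = (THE f. f \<in> carrier (invariants \<Gamma>) \<and>
     (\<forall>n. \<exists>a \<in> nc_smash_filtration \<Gamma> n. cbh_class \<Gamma> c a \<in> X n \<and>
        principal_symbol n a =
          smash_of_algebra (poly_algebra UNIV) (SL2_sub \<Gamma>) (hom_part c_deg n f)
          \<otimes>\<^bsub>c_smash \<Gamma>\<^esub>
          smash_of_group (poly_algebra UNIV) (averaging_idempotent (SL2_sub \<Gamma>))))"

end

theory Submission
  imports Defs
begin

text \<open>Let \<open>A = \<complex>\<langle>u,v\<rangle> # G\<close>, let \<open>r = uv - vu - c\<close>, let \<open>I\<close> be the ideal generated by \<open>r\<close> and \<open>e\<close>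
the averaging idempotent of \<open>G\<close>. Everything is reduced to the free algebra by the identity \<open>e a
e = f e\<close>, where \<open>f\<close> is the \<open>G\<close>-average of the sum of the coefficients of \<open>a\<close>: the CBH algebra is
the image of the algebra \<open>\<complex>\<langle>u,v\<rangle>\<^sup>G\<close> of noncommutative invariants under \<open>f \<mapsto> [f e]\<close>, with the
filtration by degree (\<open>carrier_CBH\<close>, \<open>CBH_filtration_eq\<close>).

The embedding sends \<open>[f e\<^sub>2]\<close> to \<open>[f e\<^sub>1]\<close> for \<open>f \<in> \<complex>\<langle>u,v\<rangle>\<close> invariant under \<open>G\<^sub>2\<close>, hence under
\<open>G\<^sub>1\<close>. It visibly respects products and degrees, so two points remain: that it is well defined
and injective, i.e. \<open>f e\<^sub>2 \<in> I\<^sub>2\<close> iff \<open>f e\<^sub>1 \<in> I\<^sub>1\<close>, and that the associated graded algebras are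
the expected ones. Both follow from an explicit form of the ideal (\<open>cbh_ideal_eq\<close>): \<open>I\<close> is the
sum of the \<open>v\<^sup>a u\<^sup>b r A\<close>. Indeed every word can be sorted into the form \<open>v\<^sup>a u\<^sup>b\<close> at the cost of
terms that contain \<open>r\<close> and of shorter words, and \<open>r\<close> commutes with \<open>G\<close> because \<open>G\<close> preserves \<open>uv
- vu\<close> and \<open>c\<close> is central; so this sum of right ideals is a two-sided ideal.

The first point (\<open>times_idem_in_relator_span_iff\<close>): since \<open>c\<close> is supported on \<open>G\<^sub>1\<close>, restricting
the support of an element of \<open>\<complex>\<langle>u,v\<rangle> # G\<^sub>2\<close> to \<open>G\<^sub>1\<close> commutes with left multiplication by \<open>v\<^sup>a
u\<^sup>b r\<close>. So it maps \<open>I\<^sub>2\<close> into \<open>I\<^sub>1\<close>, and it maps \<open>f e\<^sub>2\<close> to a nonzero multiple of \<open>f e\<^sub>1\<close>.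
Conversely \<open>I\<^sub>1 \<subseteq> I\<^sub>2\<close> and \<open>f e\<^sub>1 e\<^sub>2 = f e\<^sub>2\<close>.

The second point is a theorem of Poincare-Birkhoff-Witt type (\<open>pbw\<close>): the leading symbol in
\<open>\<complex>[u,v] # G\<close> of an element of \<open>I\<close> vanishes. In a sum of terms \<open>v\<^sup>a u\<^sup>b r y\<^sub>a\<^sub>b\<close> the leading
parts \<open>v\<^sup>a u\<^sup>b (uv - vu) y\<^sub>a\<^sub>b\<close> cannot cancel one another, because a word has at most one first
occurrence of \<open>uv\<close> (\<open>comm_uv_cancel\<close>); hence the top degree of the sum is visible in its
summands, where the commutator is killed by passing to commuting variables. Together with the
sorting of words, which shows that an element with vanishing symbol is congruent modulo \<open>I\<close> to
one of smaller degree (\<open>lower_degree\<close>), this identifies the associated graded algebra with the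
invariant polynomials. The embedding induces on it the inclusion, as it does not change the
representative \<open>f\<close>.\<close>

section \<open>Linear maps and degrees on finitely supported functions\<close>

abbreviation coeff :: "('m \<Rightarrow>\<^sub>0 complex) \<Rightarrow> 'm \<Rightarrow> complex" where
  "coeff \<equiv> Poly_Mapping.lookup"

abbreviation supp :: "('m \<Rightarrow>\<^sub>0 complex) \<Rightarrow> 'm set" where
  "supp \<equiv> Poly_Mapping.keys"

abbreviation monom :: "'m \<Rightarrow> complex \<Rightarrow> ('m \<Rightarrow>\<^sub>0 complex)" where
  "monom \<equiv> Poly_Mapping.single"

lemma poly_sum_monoms: "p = (\<Sum>m\<in>supp p. monom m (coeff p m))"
proof (rule poly_mapping_eqI)
  fix k
  have "coeff (\<Sum>m\<in>supp p. monom m (coeff p m)) k = (\<Sum>m\<in>supp p. if m = k then coeff p m else 0)"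
    by (simp add: lookup_sum lookup_single when_def)
  also have "\<dots> = coeff p k" by (simp add: in_keys_iff)
  finally show "coeff p k = coeff (\<Sum>m\<in>supp p. monom m (coeff p m)) k" by simp
qed

lemma poly_induct [case_names monom add]:
  fixes p :: "'m \<Rightarrow>\<^sub>0 complex"
  assumes monom: "\<And>m z. P (monom m z)" and add: "\<And>p q. P p \<Longrightarrow> P q \<Longrightarrow> P (p + q)"
  shows "P p"
proof -
  have P0: "P 0" using monom[of undefined 0] by simp
  have "P (\<Sum>m\<in>S. monom m (coeff p m))" if "finite S" for S
    using that by induction (auto simp: P0 intro: monom add)
  then show ?thesis using poly_sum_monoms[of p] by (metis finite_keys)
qed

lemma coeff_scale [simp]: "coeff (scale z p) m = z * coeff p m"
  by (simp add: scale_def map.rep_eq when_def)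

lemma scale_eq_mult: "scale z p = monom 0 z * p"
  for p :: "'m::monoid_add \<Rightarrow>\<^sub>0 complex"
  by (simp add: scale_def mult_map_scale_conv_mult)

lemma scale_monom [simp]: "scale z (monom m w) = monom m (z * w)"
  by (rule poly_mapping_eqI) (simp add: lookup_single when_def)

lemma scale_add_right: "scale z (p + q) = scale z p + scale z q"
  by (rule poly_mapping_eqI) (simp add: lookup_add algebra_simps)

lemma scale_diff_right: "scale z (p - q) = scale z p - scale z q"
  by (rule poly_mapping_eqI) (simp add: lookup_minus algebra_simps)

lemma scale_add_left: "scale (z + w) p = scale z p + scale w p"
  by (rule poly_mapping_eqI) (simp add: lookup_add algebra_simps)

lemma scale_scale [simp]: "scale z (scale w p) = scale (z * w) p"
  by (rule poly_mapping_eqI) simp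

lemma scale_0_right [simp]: "scale z 0 = 0"
  by (rule poly_mapping_eqI) simp

lemma scale_0_left [simp]: "scale 0 p = 0"
  by (rule poly_mapping_eqI) simp

lemma scale_1 [simp]: "scale 1 p = p"
  by (rule poly_mapping_eqI) simp

lemma scale_sum_right: "scale z (\<Sum>i\<in>S. f i) = (\<Sum>i\<in>S. scale z (f i))"
  by (rule poly_mapping_eqI) (simp add: lookup_sum sum_distrib_left)

lemma scale_uminus: "scale (- 1) p = - p"
  by (rule poly_mapping_eqI) simp

lemma scale_mult_left: "scale z p * q = scale z (p * q)"
  for p :: "'m::monoid_add \<Rightarrow>\<^sub>0 complex"
  by (simp add: scale_eq_mult mult.assoc)

text \<open>This makes multiplication bilinear in spite of the noncommutative monoid of exponents.\<close>
lemma constant_central: "p * monom 0 z = monom 0 z * p"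
  for p :: "'m::monoid_add \<Rightarrow>\<^sub>0 complex"
  by (induction p rule: poly_induct) (simp_all add: mult_single mult.commute algebra_simps)

lemma scale_mult_right: "p * scale z q = scale z (p * q)"
  for p :: "'m::monoid_add \<Rightarrow>\<^sub>0 complex"
  by (metis constant_central mult.assoc scale_eq_mult)

text \<open>The actions of matrices on both kinds of polynomials, the passage to commuting variables
and the choice of normal forms are all of this shape, and inherit linearity, multiplicativity
and compatibility with degrees from it.\<close>
definition lin_ext :: "('m \<Rightarrow> 'k \<Rightarrow>\<^sub>0 complex) \<Rightarrow> ('m \<Rightarrow>\<^sub>0 complex) \<Rightarrow> ('k \<Rightarrow>\<^sub>0 complex)" where
  "lin_ext \<phi> p = (\<Sum>m\<in>supp p. scale (coeff p m) (\<phi> m))"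

lemma lin_ext_superset:
  assumes "finite S" "supp p \<subseteq> S"
  shows "lin_ext \<phi> p = (\<Sum>m\<in>S. scale (coeff p m) (\<phi> m))"
  unfolding lin_ext_def
  by (rule sum.mono_neutral_left) (use assms in \<open>auto simp: in_keys_iff\<close>)

lemma lin_ext_monom [simp]: "lin_ext \<phi> (monom m z) = scale z (\<phi> m)"
  by (subst lin_ext_superset[of "{m}"]) auto

lemma lin_ext_add: "lin_ext \<phi> (p + q) = lin_ext \<phi> p + lin_ext \<phi> q"
proof -
  let ?S = "supp p \<union> supp q"
  have "supp (p + q) \<subseteq> ?S" by (rule keys_add)
  then show ?thesis
    by (simp add: lin_ext_superset[of ?S] lookup_add scale_add_left sum.distrib)
qed

lemma lin_ext_0 [simp]: "lin_ext \<phi> 0 = 0"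
  by (simp add: lin_ext_def)

lemma lin_ext_uminus: "lin_ext \<phi> (- p) = - lin_ext \<phi> p"
  using lin_ext_add[of \<phi> p "- p"] by (simp add: eq_neg_iff_add_eq_0 add.commute)

lemma lin_ext_diff: "lin_ext \<phi> (p - q) = lin_ext \<phi> p - lin_ext \<phi> q"
  using lin_ext_add[of \<phi> p "- q"] by (simp add: lin_ext_uminus)

lemma lin_ext_sum: "lin_ext \<phi> (\<Sum>i\<in>S. f i) = (\<Sum>i\<in>S. lin_ext \<phi> (f i))"
  by (induction S rule: infinite_finite_induct) (simp_all add: lin_ext_add)

lemma lin_ext_scale: "lin_ext \<phi> (scale z p) = scale z (lin_ext \<phi> p)"
  by (induction p rule: poly_induct) (simp_all add: lin_ext_add scale_add_right)

lemma lin_ext_mult: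
  fixes \<phi> :: "'m::monoid_add \<Rightarrow> 'k::monoid_add \<Rightarrow>\<^sub>0 complex"
  assumes "\<And>a b. \<phi> (a + b) = \<phi> a * \<phi> b"
  shows "lin_ext \<phi> (p * q) = lin_ext \<phi> p * lin_ext \<phi> q"
proof (induction p rule: poly_induct)
  case (monom m z)
  show ?case
    by (induction q rule: poly_induct)
      (simp_all add: mult_single assms scale_mult_left scale_mult_right lin_ext_add distrib_left
          mult.commute)
qed (simp add: lin_ext_add distrib_right)

text \<open>One predicate serves both for homogeneous elements, with \<open>S = {n}\<close>, and for degree bounds,
with \<open>S = {..n}\<close> or \<open>S = {..<n}\<close>. The last form makes sense of degree less than 0: it singles
out the zero polynomial, in accordance with the convention \<open>F (-1) = 0\<close>.\<close>
definition in_degs :: "('m \<Rightarrow> nat) \<Rightarrow> nat set \<Rightarrow> ('m \<Rightarrow>\<^sub>0 complex) \<Rightarrow> bool" where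
  "in_degs d S p \<longleftrightarrow> (\<forall>m\<in>supp p. d m \<in> S)"

lemma in_degs_0 [simp]: "in_degs d S 0"
  by (simp add: in_degs_def)

lemma in_degs_monom: "d m \<in> S \<Longrightarrow> in_degs d S (monom m z)"
  by (simp add: in_degs_def)

lemma in_degs_add: "in_degs d S p \<Longrightarrow> in_degs d S q \<Longrightarrow> in_degs d S (p + q)"
  using keys_add[of p q] by (auto simp: in_degs_def)

lemma in_degs_scale: "in_degs d S p \<Longrightarrow> in_degs d S (scale z p)"
  by (auto simp: in_degs_def in_keys_iff)

lemma in_degs_uminus: "in_degs d S p \<Longrightarrow> in_degs d S (- p)"
  by (auto simp: in_degs_def in_keys_iff)

lemma in_degs_diff: "in_degs d S p \<Longrightarrow> in_degs d S q \<Longrightarrow> in_degs d S (p - q)"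
  using in_degs_add[of d S p "- q"] by (simp add: in_degs_uminus)

lemma in_degs_sum: "(\<And>i. i \<in> K \<Longrightarrow> in_degs d S (f i)) \<Longrightarrow> in_degs d S (\<Sum>i\<in>K. f i)"
  by (induction K rule: infinite_finite_induct) (auto intro: in_degs_add)

lemma in_degs_mono: "in_degs d S p \<Longrightarrow> S \<subseteq> T \<Longrightarrow> in_degs d T p"
  by (auto simp: in_degs_def)

lemma in_degs_mult:
  assumes "\<And>a b. d (a + b) = d a + d b"
    and "in_degs d S p" "in_degs d T q" "\<And>s t. s \<in> S \<Longrightarrow> t \<in> T \<Longrightarrow> s + t \<in> R"
  shows "in_degs d R (p * q)"
  unfolding in_degs_def
proof
  fix m assume "m \<in> supp (p * q)"
  then obtain a b where "m = a + b" "a \<in> supp p" "b \<in> supp q"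
    using keys_mult[of p q] by blast
  then show "d m \<in> R" using assms by (simp add: in_degs_def)
qed

lemma in_degs_lin_ext:
  assumes "\<And>m. in_degs d' {d m} (\<phi> m)" "in_degs d S p"
  shows "in_degs d' S (lin_ext \<phi> p)"
  unfolding lin_ext_def
  by (intro in_degs_sum in_degs_scale in_degs_mono[OF assms(1)]) (use assms(2) in \<open>auto simp:
      in_degs_def\<close>)

lemma coeff_hom_part: "coeff (hom_part d n p) m = (if d m = n then coeff p m else 0)"
proof -
  have "coeff (hom_part d n p) m
      = (\<Sum>k | k \<in> supp p \<and> d k = n. if k = m then coeff p k else 0)"
    by (simp add: hom_part_def lookup_sum lookup_single when_def)
  also have "\<dots> = (if d m = n then coeff p m else 0)"
    by (simp add: in_keys_iff)
  finally show ?thesis .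
qed

lemma hom_part_add: "hom_part d n (p + q) = hom_part d n p + hom_part d n q"
  by (rule poly_mapping_eqI) (simp add: coeff_hom_part lookup_add)

lemma hom_part_diff: "hom_part d n (p - q) = hom_part d n p - hom_part d n q"
  by (rule poly_mapping_eqI) (simp add: coeff_hom_part lookup_minus)

lemma hom_part_scale: "hom_part d n (scale z p) = scale z (hom_part d n p)"
  by (rule poly_mapping_eqI) (simp add: coeff_hom_part)

lemma hom_part_0 [simp]: "hom_part d n 0 = 0"
  by (rule poly_mapping_eqI) (simp add: coeff_hom_part)

lemma hom_part_sum: "hom_part d n (\<Sum>i\<in>S. f i) = (\<Sum>i\<in>S. hom_part d n (f i))"
  by (induction S rule: infinite_finite_induct) (simp_all add: hom_part_add)

lemma hom_part_monom: "hom_part d n (monom m z) = (if d m = n then monom m z else 0)"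
  by (rule poly_mapping_eqI) (simp add: coeff_hom_part lookup_single when_def)

lemma in_degs_hom_part: "in_degs d {n} (hom_part d n p)"
  by (auto simp: in_degs_def in_keys_iff coeff_hom_part split: if_splits)

lemma hom_part_id: "in_degs d {n} p \<Longrightarrow> hom_part d n p = p"
  by (rule poly_mapping_eqI) (auto simp: coeff_hom_part in_degs_def in_keys_iff)

lemma hom_part_eq_0: "in_degs d S p \<Longrightarrow> n \<notin> S \<Longrightarrow> hom_part d n p = 0"
  by (rule poly_mapping_eqI) (auto simp: coeff_hom_part in_degs_def in_keys_iff)

lemma hom_part_lin_ext:
  assumes "\<And>m. in_degs d' {d m} (\<phi> m)"
  shows "hom_part d' n (lin_ext \<phi> p) = lin_ext \<phi> (hom_part d n p)"
proof (induction p rule: poly_induct)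
  case (monom m z)
  have "hom_part d' n (\<phi> m) = (if d m = n then \<phi> m else 0)"
    using hom_part_id[OF assms[of m]] hom_part_eq_0[OF assms[of m], of n] by auto
  then show ?case by (simp add: hom_part_scale hom_part_monom)
qed (simp add: hom_part_add lin_ext_add)

lemma hom_part_mult:
  assumes d: "\<And>a b. d (a + b) = d a + d b"
  shows "hom_part d n (p * q) = (\<Sum>i\<le>n. hom_part d i p * hom_part d (n - i) q)"
proof (induction p rule: poly_induct)
  case (monom a z)
  show ?case
  proof (induction q rule: poly_induct)
    case (monom b w)
    have "(\<Sum>i\<le>n. hom_part d i (monom a z) * hom_part d (n - i) (monom b w))
        = (\<Sum>i\<le>n. if i = d a then (if d b = n - i then monom (a + b) (z * w) else 0) else 0)"
      by (rule sum.cong) (auto simp: hom_part_monom mult_single)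
    then show ?case by (auto simp: mult_single hom_part_monom d)
  qed (simp add: hom_part_add distrib_left sum.distrib)
qed (simp add: hom_part_add distrib_right sum.distrib)

text \<open>If either factor of a term of the convolution drops below its top degree, the other would
have to exceed it.\<close>
lemma hom_part_mult_top:
  assumes d: "\<And>a b. d (a + b) = d a + d b"
    and p: "in_degs d {..i} p" and q: "in_degs d {..j} q"
  shows "hom_part d (i + j) (p * q) = hom_part d i p * hom_part d j q"
proof -
  have "hom_part d (i + j) (p * q)
      = (\<Sum>k\<le>i + j. if k = i then hom_part d k p * hom_part d (i + j - k) q else 0)"
    unfolding hom_part_mult[OF d]
  proof (rule sum.cong)
    fix k assume "k \<in> {..i + j}"
    show "hom_part d k p * hom_part d (i + j - k) q
        = (if k = i then hom_part d k p * hom_part d (i + j - k) q else 0)"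
    proof (cases "k < i")
      case True
      then show ?thesis using hom_part_eq_0[OF q, of "i + j - k"] by auto
    next
      case False
      then show ?thesis using hom_part_eq_0[OF p, of k] by auto
    qed
  qed simp
  then show ?thesis by simp
qed

lemma hom_part_mult_hom:
  assumes d: "\<And>a b. d (a + b) = d a + d b" and p: "in_degs d {i} p" and "i \<le> n"
  shows "hom_part d n (p * q) = p * hom_part d (n - i) q"
proof -
  have "hom_part d n (p * q) = (\<Sum>k\<le>n. if k = i then p * hom_part d (n - i) q else 0)"
    unfolding hom_part_mult[OF d]
    by (rule sum.cong) (auto simp: hom_part_id[OF p] hom_part_eq_0[OF p])
  then show ?thesis using assms(3) by simp
qed

lemma hom_part_decomposition:
  assumes "\<And>m. m \<in> supp p \<Longrightarrow> d m \<in> K" "finite K"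
  shows "p = (\<Sum>n\<in>K. hom_part d n p)"
proof (rule poly_mapping_eqI)
  fix k
  have "coeff (\<Sum>n\<in>K. hom_part d n p) k = (\<Sum>n\<in>K. if d k = n then coeff p k else 0)"
    by (simp only: lookup_sum coeff_hom_part)
  also have "\<dots> = coeff p k"
    using assms by (cases "k \<in> supp p") (simp_all add: in_keys_iff)
  finally show "coeff p k = coeff (\<Sum>n\<in>K. hom_part d n p) k" by simp
qed

lemma hom_part_inject:
  assumes "\<And>n. hom_part d n p = hom_part d n q"
  shows "p = q"
proof (rule poly_mapping_eqI)
  fix k
  show "coeff p k = coeff q k"
    using arg_cong[OF assms[of "d k"], of "\<lambda>r. coeff r k"] by (simp add: coeff_hom_part)
qed

section \<open>The free algebra, commuting variables and the action of matrices\<close>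

lemma nc_deg_add [simp]: "nc_deg (v + w) = nc_deg v + nc_deg w"
  by (simp add: nc_deg_def plus_word_def)

lemma c_deg_add [simp]: "c_deg (a + b) = c_deg a + c_deg b"
  by (simp add: c_deg_def)

lemma letters_add [simp]: "letters (v + w) = letters v @ letters w"
  by (simp add: plus_word_def)

lemma letters_0 [simp]: "letters 0 = []"
  by (simp add: zero_word_def)

lemma word_add: "Word xs + Word ys = Word (xs @ ys)"
  by (simp add: plus_word_def)

definition nc_word :: "var list \<Rightarrow> nc_poly" where
  "nc_word xs = monom (Word xs) 1"

lemma nc_word_append: "nc_word (xs @ ys) = nc_word xs * nc_word ys"
  by (simp add: nc_word_def mult_single word_add)

lemma nc_word_Nil [simp]: "nc_word [] = 1"
  by (simp add: nc_word_def flip: zero_word_def)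

lemma nc_var_eq: "nc_var x = nc_word [x]"
  by (simp add: nc_var_def nc_word_def)

lemma nc_word_Cons: "nc_word (x # xs) = nc_var x * nc_word xs"
  using nc_word_append[of "[x]" xs] by (simp add: nc_var_eq)

lemma monom_eq_nc_word: "monom w z = scale z (nc_word (letters w))"
  by (simp add: nc_word_def)

lemma nc_induct [case_names word scale add]:
  fixes p :: nc_poly
  assumes "\<And>xs. P (nc_word xs)" "\<And>z p. P p \<Longrightarrow> P (scale z p)" "\<And>p q. P p \<Longrightarrow> P q \<Longrightarrow> P (p + q)"
  shows "P p"
  by (induction p rule: poly_induct) (auto simp: monom_eq_nc_word assms)

lemma in_degs_nc_word: "in_degs nc_deg {length xs} (nc_word xs)"
  by (simp add: nc_word_def nc_deg_def in_degs_monom)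

lemma nc_act_eq: "nc_act g = lin_ext (\<lambda>w. prod_list (map (linear_image nc_var g) (letters w)))"
  by (rule ext) (simp add: nc_act_def lin_ext_def)

lemma abelianize_eq: "abelianize = lin_ext (\<lambda>w. prod_list (map c_var (letters w)))"
  by (rule ext) (simp add: abelianize_def lin_ext_def)

lemma c_act_eq: "c_act g = lin_ext (\<lambda>(i, j). linear_image c_var g U ^ i * linear_image c_var g V
    ^ j)"
  by (rule ext) (simp add: c_act_def lin_ext_def case_prod_unfold)

lemma nc_act_add: "nc_act g (p + q) = nc_act g p + nc_act g q"
  by (simp add: nc_act_eq lin_ext_add)

lemma nc_act_diff: "nc_act g (p - q) = nc_act g p - nc_act g q"
  by (simp add: nc_act_eq lin_ext_diff)

lemma nc_act_0 [simp]: "nc_act g 0 = 0"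
  by (simp add: nc_act_eq)

lemma nc_act_scale: "nc_act g (scale z p) = scale z (nc_act g p)"
  by (simp add: nc_act_eq lin_ext_scale)

lemma nc_act_sum: "nc_act g (\<Sum>i\<in>S. f i) = (\<Sum>i\<in>S. nc_act g (f i))"
  by (simp add: nc_act_eq lin_ext_sum)

lemma nc_act_mult: "nc_act g (p * q) = nc_act g p * nc_act g q"
  by (simp add: nc_act_eq lin_ext_mult)

lemma nc_act_nc_word: "nc_act g (nc_word xs) = prod_list (map (linear_image nc_var g) xs)"
  by (simp add: nc_act_eq nc_word_def)

lemma nc_act_var: "nc_act g (nc_var x) = linear_image nc_var g x"
  using nc_act_nc_word[of g "[x]"] by (simp add: nc_var_eq)

lemma nc_act_1 [simp]: "nc_act g 1 = 1"
  using nc_act_nc_word[of g "[]"] by simp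

lemma nc_act_id [simp]: "nc_act (mat 1) p = p"
proof (induction p rule: nc_induct)
  case (word xs)
  have "linear_image nc_var (mat 1) x = nc_var x" for x
    by (cases x) (simp_all add: linear_image_def mat_def)
  then have "prod_list (map (linear_image nc_var (mat 1)) xs) = nc_word xs"
    by (induction xs) (simp_all add: nc_word_Cons)
  then show ?case by (simp add: nc_act_nc_word)
qed (simp_all add: nc_act_add nc_act_scale)

lemma nc_act_compose: "nc_act g (nc_act h p) = nc_act (g ** h) p"
proof (induction p rule: nc_induct)
  case (word xs)
  have "nc_act g (linear_image nc_var h x) = linear_image nc_var (g ** h) x" for x
    by (cases x) (simp_all add: linear_image_def nc_act_add nc_act_scale nc_act_var
        matrix_matrix_mult_def sum_2 scale_add_right scale_add_left algebra_simps)
  then show ?case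
    by (induction xs) (simp_all add: nc_act_nc_word nc_act_mult)
qed (simp_all add: nc_act_add nc_act_scale)

lemma in_degs_prod_letters:
  assumes "\<And>a b. d (a + b) = d a + d b" "d 0 = 0" "\<And>x. in_degs d {1} (L x)"
  shows "in_degs d {length xs} (prod_list (map L xs))"
proof (induction xs)
  case Nil
  show ?case using assms(2) by (simp add: in_degs_def)
next
  case (Cons x xs)
  show ?case using in_degs_mult[OF assms(1,3) Cons, where R = "{length (x # xs)}"] by simp
qed

lemma in_degs_linear_image:
  "(\<And>x. in_degs d {1} (X x)) \<Longrightarrow> in_degs d {1} (linear_image X g x)"
  by (cases x) (simp_all add: linear_image_def in_degs_add in_degs_scale)

lemma in_degs_nc_var: "in_degs nc_deg {1} (nc_var x)"
  using in_degs_nc_word[of "[x]"] by (simp add: nc_var_eq)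

lemma in_degs_c_var: "in_degs c_deg {1} (c_var x)"
  by (cases x) (simp_all add: c_var_def in_degs_monom c_deg_def)

lemma nc_deg_0 [simp]: "nc_deg 0 = 0"
  by (simp add: nc_deg_def)

lemma c_deg_0 [simp]: "c_deg 0 = 0"
  by (simp add: c_deg_def)

lemma nc_act_basis_deg:
  "in_degs nc_deg {nc_deg w} (prod_list (map (linear_image nc_var g) (letters w)))"
  using in_degs_prod_letters[of nc_deg "linear_image nc_var g"]
  by (simp add: nc_deg_def[of w] in_degs_linear_image in_degs_nc_var del: One_nat_def)

lemma in_degs_nc_act: "in_degs nc_deg S p \<Longrightarrow> in_degs nc_deg S (nc_act g p)"
  unfolding nc_act_eq by (rule in_degs_lin_ext[OF nc_act_basis_deg])

lemma hom_part_nc_act: "hom_part nc_deg n (nc_act g p) = nc_act g (hom_part nc_deg n p)"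
  unfolding nc_act_eq by (rule hom_part_lin_ext[OF nc_act_basis_deg])

text \<open>The part of the relator of degree 2.\<close>
definition comm_uv :: nc_poly where
  "comm_uv = nc_var U * nc_var V - nc_var V * nc_var U"

text \<open>A matrix multiplies the commutator of the two variables by its determinant.\<close>
lemma nc_act_comm_uv: "det g = 1 \<Longrightarrow> nc_act g comm_uv = comm_uv"
proof -
  assume "det g = 1"
  have "nc_act g comm_uv = scale (det g) comm_uv"
    by (rule poly_mapping_eqI)
      (simp add: comm_uv_def nc_act_diff nc_act_mult nc_act_var linear_image_def det_2
        distrib_left distrib_right scale_mult_left scale_mult_right lookup_add lookup_minus
        right_diff_distrib left_diff_distrib mult_ac)
  then show ?thesis using \<open>det g = 1\<close> by simp
qed

lemma in_degs_comm_uv: "in_degs nc_deg {2} comm_uv"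
  unfolding comm_uv_def using in_degs_mult[OF nc_deg_add in_degs_nc_var in_degs_nc_var, where R
      = "{2}"]
  by (intro in_degs_diff) auto

lemma abelianize_add: "abelianize (p + q) = abelianize p + abelianize q"
  by (simp add: abelianize_eq lin_ext_add)

lemma abelianize_diff: "abelianize (p - q) = abelianize p - abelianize q"
  by (simp add: abelianize_eq lin_ext_diff)

lemma abelianize_0 [simp]: "abelianize 0 = 0"
  by (simp add: abelianize_eq)

lemma abelianize_scale: "abelianize (scale z p) = scale z (abelianize p)"
  by (simp add: abelianize_eq lin_ext_scale)

lemma abelianize_sum: "abelianize (\<Sum>i\<in>S. f i) = (\<Sum>i\<in>S. abelianize (f i))"
  by (simp add: abelianize_eq lin_ext_sum)

lemma abelianize_mult: "abelianize (p * q) = abelianize p * abelianize q"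
  by (simp add: abelianize_eq lin_ext_mult)

lemma abelianize_nc_word: "abelianize (nc_word xs) = prod_list (map c_var xs)"
  by (simp add: abelianize_eq nc_word_def)

lemma abelianize_1 [simp]: "abelianize 1 = 1"
  using abelianize_nc_word[of "[]"] by simp

lemma abelianize_var: "abelianize (nc_var x) = c_var x"
  using abelianize_nc_word[of "[x]"] by (simp add: nc_var_eq)

lemma abelianize_comm_uv [simp]: "abelianize comm_uv = 0"
  by (simp add: comm_uv_def abelianize_diff abelianize_mult mult.commute)

lemma abelianize_basis_deg: "in_degs c_deg {nc_deg w} (prod_list (map c_var (letters w)))"
  using in_degs_prod_letters[of c_deg c_var]
  by (simp add: nc_deg_def[of w] in_degs_c_var del: One_nat_def)

lemma in_degs_abelianize: "in_degs nc_deg S p \<Longrightarrow> in_degs c_deg S (abelianize p)"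
  unfolding abelianize_eq by (rule in_degs_lin_ext[OF abelianize_basis_deg])

lemma hom_part_abelianize: "hom_part c_deg n (abelianize p) = abelianize (hom_part nc_deg n p)"
  unfolding abelianize_eq by (rule hom_part_lin_ext[OF abelianize_basis_deg])

lemma c_act_add: "c_act g (p + q) = c_act g p + c_act g q"
  by (simp add: c_act_eq lin_ext_add)

lemma c_act_diff: "c_act g (p - q) = c_act g p - c_act g q"
  by (simp add: c_act_eq lin_ext_diff)

lemma c_act_0 [simp]: "c_act g 0 = 0"
  by (simp add: c_act_eq)

lemma c_act_scale: "c_act g (scale z p) = scale z (c_act g p)"
  by (simp add: c_act_eq lin_ext_scale)

lemma c_act_mult: "c_act g (p * q) = c_act g p * c_act g q"
  unfolding c_act_eq by (rule lin_ext_mult) (auto simp: power_add mult_ac)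

lemma c_act_1 [simp]: "c_act g 1 = 1"
  by (simp add: c_act_eq zero_prod_def mult_single flip: single_one)

lemma c_act_var: "c_act g (c_var x) = linear_image c_var g x"
  by (cases x) (simp_all add: c_act_eq c_var_def)

lemma in_degs_power:
  assumes "\<And>a b. d (a + b) = d a + d b" "d 0 = 0" "in_degs d {1} p"
  shows "in_degs d {n} (p ^ n)"
  using in_degs_prod_letters[of d "\<lambda>_. p" "replicate n undefined", OF assms(1,2,3)]
  by (simp add: prod_list_replicate map_replicate_const)

lemma c_act_basis_deg:
  "in_degs c_deg {c_deg m} (case m of (i, j) \<Rightarrow> linear_image c_var g U ^ i * linear_image c_var g
      V ^ j)"
proof (cases m)
  case (Pair i j)
  have L: "in_degs c_deg {k} (linear_image c_var g x ^ k)" for x k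
    by (rule in_degs_power) (simp_all only: c_deg_add c_deg_0 in_degs_linear_image in_degs_c_var)
  show ?thesis
    using in_degs_mult[OF c_deg_add L[of i U] L[of j V], where R = "{i + j}"]
    by (simp add: Pair c_deg_def)
qed

lemma hom_part_c_act: "hom_part c_deg n (c_act g p) = c_act g (hom_part c_deg n p)"
  unfolding c_act_eq by (rule hom_part_lin_ext[OF c_act_basis_deg])

lemma abelianize_nc_act: "abelianize (nc_act g p) = c_act g (abelianize p)"
proof (induction p rule: nc_induct)
  case (word xs)
  have "abelianize (linear_image nc_var g x) = c_act g (c_var x)" for x
    by (cases x) (simp_all add: linear_image_def abelianize_add abelianize_scale abelianize_var
        c_act_var)
  then show ?case
    by (induction xs) (simp_all add: nc_act_nc_word abelianize_nc_word abelianize_mult c_act_mult)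
qed (simp_all add: nc_act_add nc_act_scale abelianize_add abelianize_scale c_act_add c_act_scale)

text \<open>The words without \<open>uv\<close> as a subword: exactly one for each commutative monomial. The
letters are in this order because the relator is used to replace \<open>uv\<close> by \<open>vu + c\<close>.\<close>
definition normal_word :: "nat \<Rightarrow> nat \<Rightarrow> var list" where
  "normal_word a b = replicate a V @ replicate b U"

lemma abelianize_nc_word_monom: "abelianize (nc_word xs) = monom (count_list xs U, count_list xs
    V) 1"
  unfolding abelianize_nc_word
proof (induction xs)
  case (Cons x xs)
  then show ?case by (cases x) (simp_all add: c_var_def mult_single)
qed (simp add: zero_prod_def flip: single_one)

lemma count_list_replicate: "count_list (replicate n x) y = (if x = y then n else 0)"
  by (induction n) auto

definition normal_form :: "c_poly \<Rightarrow> nc_poly" where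
  "normal_form = lin_ext (\<lambda>(i, j). nc_word (normal_word j i))"

lemma normal_form_add: "normal_form (p + q) = normal_form p + normal_form q"
  by (simp add: normal_form_def lin_ext_add)

lemma normal_form_scale: "normal_form (scale z p) = scale z (normal_form p)"
  by (simp add: normal_form_def lin_ext_scale)

lemma normal_form_0 [simp]: "normal_form 0 = 0"
  by (simp add: normal_form_def)

lemma abelianize_normal_form [simp]: "abelianize (normal_form f) = f"
proof (induction f rule: poly_induct)
  case (monom m z)
  then show ?case
    by (cases m) (simp add: normal_form_def abelianize_scale abelianize_nc_word_monom
        normal_word_def
        count_list_replicate)
qed (simp add: normal_form_add abelianize_add)

lemma normal_form_abelianize_nc_word:
  "normal_form (abelianize (nc_word xs)) = nc_word (normal_word (count_list xs V) (count_list xs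
      U))"
  by (simp add: normal_form_def abelianize_nc_word_monom)

lemma in_degs_normal_form: "in_degs c_deg S f \<Longrightarrow> in_degs nc_deg S (normal_form f)"
  unfolding normal_form_def
  by (rule in_degs_lin_ext)
    (auto simp: c_deg_def normal_word_def add.commute intro: in_degs_mono[OF in_degs_nc_word])

text \<open>Every word is obtained from a sorted one by exchanging neighbours \<open>vu\<close> into \<open>uv\<close>. The
letters of the word are inserted from left to right behind a sorted prefix.\<close>
lemma swap_induct:
  assumes normal: "\<And>a b. P (normal_word a b)"
    and swap: "\<And>xs ys. P (xs @ [V, U] @ ys) \<Longrightarrow> P (xs @ [U, V] @ ys)"
  shows "P xs"
proof -
  have move: "P (replicate a V @ replicate k U @ [V] @ replicate l U @ ys)"
    if "P (replicate (Suc a) V @ replicate (k + l) U @ ys)" for a k l ys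
    using that
  proof (induction k arbitrary: l)
    case 0
    then show ?case by (simp add: replicate_app_Cons_same)
  next
    case (Suc k)
    from Suc.IH[of "Suc l"] Suc.prems
    have "P ((replicate a V @ replicate k U) @ [V, U] @ replicate l U @ ys)" by simp
    from swap[OF this] show ?case by (simp add: replicate_app_Cons_same)
  qed
  have "P (replicate a V @ replicate b U @ ys)" for a b ys
  proof (induction ys arbitrary: a b)
    case Nil
    show ?case using normal[of a b] by (simp add: normal_word_def)
  next
    case (Cons y ys)
    show ?case
    proof (cases y)
      case U
      show ?thesis using Cons[of a "Suc b"] by (simp add: U replicate_app_Cons_same)
    next
      case V
      show ?thesis using move[of a b 0 ys] Cons[of "Suc a" b] by (simp add: V)
    qed
  qed
  from this[of 0 0] show ?thesis by simp
qed

section \<open>Complex algebras and their images\<close>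

lemma cring_complex_field: "cring complex_field"
  by (rule cringI, rule abelian_groupI)
    (auto simp: complex_field_def algebra_simps intro!: comm_monoidI exI[of _ "- x" for x])

lemma C_algebraI:
  fixes A :: "(complex, 'a) module" (structure)
  assumes "\<And>x y. x \<in> carrier A \<Longrightarrow> y \<in> carrier A \<Longrightarrow> x \<oplus> y \<in> carrier A"
    and "\<zero> \<in> carrier A"
    and "\<And>x y z. x \<in> carrier A \<Longrightarrow> y \<in> carrier A \<Longrightarrow> z \<in> carrier A \<Longrightarrow> (x \<oplus> y) \<oplus> z = x \<oplus> (y \<oplus> z)"
    and "\<And>x y. x \<in> carrier A \<Longrightarrow> y \<in> carrier A \<Longrightarrow> x \<oplus> y = y \<oplus> x"
    and "\<And>x. x \<in> carrier A \<Longrightarrow> \<zero> \<oplus> x = x"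
    and "\<And>x. x \<in> carrier A \<Longrightarrow> \<exists>y\<in>carrier A. y \<oplus> x = \<zero>"
    and "\<And>x y. x \<in> carrier A \<Longrightarrow> y \<in> carrier A \<Longrightarrow> x \<otimes> y \<in> carrier A"
    and "\<one> \<in> carrier A"
    and "\<And>x y z. x \<in> carrier A \<Longrightarrow> y \<in> carrier A \<Longrightarrow> z \<in> carrier A \<Longrightarrow> (x \<otimes> y) \<otimes> z = x \<otimes> (y \<otimes> z)"
    and "\<And>x. x \<in> carrier A \<Longrightarrow> \<one> \<otimes> x = x"
    and "\<And>x. x \<in> carrier A \<Longrightarrow> x \<otimes> \<one> = x"
    and "\<And>x y z. x \<in> carrier A \<Longrightarrow> y \<in> carrier A \<Longrightarrow> z \<in> carrier A \<Longrightarrow> (x \<oplus> y) \<otimes> z = x \<otimes> z \<oplus> y \<otimes> z"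
    and "\<And>x y z. x \<in> carrier A \<Longrightarrow> y \<in> carrier A \<Longrightarrow> z \<in> carrier A \<Longrightarrow> z \<otimes> (x \<oplus> y) = z \<otimes> x \<oplus> z \<otimes> y"
    and "\<And>s x. x \<in> carrier A \<Longrightarrow> s \<odot> x \<in> carrier A"
    and "\<And>s t x. x \<in> carrier A \<Longrightarrow> (s + t) \<odot> x = s \<odot> x \<oplus> t \<odot> x"
    and "\<And>s x y. x \<in> carrier A \<Longrightarrow> y \<in> carrier A \<Longrightarrow> s \<odot> (x \<oplus> y) = s \<odot> x \<oplus> s \<odot> y"
    and "\<And>s t x. x \<in> carrier A \<Longrightarrow> (s * t) \<odot> x = s \<odot> (t \<odot> x)"
    and "\<And>x. x \<in> carrier A \<Longrightarrow> 1 \<odot> x = x"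
    and "\<And>s x y. x \<in> carrier A \<Longrightarrow> y \<in> carrier A \<Longrightarrow> (s \<odot> x) \<otimes> y = s \<odot> (x \<otimes> y)"
    and "\<And>s x y. x \<in> carrier A \<Longrightarrow> y \<in> carrier A \<Longrightarrow> x \<otimes> (s \<odot> y) = s \<odot> (x \<otimes> y)"
  shows "C_algebra A"
proof -
  have ab: "abelian_group A" by (rule abelian_groupI) (use assms in auto)
  have "ring A" by (rule ringI[OF ab monoidI]) (use assms in auto)
  moreover have "Module.module complex_field A"
    by (rule Module.moduleI[OF cring_complex_field ab]) (use assms in \<open>auto simp:
        complex_field_def\<close>)
  ultimately show ?thesis
    by (intro C_algebra.intro C_algebra_axioms.intro) (use assms in auto)
qed

lemma poly_algebra_simps [simp]:
  "carrier (poly_algebra S) = S" "mult (poly_algebra S) = (*)" "one (poly_algebra S) = 1"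
  "zero (poly_algebra S) = 0" "add (poly_algebra S) = (+)" "smult (poly_algebra S) = scale"
  by (simp_all add: poly_algebra_def)

lemma SL2_sub_simps [simp]:
  "carrier (SL2_sub G) = G" "mult (SL2_sub G) = (**)" "one (SL2_sub G) = mat 1"
  by (simp_all add: SL2_def)

lemma C_algebra_poly_algebra:
  fixes S :: "('m::monoid_add \<Rightarrow>\<^sub>0 complex) set"
  assumes "1 \<in> S" "\<And>p q. p \<in> S \<Longrightarrow> q \<in> S \<Longrightarrow> p + q \<in> S"
    "\<And>p q. p \<in> S \<Longrightarrow> q \<in> S \<Longrightarrow> p * q \<in> S" "\<And>z p. p \<in> S \<Longrightarrow> scale z p \<in> S"
  shows "C_algebra (poly_algebra S)"
proof -
  have m: "- p \<in> S" if "p \<in> S" for p using assms(4)[OF that, of "- 1"] by (simp add: scale_uminus)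
  have z: "0 \<in> S" using assms(4)[OF assms(1), of 0] by simp
  show ?thesis
    by (rule C_algebraI) (auto simp: assms z m algebra_simps scale_mult_left
        scale_mult_right scale_add_right scale_add_left intro!: bexI[of _ "- x" for x])
qed

section \<open>The smash product of the free algebra with a finite group\<close>

locale finite_SL2 =
  fixes G :: "(complex^2^2) set"
  assumes finite_G: "finite G" and one_G: "mat 1 \<in> G"
    and mult_G: "g \<in> G \<Longrightarrow> h \<in> G \<Longrightarrow> g ** h \<in> G"
    and inv_ex_G: "g \<in> G \<Longrightarrow> \<exists>h\<in>G. g ** h = mat 1 \<and> h ** g = mat 1"
    and det_G: "g \<in> G \<Longrightarrow> det g = 1"
begin

abbreviation ginv :: "complex^2^2 \<Rightarrow> complex^2^2" where "ginv \<equiv> matrix_inv"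

lemma ginv:
  assumes "g \<in> G"
  shows "ginv g \<in> G" "g ** ginv g = mat 1" "ginv g ** g = mat 1"
proof -
  from inv_ex_G[OF assms] obtain h where h: "h \<in> G" "g ** h = mat 1" "h ** g = mat 1" by auto
  have *: "g ** ginv g = mat 1 \<and> ginv g ** g = mat 1"
    unfolding matrix_inv_def by (rule someI[of _ h]) (use h in auto)
  then show "g ** ginv g = mat 1" "ginv g ** g = mat 1" by auto
  have "ginv g = (h ** g) ** ginv g" by (simp add: h)
  also have "\<dots> = h ** (g ** ginv g)" by (simp add: matrix_mul_assoc)
  also have "\<dots> = h" by (simp add: *)
  finally show "ginv g \<in> G" using h by simp
qed

lemma cancel_G [simp]:
  assumes "g \<in> G"
  shows "ginv g ** (g ** h) = h" "g ** (ginv g ** h) = h" "(h ** g) ** ginv g = h" "(h ** ginv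
      g) ** g = h"
  using ginv[OF assms] by (simp_all add: matrix_mul_assoc) (simp_all flip: matrix_mul_assoc)

lemma ginv_1 [simp]: "ginv (mat 1) = mat 1"
  using ginv(2)[OF one_G] by simp

lemma ginv_mult: "g \<in> G \<Longrightarrow> h \<in> G \<Longrightarrow> ginv (g ** h) = ginv h ** ginv g"
  by (metis cancel_G(1) cancel_G(3) ginv(1) mult_G ginv(3) matrix_mul_lid)

lemma mult_G_iff: "g \<in> G \<Longrightarrow> g ** h \<in> G \<longleftrightarrow> h \<in> G"
  by (metis cancel_G(1) ginv(1) mult_G)

lemma ginv_mult_eq_1: "g \<in> G \<Longrightarrow> ginv g ** k = mat 1 \<longleftrightarrow> k = g"
  by (metis cancel_G(2) ginv(3) matrix_mul_rid)

lemma sum_G_left: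
  assumes "g \<in> G"
  shows "(\<Sum>h\<in>G. F (g ** h)) = (\<Sum>h\<in>G. F h)"
  by (rule sum.reindex_bij_witness[of _ "\<lambda>h. ginv g ** h" "\<lambda>h. g ** h"])
    (use assms in \<open>auto simp: mult_G ginv\<close>)

lemma sum_G_right:
  assumes "g \<in> G"
  shows "(\<Sum>h\<in>G. F (h ** g)) = (\<Sum>h\<in>G. F h)"
  by (rule sum.reindex_bij_witness[of _ "\<lambda>h. h ** ginv g" "\<lambda>h. h ** g"])
    (use assms in \<open>auto simp: mult_G ginv\<close>)

lemma card_G: "of_nat (card G) \<noteq> (0::complex)"
  using finite_G one_G by auto

abbreviation A where "A \<equiv> nc_smash G"

text \<open>Left multiplication by the group element \<open>g\<close> in the smash product.\<close>
definition group_act :: "complex^2^2 \<Rightarrow> (complex^2^2 \<Rightarrow> nc_poly) \<Rightarrow> complex^2^2 \<Rightarrow> nc_poly" where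
  "group_act g a = (\<lambda>k. nc_act g (a (ginv g ** k)))"

lemma carrier_A: "carrier A = {a. \<forall>g. g \<notin> G \<longrightarrow> a g = 0}"
  by (simp add: nc_smash_def smash_product_def)

lemma outside: "a \<in> carrier A \<Longrightarrow> g \<notin> G \<Longrightarrow> a g = 0"
  by (simp add: carrier_A)

lemma A_simps:
  "\<one>\<^bsub>A\<^esub> = (\<lambda>g. if g = mat 1 then 1 else 0)" "\<zero>\<^bsub>A\<^esub> = (\<lambda>g. 0)"
  "a \<oplus>\<^bsub>A\<^esub> b = (\<lambda>g. a g + b g)" "z \<odot>\<^bsub>A\<^esub> a = (\<lambda>g. scale z (a g))"
  by (simp_all add: nc_smash_def smash_product_def cong: if_cong)

lemma finsum_poly_algebra: "finsum (poly_algebra UNIV) f S = (\<Sum>i\<in>S. f i)"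
  if "finite S" for f :: "'i \<Rightarrow> 'm::monoid_add \<Rightarrow>\<^sub>0 complex"
proof -
  interpret C_algebra "poly_algebra (UNIV :: ('m \<Rightarrow>\<^sub>0 complex) set)"
    by (rule C_algebra_poly_algebra) auto
  show ?thesis using that by induction auto
qed

text \<open>The sum runs over all of \<open>G\<close>, for every \<open>k\<close>: outside \<open>G\<close> both sides vanish. Hence no case
distinctions on supports are needed below.\<close>
lemma smash_mult_sum:
  fixes a b :: "complex^2^2 \<Rightarrow> 'm::monoid_add \<Rightarrow>\<^sub>0 complex"
  assumes b: "\<And>g. g \<notin> G \<Longrightarrow> b g = 0" and act: "\<And>g. \<rho> g 0 = 0"
  shows "(a \<otimes>\<^bsub>smash_product (poly_algebra UNIV) (SL2_sub G) \<rho>\<^esub> b) k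
    = (\<Sum>g\<in>G. a g * \<rho> g (b (ginv g ** k)))"
proof -
  let ?S = "{(g, h). (g, h) \<in> G \<times> G \<and> g ** h = k}"
  have "finite ?S" by (rule finite_subset[of _ "G \<times> G"]) (auto simp: finite_G)
  then have "(a \<otimes>\<^bsub>smash_product (poly_algebra UNIV) (SL2_sub G) \<rho>\<^esub> b) k
      = (\<Sum>(g, h)\<in>?S. a g * \<rho> g (b h))"
    by (simp add: smash_product_def finsum_poly_algebra case_prod_unfold)
  also have "\<dots> = (\<Sum>g \<in> {g \<in> G. ginv g ** k \<in> G}. a g * \<rho> g (b (ginv g ** k)))"
    by (rule sum.reindex_bij_witness[of _ "\<lambda>g. (g, ginv g ** k)" fst]) auto
  also have "\<dots> = (\<Sum>g\<in>G. a g * \<rho> g (b (ginv g ** k)))"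
    by (rule sum.mono_neutral_left) (auto simp: finite_G b act)
  finally show ?thesis .
qed

text \<open>Product in terms of left multiplications: by coefficients, which is pointwise, and by
group elements.\<close>
lemma mult_A: "b \<in> carrier A \<Longrightarrow> a \<otimes>\<^bsub>A\<^esub> b = (\<lambda>k. \<Sum>g\<in>G. a g * group_act g b k)"
  unfolding nc_smash_def group_act_def
  by (rule ext, rule smash_mult_sum) (auto simp: carrier_A simp flip: nc_smash_def)

lemma group_act_carrier: "g \<in> G \<Longrightarrow> a \<in> carrier A \<Longrightarrow> group_act g a \<in> carrier A"
  by (simp add: carrier_A group_act_def mult_G_iff ginv)

lemma group_act_add: "group_act g (\<lambda>k. a k + b k) = (\<lambda>k. group_act g a k + group_act g b k)"
  by (simp add: group_act_def nc_act_add)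

lemma group_act_scale: "group_act g (\<lambda>k. scale z (a k)) = (\<lambda>k. scale z (group_act g a k))"
  by (simp add: group_act_def nc_act_scale)

lemma group_act_0 [simp]: "group_act g (\<lambda>k. 0) = (\<lambda>k. 0)"
  by (simp add: group_act_def)

lemma group_act_sum: "group_act g (\<lambda>k. \<Sum>i\<in>S. f i k) = (\<lambda>k. \<Sum>i\<in>S. group_act g (f i) k)"
  by (simp add: group_act_def nc_act_sum)

lemma group_act_lmul: "group_act g (\<lambda>k. p * a k) = (\<lambda>k. nc_act g p * group_act g a k)"
  by (simp add: group_act_def nc_act_mult)

lemma group_act_group_act: "g \<in> G \<Longrightarrow> h \<in> G \<Longrightarrow> group_act g (group_act h a) = group_act (g ** h) a"
  by (simp add: group_act_def nc_act_compose ginv_mult matrix_mul_assoc)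

lemma group_act_1 [simp]: "group_act (mat 1) a = a"
  by (simp add: group_act_def)

lemma mult_A_carrier: "a \<otimes>\<^bsub>A\<^esub> b \<in> carrier A" if "b \<in> carrier A"
  using group_act_carrier[OF _ that] by (simp add: mult_A[OF that] carrier_A)

lemma mult_A_assoc:
  assumes "b \<in> carrier A" "d \<in> carrier A"
  shows "(a \<otimes>\<^bsub>A\<^esub> b) \<otimes>\<^bsub>A\<^esub> d = a \<otimes>\<^bsub>A\<^esub> (b \<otimes>\<^bsub>A\<^esub> d)"
proof
  fix k
  have "((a \<otimes>\<^bsub>A\<^esub> b) \<otimes>\<^bsub>A\<^esub> d) k = (\<Sum>x\<in>G. \<Sum>g\<in>G. a g * group_act g b x * group_act x d k)"
    using assms by (simp add: mult_A sum_distrib_right)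
  also have "\<dots> = (\<Sum>g\<in>G. \<Sum>x\<in>G. a g * group_act g b x * group_act x d k)"
    by (rule sum.swap)
  also have "\<dots> = (\<Sum>g\<in>G. \<Sum>x\<in>G. a g * group_act g b (g ** x) * group_act (g ** x) d k)"
    by (rule sum.cong[OF refl], rule sum_G_left[symmetric])
  also have "\<dots> = (\<Sum>g\<in>G. a g * group_act g (b \<otimes>\<^bsub>A\<^esub> d) k)"
    unfolding mult_A[OF assms(2)] group_act_sum sum_distrib_left
  proof (intro sum.cong refl)
    fix g x assume gx: "g \<in> G" "x \<in> G"
    have "group_act g (\<lambda>k. b x * group_act x d k) = (\<lambda>k. nc_act g (b x) * group_act (g ** x) d k)"
      by (simp add: group_act_lmul group_act_group_act gx)
    then show "a g * group_act g b (g ** x) * group_act (g ** x) d k = a g * group_act g (\<lambda>k. b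
        x * group_act x d k) k"
      using gx by (simp add: group_act_def mult.assoc)
  qed
  also have "\<dots> = (a \<otimes>\<^bsub>A\<^esub> (b \<otimes>\<^bsub>A\<^esub> d)) k"
    using mult_A_carrier[OF assms(2), of b] by (simp add: mult_A)
  finally show "((a \<otimes>\<^bsub>A\<^esub> b) \<otimes>\<^bsub>A\<^esub> d) k = (a \<otimes>\<^bsub>A\<^esub> (b \<otimes>\<^bsub>A\<^esub> d)) k" .
qed

lemma smash_of_algebra_mult:
  "b \<in> carrier A \<Longrightarrow> smash_of_algebra (poly_algebra UNIV) (SL2_sub G) p \<otimes>\<^bsub>A\<^esub> b = (\<lambda>k. p * b k)"
proof
  fix k assume b: "b \<in> carrier A"
  have "(smash_of_algebra (poly_algebra UNIV) (SL2_sub G) p \<otimes>\<^bsub>A\<^esub> b) k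
      = (\<Sum>g\<in>G. if g = mat 1 then p * group_act g b k else 0)"
    unfolding mult_A[OF b] by (rule sum.cong) (auto simp: smash_of_algebra_def)
  then show "(smash_of_algebra (poly_algebra UNIV) (SL2_sub G) p \<otimes>\<^bsub>A\<^esub> b) k = p * b k"
    by (simp add: finite_G one_G)
qed

lemma one_A_eq: "\<one>\<^bsub>A\<^esub> = smash_of_algebra (poly_algebra UNIV) (SL2_sub G) 1"
  by (simp add: A_simps smash_of_algebra_def cong: if_cong)

lemma one_A_carrier: "\<one>\<^bsub>A\<^esub> \<in> carrier A"
  using one_G by (auto simp: carrier_A A_simps)

lemma group_act_one: "g \<in> G \<Longrightarrow> group_act g \<one>\<^bsub>A\<^esub> k = (if k = g then 1 else 0)"
  by (simp add: A_simps group_act_def ginv_mult_eq_1)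

lemma mult_A_one: "a \<in> carrier A \<Longrightarrow> a \<otimes>\<^bsub>A\<^esub> \<one>\<^bsub>A\<^esub> = a"
proof
  fix k assume a: "a \<in> carrier A"
  have "(a \<otimes>\<^bsub>A\<^esub> \<one>\<^bsub>A\<^esub>) k = (\<Sum>g\<in>G. if g = k then a g else 0)"
    unfolding mult_A[OF one_A_carrier] by (rule sum.cong) (auto simp: group_act_one)
  then show "(a \<otimes>\<^bsub>A\<^esub> \<one>\<^bsub>A\<^esub>) k = a k" using outside[OF a] by (auto simp: finite_G)
qed

lemma C_algebra_A: "C_algebra A"
proof (rule C_algebraI)
  show "\<exists>y\<in>carrier A. y \<oplus>\<^bsub>A\<^esub> x = \<zero>\<^bsub>A\<^esub>" if "x \<in> carrier A" for x
    by (rule bexI[of _ "\<lambda>g. - x g"]) (use that in \<open>auto simp: A_simps carrier_A\<close>)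
  show "\<one>\<^bsub>A\<^esub> \<otimes>\<^bsub>A\<^esub> x = x" if "x \<in> carrier A" for x
    unfolding one_A_eq smash_of_algebra_mult[OF that] by simp
  show "z \<otimes>\<^bsub>A\<^esub> (x \<oplus>\<^bsub>A\<^esub> y) = z \<otimes>\<^bsub>A\<^esub> x \<oplus>\<^bsub>A\<^esub> z \<otimes>\<^bsub>A\<^esub> y"
    if "x \<in> carrier A" "y \<in> carrier A" for x y z
  proof -
    have "x \<oplus>\<^bsub>A\<^esub> y \<in> carrier A" using that by (simp add: A_simps carrier_A)
    then show ?thesis using that
      by (simp add: mult_A) (simp add: A_simps group_act_add distrib_left sum.distrib)
  qed
  show "x \<otimes>\<^bsub>A\<^esub> (s \<odot>\<^bsub>A\<^esub> y) = s \<odot>\<^bsub>A\<^esub> (x \<otimes>\<^bsub>A\<^esub> y)" if "y \<in> carrier A" for s x y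
  proof -
    have "s \<odot>\<^bsub>A\<^esub> y \<in> carrier A" using that by (simp add: A_simps carrier_A)
    then show ?thesis using that
      by (simp add: mult_A) (simp add: A_simps group_act_scale scale_mult_right scale_sum_right)
  qed
qed (simp_all add: mult_A_carrier mult_A_assoc one_A_carrier mult_A_one,
     simp_all add: mult_A, simp_all add: A_simps carrier_A algebra_simps sum.distrib
     scale_mult_left scale_sum_right scale_add_left scale_add_right)

sublocale A: ring A using C_algebra_A by (rule C_algebra.axioms(1))

lemma minus_A: "a \<in> carrier A \<Longrightarrow> b \<in> carrier A \<Longrightarrow> a \<ominus>\<^bsub>A\<^esub> b = (\<lambda>g. a g - b g)"
proof -
  assume ab: "a \<in> carrier A" "b \<in> carrier A"
  have "\<ominus>\<^bsub>A\<^esub> b = (\<lambda>g. - b g)"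
    by (rule A.minus_equality) (use ab in \<open>auto simp: A_simps carrier_A\<close>)
  then show ?thesis by (simp add: a_minus_def A_simps)
qed

end

section \<open>Commutators do not cancel in the free algebra\<close>

lemma coeff_var_mult:
  "coeff (nc_var x * p) (Word (y # ys)) = (if x = y then coeff p (Word ys) else 0)"
  by (induction p rule: nc_induct)
    (simp_all add: scale_mult_right lookup_add distrib_left nc_word_def nc_var_def mult_single
      word_add lookup_single when_def)

text \<open>The words of the two summands begin with different letters.\<close>
lemma free_algebra_cancel:
  assumes "nc_var U * p + nc_var V * q = 0"
  shows "p = 0" "q = 0"
proof -
  have *: "coeff (nc_var U * p + nc_var V * q) (Word (y # ys)) = 0" for y ys
    by (simp add: assms)
  have "coeff p w = 0" for w
    using *[of U "letters w"] by (simp add: lookup_add coeff_var_mult)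
  then show "p = 0" by (intro poly_mapping_eqI) simp
  have "coeff q w = 0" for w
    using *[of V "letters w"] by (simp add: lookup_add coeff_var_mult)
  then show "q = 0" by (intro poly_mapping_eqI) simp
qed

text \<open>The extra summand \<open>v z\<close> makes the induction possible: splitting off the first letter of
all words, \<open>u\<close> or \<open>v\<close>, turns the sum into one of the same form with \<open>z\<close> replaced by \<open>y 0\<close>, and
the equation \<open>z = u (y 0)\<close>.\<close>
lemma comm_uv_cancel_row:
  assumes "nc_var V * z + (\<Sum>b<N. nc_word (replicate b U) * (comm_uv * y b)) = 0"
  shows "z = 0 \<and> (\<forall>b<N. y b = 0)"
  using assms
proof (induction N arbitrary: z y)
  case 0
  then show ?case using free_algebra_cancel(2)[of 0 z] by simp
next
  case (Suc N)
  let ?S = "\<Sum>b<N. nc_word (replicate b U) * (comm_uv * y (Suc b))"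
  \<comment> \<open>Only the term with \<open>b = 0\<close> contributes words beginning with \<open>v\<close>, apart from \<open>v z\<close>.\<close>
  have "nc_var U * (nc_var V * y 0 + ?S) + nc_var V * (z - nc_var U * y 0) = 0"
    using Suc.prems by (simp add: sum.lessThan_Suc_shift comm_uv_def nc_word_Cons mult.assoc
        algebra_simps sum_distrib_left del: sum.lessThan_Suc)
  from free_algebra_cancel[OF this] Suc.IH[of "y 0" "\<lambda>b. y (Suc b)"]
  show ?case by (auto simp: less_Suc_eq_0_disj)
qed

text \<open>The right ideals \<open>v\<^sup>a u\<^sup>b (uv - vu) \<complex>\<langle>u,v\<rangle>\<close> form a direct sum: a word that is not sorted
has exactly one first occurrence of \<open>uv\<close>, and the letters before it form a sorted word.\<close>
lemma comm_uv_cancel: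
  assumes "(\<Sum>a<M. \<Sum>b<N. nc_word (normal_word a b) * (comm_uv * y a b)) = 0" "a < M" "b < N"
  shows "y a b = 0"
  using assms
proof (induction M arbitrary: y a)
  case (Suc M)
  let ?S = "\<Sum>a<M. \<Sum>b<N. nc_word (normal_word a b) * (comm_uv * y (Suc a) b)"
  \<comment> \<open>The rows with \<open>a > 0\<close> together play the role of \<open>v z\<close>.\<close>
  have "nc_var V * ?S + (\<Sum>b<N. nc_word (replicate b U) * (comm_uv * y 0 b)) = 0"
    using Suc.prems(1) by (simp add: sum.lessThan_Suc_shift nc_word_Cons normal_word_def
        mult.assoc
        add.commute sum_distrib_left del: sum.lessThan_Suc)
  from comm_uv_cancel_row[OF this] Suc.IH[of "\<lambda>a. y (Suc a)"] Suc.prems(2,3)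
  show ?case by (auto simp: less_Suc_eq_0_disj)
qed simp

lemma in_degs_remove:
  assumes "in_degs d S p" "hom_part d n p = 0"
  shows "in_degs d (S - {n}) p"
  unfolding in_degs_def
proof
  fix m assume m: "m \<in> supp p"
  have "d m \<noteq> n"
    using arg_cong[OF assms(2), of "\<lambda>q. coeff q m"] m by (auto simp: coeff_hom_part in_keys_iff)
  then show "d m \<in> S - {n}" using assms(1) m by (auto simp: in_degs_def)
qed

lemma in_degs_nc_mult:
  "in_degs nc_deg S p \<Longrightarrow> in_degs nc_deg T q \<Longrightarrow> (\<And>s t. s \<in> S \<Longrightarrow> t \<in> T \<Longrightarrow> s + t \<in> R)
    \<Longrightarrow> in_degs nc_deg R (p * q)"
  by (rule in_degs_mult[OF nc_deg_add])

lemma length_normal_word [simp]: "length (normal_word a b) = a + b"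
  by (simp add: normal_word_def)

section \<open>The defining ideal as a sum of right ideals\<close>

locale cbh = finite_SL2 +
  fixes c :: "complex^2^2 \<Rightarrow> complex"
  assumes c_outside: "g \<notin> G \<Longrightarrow> c g = 0"
    and c_class: "g \<in> G \<Longrightarrow> h \<in> G \<Longrightarrow> c (g ** h) = c (h ** g)"
begin

text \<open>Left multiplication by \<open>c\<close>.\<close>
definition central_act :: "(complex^2^2 \<Rightarrow> nc_poly) \<Rightarrow> complex^2^2 \<Rightarrow> nc_poly" where
  "central_act y = (\<lambda>k. \<Sum>g\<in>G. scale (c g) (group_act g y k))"

text \<open>Left multiplication by the relator.\<close>
definition relator_act :: "(complex^2^2 \<Rightarrow> nc_poly) \<Rightarrow> complex^2^2 \<Rightarrow> nc_poly" where
  "relator_act y = (\<lambda>k. comm_uv * y k - central_act y k)"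

lemma smash_carrier: "smash_of_algebra (poly_algebra UNIV) (SL2_sub G) p \<in> carrier A"
  "smash_of_group (poly_algebra UNIV) c \<in> carrier A"
  using one_G c_outside by (auto simp: carrier_A smash_of_algebra_def smash_of_group_def)

lemma relator_eq: "cbh_relator G c = (\<lambda>k. (if k = mat 1 then comm_uv else 0) - scale (c k) 1)"
  unfolding cbh_relator_def minus_A[OF smash_carrier]
  by (simp add: smash_of_algebra_def smash_of_group_def comm_uv_def cong: if_cong)

lemma relator_carrier: "cbh_relator G c \<in> carrier A"
  unfolding cbh_relator_def by (intro A.minus_closed smash_carrier)

lemma relator_mult: "y \<in> carrier A \<Longrightarrow> cbh_relator G c \<otimes>\<^bsub>A\<^esub> y = relator_act y"
proof
  fix k assume y: "y \<in> carrier A"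
  have "(cbh_relator G c \<otimes>\<^bsub>A\<^esub> y) k
      = (\<Sum>g\<in>G. (if g = mat 1 then comm_uv * group_act g y k else 0) - scale (c g) (group_act g y
          k))"
    unfolding mult_A[OF y] relator_eq
    by (rule sum.cong) (auto simp: left_diff_distrib scale_mult_left)
  also have "\<dots> = relator_act y k"
    by (simp add: sum_subtractf finite_G one_G relator_act_def central_act_def)
  finally show "(cbh_relator G c \<otimes>\<^bsub>A\<^esub> y) k = relator_act y k" .
qed

lemma relator_act_carrier: "y \<in> carrier A \<Longrightarrow> relator_act y \<in> carrier A"
  using mult_A_carrier[of y "cbh_relator G c"] by (simp add: relator_mult)

lemma relator_act_mult: "y \<in> carrier A \<Longrightarrow> z \<in> carrier A \<Longrightarrow> relator_act y \<otimes>\<^bsub>A\<^esub> z = relator_act (y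
    \<otimes>\<^bsub>A\<^esub> z)"
  using mult_A_assoc[of y z "cbh_relator G c"] by (simp add: relator_mult mult_A_carrier)

lemma central_act_add: "central_act (\<lambda>k. x k + y k) = (\<lambda>k. central_act x k + central_act y k)"
  by (simp add: central_act_def group_act_add scale_add_right sum.distrib)

lemma central_act_scale: "central_act (\<lambda>k. scale z (y k)) = (\<lambda>k. scale z (central_act y k))"
  by (simp add: central_act_def group_act_scale scale_sum_right mult.commute)

lemma central_act_carrier: "y \<in> carrier A \<Longrightarrow> central_act y \<in> carrier A"
  using group_act_carrier by (simp add: carrier_A central_act_def)

lemma relator_act_add: "relator_act (\<lambda>k. x k + y k) = (\<lambda>k. relator_act x k + relator_act y k)"
  by (simp add: relator_act_def central_act_add algebra_simps)

lemma relator_act_scale: "relator_act (\<lambda>k. scale z (y k)) = (\<lambda>k. scale z (relator_act y k))"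
  by (simp add: relator_act_def central_act_scale scale_mult_right scale_diff_right)

lemma relator_act_0 [simp]: "relator_act (\<lambda>k. 0) = (\<lambda>k. 0)"
  by (simp add: relator_act_def central_act_def)

lemma group_act_central_act: "h \<in> G \<Longrightarrow> group_act h (central_act y) = central_act (group_act h y)"
proof
  fix k assume h: "h \<in> G"
  have "group_act h (central_act y) k = (\<Sum>g\<in>G. scale (c g) (group_act (h ** g) y k))"
    by (simp add: central_act_def group_act_sum group_act_scale group_act_group_act h)
  also have "\<dots> = (\<Sum>g\<in>G. scale (c (ginv h ** g)) (group_act g y k))"
    using sum_G_left[OF ginv(1)[OF h], of "\<lambda>g. scale (c g) (group_act (h ** g) y k)"]
    by (simp add: h)
  also have "\<dots> = (\<Sum>g\<in>G. scale (c (g ** ginv h)) (group_act g y k))"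
    using c_class[OF _ ginv(1)[OF h]] by simp
  also have "\<dots> = (\<Sum>g\<in>G. scale (c g) (group_act (g ** h) y k))"
    using sum_G_right[OF h, of "\<lambda>g. scale (c (g ** ginv h)) (group_act g y k)"]
    by (simp add: h)
  also have "\<dots> = central_act (group_act h y) k"
    by (simp add: central_act_def group_act_group_act h)
  finally show "group_act h (central_act y) k = central_act (group_act h y) k" .
qed

lemma group_act_diff: "group_act g (\<lambda>k. a k - b k) = (\<lambda>k. group_act g a k - group_act g b k)"
  by (simp add: group_act_def nc_act_diff)

text \<open>The relator commutes with group elements: the commutator is fixed since determinants are
1, and \<open>c\<close> is a class function.\<close>
lemma group_act_relator_act: "h \<in> G \<Longrightarrow> group_act h (relator_act y) = relator_act (group_act h y)"
  by (simp add: relator_act_def group_act_diff group_act_lmul group_act_central_act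
      nc_act_comm_uv det_G)

lemma lmul_carrier: "y \<in> carrier A \<Longrightarrow> (\<lambda>k. p * y k) \<in> carrier A"
  by (simp add: carrier_A)

text \<open>The sum of the right ideals \<open>v\<^sup>a u\<^sup>b r A\<close>. It turns out to be the whole ideal generated by
\<open>r\<close>, and has the advantage over it that its elements are controlled by the sorted words alone.\<close>
inductive_set relator_span :: "(complex^2^2 \<Rightarrow> nc_poly) set" where
  zero: "(\<lambda>k. 0) \<in> relator_span"
| step: "x \<in> relator_span \<Longrightarrow> y \<in> carrier A \<Longrightarrow> (\<lambda>k. x k + nc_word (normal_word a b) * relator_act y
    k) \<in> relator_span"

lemma relator_span_carrier: "x \<in> relator_span \<Longrightarrow> x \<in> carrier A"
proof (induction rule: relator_span.induct)
  case (step x y a b)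
  then show ?case using relator_act_carrier[of y] by (simp add: carrier_A)
qed (simp add: carrier_A)

lemma relator_span_add: "y \<in> relator_span \<Longrightarrow> x \<in> relator_span \<Longrightarrow> (\<lambda>k. x k + y k) \<in> relator_span"
proof (induction rule: relator_span.induct)
  case (step y z a b)
  then have "(\<lambda>k. (x k + y k) + nc_word (normal_word a b) * relator_act z k) \<in> relator_span" by
      (intro relator_span.step) auto
  then show ?case by (simp add: add.assoc)
qed simp

lemma relator_span_scale: "x \<in> relator_span \<Longrightarrow> (\<lambda>k. scale z (x k)) \<in> relator_span"
proof (induction rule: relator_span.induct)
  case (step x y a b)
  have "(\<lambda>k. scale z (y k)) \<in> carrier A" using step by (simp add: carrier_A)
  from relator_span.step[OF step(3) this, of a b] show ?case
    by (simp add: relator_act_scale scale_add_right scale_mult_right)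
qed (simp add: relator_span.zero)

lemma relator_span_sum: "(\<And>i. i \<in> S \<Longrightarrow> f i \<in> relator_span) \<Longrightarrow> (\<lambda>k. \<Sum>i\<in>S. f i k) \<in> relator_span"
proof (induction S rule: infinite_finite_induct)
  case (insert i S)
  then show ?case using relator_span_add[of "\<lambda>k. \<Sum>i\<in>S. f i k" "f i"] by simp
qed (simp_all add: relator_span.zero)

lemma relator_span_lmul_poly_if:
  assumes "\<And>xs. Word xs \<in> supp p \<Longrightarrow> (\<lambda>k. nc_word xs * y k) \<in> relator_span"
  shows "(\<lambda>k. p * y k) \<in> relator_span"
proof -
  have "p * y k = (\<Sum>w\<in>supp p. scale (coeff p w) (nc_word (letters w) * y k))" for k
    by (subst (1) poly_sum_monoms[of p]) (simp add: monom_eq_nc_word sum_distrib_right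
        scale_mult_left)
  then show ?thesis using assms by (auto intro!: relator_span_sum relator_span_scale)
qed

text \<open>Sorting a word in front of the relator. Exchanging \<open>uv\<close> in the word \<open>xs u v ys\<close> produces
two more terms: \<open>xs r (ys r y)\<close>, where \<open>xs\<close> is shorter and \<open>ys r y\<close> is just another element of
\<open>A\<close>, and \<open>xs c ys r y\<close>, where the group elements of \<open>c\<close> move past \<open>ys\<close> and past \<open>r\<close>, leaving
polynomials of smaller degree in front of \<open>r\<close>.\<close>
lemma relator_span_lmul_word: "length xs = n \<Longrightarrow> y \<in> carrier A \<Longrightarrow> (\<lambda>k. nc_word xs * relator_act y
    k) \<in> relator_span"
proof (induction n arbitrary: xs y rule: less_induct)
  case (less n)
  have "length xs = n \<longrightarrow> (\<lambda>k. nc_word xs * relator_act y k) \<in> relator_span" for xs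
  proof (induction xs rule: swap_induct)
    case (1 a b)
    show ?case using relator_span.step[OF relator_span.zero less.prems(2), of a b] by simp
  next
    case (2 xs ys)
    let ?z = "\<lambda>k. nc_word ys * relator_act y k"
    have z: "?z \<in> carrier A" using less.prems relator_act_carrier by (simp add: lmul_carrier)
    show ?case
    proof
      assume len: "length (xs @ [U, V] @ ys) = n"
      have a: "(\<lambda>k. nc_word (xs @ [V, U] @ ys) * relator_act y k) \<in> relator_span" using 2 len by
          simp
      have b: "(\<lambda>k. nc_word xs * relator_act ?z k) \<in> relator_span" by (rule less.IH[OF _ refl
          z]) (use len in simp)
      have e: "(\<lambda>k. (nc_word xs * nc_act g (nc_word ys)) * relator_act (group_act g y) k) \<in>
          relator_span" if g: "g \<in> G" for g
      proof (rule relator_span_lmul_poly_if)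
        fix zs assume "Word zs \<in> supp (nc_word xs * nc_act g (nc_word ys))"
        moreover have "in_degs nc_deg {length xs + length ys} (nc_word xs * nc_act g (nc_word
            ys))"
          by (rule in_degs_nc_mult[OF in_degs_nc_word in_degs_nc_act[OF in_degs_nc_word]]) auto
        ultimately have "length zs < n" using len by (auto simp: in_degs_def nc_deg_def)
        then show "(\<lambda>k. nc_word zs * relator_act (group_act g y) k) \<in> relator_span"
          by (rule less.IH[OF _ refl group_act_carrier[OF g less.prems(2)]])
      qed
      have "(\<lambda>k. \<Sum>g\<in>G. scale (c g) ((nc_word xs * nc_act g (nc_word ys)) * relator_act
          (group_act g y) k)) \<in> relator_span"
        using e by (intro relator_span_sum relator_span_scale)
      also have "(\<lambda>k. \<Sum>g\<in>G. scale (c g) ((nc_word xs * nc_act g (nc_word ys)) * relator_act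
          (group_act g y) k))
          = (\<lambda>k. nc_word xs * central_act ?z k)"
        by (simp add: central_act_def group_act_lmul group_act_relator_act sum_distrib_left
            scale_mult_right mult.assoc)
      finally have d: "(\<lambda>k. nc_word xs * central_act ?z k) \<in> relator_span" .
      have "nc_word (xs @ [U, V] @ ys) * relator_act y k
          = (nc_word (xs @ [V, U] @ ys) * relator_act y k + nc_word xs * relator_act ?z k) +
              nc_word xs * central_act ?z k" for k
        by (simp add: nc_word_append nc_word_Cons relator_act_def[of ?z] comm_uv_def
            algebra_simps)
      then show "(\<lambda>k. nc_word (xs @ [U, V] @ ys) * relator_act y k) \<in> relator_span"
        using relator_span_add[OF d relator_span_add[OF b a]] by simp
    qed
  qed
  then show ?case using less.prems by simp
qed

lemma relator_span_lmul: "y \<in> carrier A \<Longrightarrow> (\<lambda>k. p * relator_act y k) \<in> relator_span"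
  by (rule relator_span_lmul_poly_if) (rule relator_span_lmul_word[OF refl])

lemma relator_span_right: "x \<in> relator_span \<Longrightarrow> z \<in> carrier A \<Longrightarrow> x \<otimes>\<^bsub>A\<^esub> z \<in> relator_span"
proof (induction rule: relator_span.induct)
  case zero
  then show ?case by (simp add: mult_A relator_span.zero)
next
  case (step x y a b)
  have "(\<lambda>k. x k + nc_word (normal_word a b) * relator_act y k) \<otimes>\<^bsub>A\<^esub> z
      = (\<lambda>k. (x \<otimes>\<^bsub>A\<^esub> z) k + nc_word (normal_word a b) * relator_act (y \<otimes>\<^bsub>A\<^esub> z) k)"
    unfolding relator_act_mult[OF step.hyps(2) step.prems, symmetric]
    using step.prems by (simp add: mult_A distrib_right sum.distrib sum_distrib_left mult.assoc)
  then show ?case using relator_span.step[OF step.IH[OF step.prems] mult_A_carrier] step by simp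
qed

lemma relator_span_left: "x \<in> relator_span \<Longrightarrow> z \<in> carrier A \<Longrightarrow> z \<otimes>\<^bsub>A\<^esub> x \<in> relator_span"
proof (induction rule: relator_span.induct)
  case zero
  then show ?case by (simp add: mult_A[of "\<lambda>k. 0"] carrier_A relator_span.zero)
next
  case (step x y a b)
  let ?w = "nc_word (normal_word a b)"
  have x: "x \<in> carrier A" using step by (simp add: relator_span_carrier)
  have "(\<lambda>k. \<Sum>g\<in>G. (z g * nc_act g ?w) * relator_act (group_act g y) k) \<in> relator_span"
    by (intro relator_span_sum relator_span_lmul group_act_carrier step)
  from relator_span_add[OF this step.IH[OF step.prems]]
  show ?case using relator_span_carrier[OF relator_span.step[OF step.hyps(1,2)]]
    by (simp add: mult_A x group_act_add group_act_lmul group_act_relator_act distrib_left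
        sum.distrib mult.assoc)
qed

lemma ideal_relator_span: "ideal relator_span A"
proof (rule idealI[OF A.ring_axioms])
  show "subgroup relator_span (add_monoid A)"
  proof (rule A.add.subgroupI)
    show "\<ominus>\<^bsub>A\<^esub> x \<in> relator_span" if "x \<in> relator_span" for x
    proof -
      have x: "x \<in> carrier A" using that by (rule relator_span_carrier)
      have "\<ominus>\<^bsub>A\<^esub> x = \<zero>\<^bsub>A\<^esub> \<ominus>\<^bsub>A\<^esub> x" using x by (simp add: a_minus_def)
      also have "\<dots> = (\<lambda>k. scale (-1) (x k))"
        using x by (subst minus_A) (auto simp: A_simps carrier_A scale_uminus)
      finally show ?thesis using relator_span_scale[OF that, of "-1"] by simp
    qed
    show "x \<oplus>\<^bsub>A\<^esub> y \<in> relator_span" if "x \<in> relator_span" "y \<in> relator_span" for x y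
      using relator_span_add[OF that(2,1)] by (simp add: A_simps)
  qed (use relator_span_carrier relator_span.zero in auto)
qed (auto intro: relator_span_left relator_span_right)

text \<open>The two-sided ideal equals the sum of right ideals: the latter is a two-sided ideal that
contains the relator, and each \<open>v\<^sup>a u\<^sup>b r y\<close> lies in the former.\<close>
lemma cbh_ideal_eq: "cbh_ideal G c = relator_span"
proof
  have "relator_act \<one>\<^bsub>A\<^esub> \<in> relator_span"
    using relator_span_lmul[OF one_A_carrier, of 1] by simp
  then have "cbh_relator G c \<in> relator_span"
    using relator_mult[OF one_A_carrier] mult_A_one[OF relator_carrier] by simp
  then show "cbh_ideal G c \<subseteq> relator_span"
    unfolding cbh_ideal_def by (intro A.genideal_minimal ideal_relator_span) simp
  interpret I: ideal "cbh_ideal G c" A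
    unfolding cbh_ideal_def by (rule A.genideal_ideal) (simp add: relator_carrier)
  have r: "cbh_relator G c \<in> cbh_ideal G c"
    unfolding cbh_ideal_def using A.genideal_self[of "{cbh_relator G c}"] relator_carrier by simp
  show "relator_span \<subseteq> cbh_ideal G c"
  proof
    fix x assume "x \<in> relator_span"
    then show "x \<in> cbh_ideal G c"
    proof (induction rule: relator_span.induct)
      case zero
      then show ?case using I.zero_closed by (simp add: A_simps)
    next
      case (step x y a b)
      let ?w = "smash_of_algebra (poly_algebra UNIV) (SL2_sub G) (nc_word (normal_word a b))"
      have "?w \<otimes>\<^bsub>A\<^esub> (cbh_relator G c \<otimes>\<^bsub>A\<^esub> y) \<in> cbh_ideal G c"
        by (intro I.I_l_closed I.I_r_closed r step smash_carrier)
      then have "x \<oplus>\<^bsub>A\<^esub> ?w \<otimes>\<^bsub>A\<^esub> (cbh_relator G c \<otimes>\<^bsub>A\<^esub> y) \<in> cbh_ideal G c"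
        using step by (intro I.a_closed)
      then show ?case
        by (simp add: relator_mult step smash_of_algebra_mult relator_act_carrier A_simps)
    qed
  qed
qed

text \<open>Stating the equation for all large \<open>N\<close> allows the addition of a term beyond the previous
bounds.\<close>
lemma relator_span_explicit:
  "x \<in> relator_span \<Longrightarrow> \<exists>y N0. (\<forall>a b. y a b \<in> carrier A) \<and>
    (\<forall>N\<ge>N0. x = (\<lambda>k. \<Sum>a<N. \<Sum>b<N. nc_word (normal_word a b) * relator_act (y a b) k))"
proof (induction rule: relator_span.induct)
  case zero
  show ?case by (rule exI[of _ "\<lambda>a b k. 0"]) (simp add: carrier_A)
next
  case (step x z a0 b0)
  from step.IH obtain y N0 where y: "\<And>a b. y a b \<in> carrier A"
    and x: "\<And>N. N \<ge> N0 \<Longrightarrow> x = (\<lambda>k. \<Sum>a<N. \<Sum>b<N. nc_word (normal_word a b) * relator_act (y a b)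
        k)" by blast
  define y' where "y' a b = (\<lambda>k. y a b k + (if a = a0 \<and> b = b0 then z else (\<lambda>k. 0)) k)" for a b
  have y': "y' a b \<in> carrier A" for a b
    using y[of a b] step.hyps by (auto simp: y'_def carrier_A)
  have "(\<lambda>k. x k + nc_word (normal_word a0 b0) * relator_act z k)
      = (\<lambda>k. \<Sum>a<N. \<Sum>b<N. nc_word (normal_word a b) * relator_act (y' a b) k)"
    if N: "N \<ge> max N0 (max (Suc a0) (Suc b0))" for N
  proof
    fix k
    have "(\<Sum>a<N. \<Sum>b<N. nc_word (normal_word a b) * relator_act (y' a b) k)
        = (\<Sum>a<N. \<Sum>b<N. nc_word (normal_word a b) * relator_act (y a b) k
            + (if b = b0 then if a = a0 then nc_word (normal_word a b) * relator_act z k else 0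
                else 0))"
      by (intro sum.cong refl) (simp add: y'_def relator_act_add distrib_left)
    also have "\<dots> = x k + nc_word (normal_word a0 b0) * relator_act z k"
    proof -
      have "a0 < N" "b0 < N" "x k = (\<Sum>a<N. \<Sum>b<N. nc_word (normal_word a b) * relator_act (y a b)
          k)"
        using N x[of N] by auto
      then show ?thesis by (simp add: sum.distrib)
    qed
    finally show "x k + nc_word (normal_word a0 b0) * relator_act z k
      = (\<Sum>a<N. \<Sum>b<N. nc_word (normal_word a b) * relator_act (y' a b) k)" by simp
  qed
  then show ?case using y' by blast
qed

lemma in_degs_central_act: "(\<And>g. in_degs nc_deg S (y g)) \<Longrightarrow> in_degs nc_deg S (central_act y k)"
  unfolding central_act_def group_act_def by (intro in_degs_sum in_degs_scale in_degs_nc_act)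

text \<open>Downward induction on a bound \<open>m\<close> for the degrees of the terms \<open>v\<^sup>a u\<^sup>b r y\<^sub>a\<^sub>b\<close>. As long
as \<open>m\<close> exceeds the bound \<open>n\<close> for the degree of the sum, the leading parts add up to zero, hence
vanish one by one, and \<open>m\<close> can be lowered. Once \<open>m \<le> n\<close>, the degree \<open>n\<close> part of the sum is a sum
of multiples of the commutator.\<close>
lemma pbw_bounded:
  assumes y: "\<And>a b. y a b \<in> carrier A"
    and deg: "\<And>a b g. a < N \<Longrightarrow> b < N \<Longrightarrow> in_degs nc_deg {w. a + b + 2 + w \<le> m} (y a b g)"
    and x: "x = (\<lambda>k. \<Sum>a<N. \<Sum>b<N. nc_word (normal_word a b) * relator_act (y a b) k)"
    and xn: "\<And>g. in_degs nc_deg {..n} (x g)"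
  shows "abelianize (hom_part nc_deg n (x k)) = 0"
  using deg
proof (induction m rule: less_induct)
  case (less m)
  note deg = less.prems
  \<comment> \<open>\<open>T\<close> collects the commutators; \<open>L\<close> collects the contributions of \<open>c\<close>, lower by two degrees.\<close>
  define T where "T = (\<lambda>k. \<Sum>a<N. \<Sum>b<N. nc_word (normal_word a b) * (comm_uv * y a b k))"
  define L where "L = (\<lambda>k. \<Sum>a<N. \<Sum>b<N. nc_word (normal_word a b) * central_act (y a b) k)"
  have xTL: "x k = T k - L k" for k
    by (simp add: x T_def L_def relator_act_def sum_subtractf right_diff_distrib)
  have L: "in_degs nc_deg {w. w + 2 \<le> m} (L k)" for k
    unfolding L_def
  proof (intro in_degs_sum in_degs_nc_mult[OF in_degs_nc_word in_degs_central_act])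
    fix a b g assume "a \<in> {..<N}" "b \<in> {..<N}"
    then show "in_degs nc_deg {w. a + b + 2 + w \<le> m} (y a b g)" by (intro deg) auto
  qed auto
  show ?case
  proof (cases "m \<le> n")
    case True
    have "abelianize (x k) = - abelianize (L k)"
      by (simp add: xTL abelianize_diff T_def abelianize_sum abelianize_mult)
    moreover have "hom_part nc_deg n (L k) = 0"
      using True by (intro hom_part_eq_0[OF L]) auto
    ultimately have "hom_part c_deg n (abelianize (x k)) = 0"
      by (metis abelianize_0 hom_part_0 hom_part_abelianize hom_part_scale scale_0_right
          scale_uminus)
    then show ?thesis by (simp add: hom_part_abelianize)
  next
    case False
    have y0: "hom_part nc_deg (m - 2 - a - b) (y a b k) = 0" if ab: "a < N" "b < N" for a b k
    proof -
      have hom: "hom_part nc_deg m (nc_word (normal_word a b) * (comm_uv * y a b k))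
          = nc_word (normal_word a b) * (comm_uv * hom_part nc_deg (m - 2 - a - b) (y a b k))"
        if ab: "a < N" "b < N" for a b
      proof (cases "a + b + 2 \<le> m")
        case True
        have wc: "in_degs nc_deg {a + b + 2} (nc_word (normal_word a b) * comm_uv)"
          by (rule in_degs_nc_mult[OF in_degs_nc_word in_degs_comm_uv]) simp
        have "m - (a + b + 2) = m - 2 - a - b" by simp
        then show ?thesis
          using hom_part_mult_hom[OF nc_deg_add wc True, of "y a b k"] by (simp add: mult.assoc)
      next
        \<comment> \<open>Here the subtraction truncates, but the bound leaves no room for a nonzero \<open>y a b\<close>.\<close>
        case False
        then have "in_degs nc_deg {} (y a b k)" using deg[OF ab, of k] by (auto elim:
            in_degs_mono)
        then have "y a b k = 0" by (auto simp: in_degs_def)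
        then show ?thesis by simp
      qed
      have "hom_part nc_deg m (L k) = 0" by (rule hom_part_eq_0[OF L]) simp
      moreover have "hom_part nc_deg m (x k) = 0" using False by (intro hom_part_eq_0[OF xn]) simp
      ultimately have "hom_part nc_deg m (T k) = 0" by (simp add: xTL hom_part_diff)
      then have "(\<Sum>a<N. \<Sum>b<N. nc_word (normal_word a b) *
          (comm_uv * hom_part nc_deg (m - 2 - a - b) (y a b k))) = 0"
        by (simp add: T_def hom_part_sum hom)
      from comm_uv_cancel[OF this ab] show ?thesis .
    qed
    have m1: "m - 1 < m" using False by simp
    show ?thesis
    proof (rule less.IH[OF m1])
      fix a b g assume ab: "a < N" "b < N"
      show "in_degs nc_deg {w. a + b + 2 + w \<le> m - 1} (y a b g)"
        by (rule in_degs_mono[OF in_degs_remove[OF deg[OF ab] y0[OF ab]]]) auto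
    qed
  qed
qed

text \<open>The bound that starts the preceding induction exists, as only finitely many coefficients
are involved.\<close>
theorem pbw:
  assumes "x \<in> cbh_ideal G c" "\<And>g. in_degs nc_deg {..n} (x g)"
  shows "abelianize (hom_part nc_deg n (x k)) = 0"
proof -
  from assms(1) obtain y N where y: "\<And>a b. y a b \<in> carrier A"
    and x: "x = (\<lambda>k. \<Sum>a<N. \<Sum>b<N. nc_word (normal_word a b) * relator_act (y a b) k)"
    unfolding cbh_ideal_eq by (blast dest: relator_span_explicit)
  let ?D = "\<Union>a\<in>{..<N}. \<Union>b\<in>{..<N}. \<Union>g\<in>G. (\<lambda>w. a + b + 2 + nc_deg w) ` supp (y a b g)"
  have "finite ?D" using finite_G by auto
  then obtain m where m: "\<And>d. d \<in> ?D \<Longrightarrow> d \<le> m" by (meson finite_nat_set_iff_bounded_le)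
  show ?thesis
  proof (rule pbw_bounded[OF y _ x assms(2)])
    fix a b g assume ab: "a < N" "b < N"
    show "in_degs nc_deg {w. a + b + 2 + w \<le> m} (y a b g)"
      unfolding in_degs_def
    proof
      fix w assume w: "w \<in> supp (y a b g)"
      then have "g \<in> G" using outside[OF y, of g a b] by (cases "g \<in> G") auto
      then have "a + b + 2 + nc_deg w \<in> ?D" using w ab by blast
      then show "nc_deg w \<in> {w. a + b + 2 + w \<le> m}" using m by simp
    qed
  qed
qed

end

text \<open>Equational laws pass to the image of a map that respects the operations. In this way both
the CBH algebra and its associated graded algebra, whose operations are defined on cosets, are
seen to be algebras without checking the laws on cosets.\<close>
locale algebra_image =
  fixes B :: "(complex, 'b) module" and A :: "(complex, 'a) module" and \<pi> :: "'b \<Rightarrow> 'a"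
  assumes C_algebra_B: "C_algebra B"
    and carrier_image: "carrier A = \<pi> ` carrier B"
    and image_add: "\<And>x y. x \<in> carrier B \<Longrightarrow> y \<in> carrier B \<Longrightarrow> \<pi> x \<oplus>\<^bsub>A\<^esub> \<pi> y = \<pi> (x \<oplus>\<^bsub>B\<^esub> y)"
    and image_mult: "\<And>x y. x \<in> carrier B \<Longrightarrow> y \<in> carrier B \<Longrightarrow> \<pi> x \<otimes>\<^bsub>A\<^esub> \<pi> y = \<pi> (x \<otimes>\<^bsub>B\<^esub> y)"
    and image_smult: "\<And>z x. x \<in> carrier B \<Longrightarrow> z \<odot>\<^bsub>A\<^esub> \<pi> x = \<pi> (z \<odot>\<^bsub>B\<^esub> x)"
    and image_zero: "\<zero>\<^bsub>A\<^esub> = \<pi> \<zero>\<^bsub>B\<^esub>"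
    and image_one: "\<one>\<^bsub>A\<^esub> = \<pi> \<one>\<^bsub>B\<^esub>"
begin

sublocale B: ring B
  using C_algebra_B by (rule C_algebra.axioms(1))

sublocale B_module: Module.module complex_field B
  using C_algebra_B by (rule C_algebra.axioms(2))

lemma smult_B:
  "x \<in> carrier B \<Longrightarrow> z \<odot>\<^bsub>B\<^esub> x \<in> carrier B"
  "x \<in> carrier B \<Longrightarrow> (z + w) \<odot>\<^bsub>B\<^esub> x = z \<odot>\<^bsub>B\<^esub> x \<oplus>\<^bsub>B\<^esub> w \<odot>\<^bsub>B\<^esub> x"
  "x \<in> carrier B \<Longrightarrow> y \<in> carrier B \<Longrightarrow> z \<odot>\<^bsub>B\<^esub> (x \<oplus>\<^bsub>B\<^esub> y) = z \<odot>\<^bsub>B\<^esub> x \<oplus>\<^bsub>B\<^esub> z \<odot>\<^bsub>B\<^esub> y"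
  "x \<in> carrier B \<Longrightarrow> (z * w) \<odot>\<^bsub>B\<^esub> x = z \<odot>\<^bsub>B\<^esub> (w \<odot>\<^bsub>B\<^esub> x)"
  "x \<in> carrier B \<Longrightarrow> 1 \<odot>\<^bsub>B\<^esub> x = x"
  "x \<in> carrier B \<Longrightarrow> y \<in> carrier B \<Longrightarrow> (z \<odot>\<^bsub>B\<^esub> x) \<otimes>\<^bsub>B\<^esub> y = z \<odot>\<^bsub>B\<^esub> (x \<otimes>\<^bsub>B\<^esub> y)"
  "x \<in> carrier B \<Longrightarrow> y \<in> carrier B \<Longrightarrow> x \<otimes>\<^bsub>B\<^esub> (z \<odot>\<^bsub>B\<^esub> y) = z \<odot>\<^bsub>B\<^esub> (x \<otimes>\<^bsub>B\<^esub> y)"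
  using B_module.smult_closed B_module.smult_l_distr B_module.smult_r_distr B_module.smult_assoc1
    B_module.smult_one C_algebra.smult_mult_left[OF C_algebra_B] C_algebra.smult_mult_right[OF
        C_algebra_B]
  by (simp_all add: complex_field_def)

theorem C_algebra_image: "C_algebra A"
proof (rule C_algebraI)
  show "\<exists>y\<in>carrier A. y \<oplus>\<^bsub>A\<^esub> x = \<zero>\<^bsub>A\<^esub>" if x: "x \<in> carrier A" for x
  proof -
    from x obtain b where b: "b \<in> carrier B" "x = \<pi> b" by (auto simp: carrier_image)
    then have "\<pi> (\<ominus>\<^bsub>B\<^esub> b) \<oplus>\<^bsub>A\<^esub> x = \<zero>\<^bsub>A\<^esub>" by (simp add: image_add image_zero B.l_neg)
    then show ?thesis using b by (auto simp: carrier_image)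
  qed
qed (auto simp: carrier_image image_add image_mult image_smult image_zero image_one smult_B
    B.a_ac B.m_assoc B.l_distr B.r_distr)

sublocale A: ring A
  using C_algebra_image by (rule C_algebra.axioms(1))

sublocale A_module: Module.module complex_field A
  using C_algebra_image by (rule C_algebra.axioms(2))

lemma image_closed: "x \<in> carrier B \<Longrightarrow> \<pi> x \<in> carrier A"
  by (simp add: carrier_image)

lemma image_minus: "x \<in> carrier B \<Longrightarrow> \<ominus>\<^bsub>A\<^esub> \<pi> x = \<pi> (\<ominus>\<^bsub>B\<^esub> x)"
  by (rule A.minus_equality) (simp_all add: image_add image_zero image_closed B.l_neg)

lemma image_finsum:
  "finite S \<Longrightarrow> (\<And>i. i \<in> S \<Longrightarrow> f i \<in> carrier B) \<Longrightarrow>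
    (\<Oplus>\<^bsub>A\<^esub>i\<in>S. \<pi> (f i)) = \<pi> (\<Oplus>\<^bsub>B\<^esub>i\<in>S. f i)"
proof (induction rule: finite_induct)
  case (insert i S)
  then have "f \<in> S \<rightarrow> carrier B" by auto
  with insert show ?case by (simp add: A.finsum_insert B.finsum_insert image_add image_closed)
qed (simp add: image_zero)

lemma image_submodule:
  assumes "submodule H complex_field B"
  shows "submodule (\<pi> ` H) complex_field A"
proof (rule A_module.submoduleI)
  interpret H: submodule H complex_field B by fact
  have H: "x \<in> carrier B" if "x \<in> H" for x using that H.subset by auto
  show "\<pi> ` H \<subseteq> carrier A" using H by (auto simp: carrier_image)
  show "\<zero>\<^bsub>A\<^esub> \<in> \<pi> ` H" using H.one_closed by (simp add: image_zero)
  show "\<ominus>\<^bsub>A\<^esub> x \<in> \<pi> ` H" if "x \<in> \<pi> ` H" for x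
    using that H B_module.submoduleE(6)[OF assms] by (auto simp: image_minus)
  show "x \<oplus>\<^bsub>A\<^esub> y \<in> \<pi> ` H" if "x \<in> \<pi> ` H" "y \<in> \<pi> ` H" for x y
    using that H H.m_closed by (auto simp: image_add)
  show "z \<odot>\<^bsub>A\<^esub> x \<in> \<pi> ` H" if "z \<in> carrier complex_field" "x \<in> \<pi> ` H" for z x
    using that H H.smult_closed by (auto simp: image_smult)
qed

theorem filtered_algebra_image:
  assumes "filtered_algebra B F"
  shows "filtered_algebra A (\<lambda>n. \<pi> ` F n)"
proof -
  interpret F: filtered_algebra B F by fact
  have F: "x \<in> carrier B" if "x \<in> F n" for x n
    using that F.F_exhaustive by blast
  show ?thesis
  proof (intro filtered_algebra.intro filtered_algebra_axioms.intro C_algebra_image)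
    show "submodule (\<pi> ` F n) complex_field A" for n by (rule image_submodule[OF F.F_submodule])
    show "\<pi> ` F n \<subseteq> \<pi> ` F (Suc n)" for n using F.F_mono by blast
    show "\<one>\<^bsub>A\<^esub> \<in> \<pi> ` F 0" using F.F_one by (simp add: image_one)
    show "x \<otimes>\<^bsub>A\<^esub> y \<in> \<pi> ` F (m + n)" if "x \<in> \<pi> ` F m" "y \<in> \<pi> ` F n" for x y m n
      using that F F.F_mult by (auto simp: image_mult)
    show "(\<Union>n. \<pi> ` F n) = carrier A"
      unfolding carrier_image F.F_exhaustive[symmetric] by blast
  qed
qed

text \<open>A left inverse of the surjection makes it bijective, so that the grading is transported as
well.\<close>
theorem graded_algebra_iso_inverse:
  assumes "graded_algebra B E" and chi: "\<And>b. b \<in> carrier B \<Longrightarrow> chi (\<pi> b) = b"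
    and D: "\<And>n. D n = \<pi> ` E n"
  shows "graded_algebra_iso A D B E chi"
proof -
  interpret E: graded_algebra B E by fact
  have E: "x \<in> carrier B" if "x \<in> E n" for x n
    using that subgroup.subset[OF submodule.axioms(1)[OF E.D_submodule]] by auto
  have zero_iff: "\<pi> b = \<zero>\<^bsub>A\<^esub> \<longleftrightarrow> b = \<zero>\<^bsub>B\<^esub>" if "b \<in> carrier B" for b
    unfolding image_zero using chi that B.zero_closed by metis
  have "graded_algebra A D"
  proof (intro graded_algebra.intro graded_algebra_axioms.intro C_algebra_image)
    show "submodule (D n) complex_field A" for n unfolding D by (rule image_submodule[OF
        E.D_submodule])
    show "\<one>\<^bsub>A\<^esub> \<in> D 0" using E.D_one by (simp add: image_one D)
    show "x \<otimes>\<^bsub>A\<^esub> y \<in> D (m + n)" if "x \<in> D m" "y \<in> D n" for x y m n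
      using that E E.D_mult by (auto simp: image_mult D)
    fix x assume "x \<in> carrier A"
    then obtain b where b: "b \<in> carrier B" "x = \<pi> b" by (auto simp: carrier_image)
    let ?P = "\<lambda>f. (\<forall>n. f n \<in> E n) \<and> finite {n. f n \<noteq> \<zero>\<^bsub>B\<^esub>}
        \<and> b = (\<Oplus>\<^bsub>B\<^esub>n\<in>{n. f n \<noteq> \<zero>\<^bsub>B\<^esub>}. f n)"
    from E.D_direct_sum[OF b(1)] have "\<exists>!f. ?P f" .
    then obtain f where Pf: "?P f" and uniq: "\<And>g. ?P g \<Longrightarrow> g = f" by (rule ex1E) blast
    from Pf have f: "\<And>n. f n \<in> E n" "finite {n. f n \<noteq> \<zero>\<^bsub>B\<^esub>}"
      and fb: "(\<Oplus>\<^bsub>B\<^esub>n\<in>{n. f n \<noteq> \<zero>\<^bsub>B\<^esub>}. f n) = b" by simp_all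
    show "\<exists>!f. (\<forall>n. f n \<in> D n) \<and> finite {n. f n \<noteq> \<zero>\<^bsub>A\<^esub>} \<and> x = (\<Oplus>\<^bsub>A\<^esub>n\<in>{n. f n \<noteq> \<zero>\<^bsub>A\<^esub>}. f n)"
    proof (rule ex1I[of _ "\<lambda>n. \<pi> (f n)"])
      have "{n. \<pi> (f n) \<noteq> \<zero>\<^bsub>A\<^esub>} = {n. f n \<noteq> \<zero>\<^bsub>B\<^esub>}" using zero_iff E f(1) by blast
      moreover have "(\<Oplus>\<^bsub>A\<^esub>n\<in>{n. f n \<noteq> \<zero>\<^bsub>B\<^esub>}. \<pi> (f n)) = x"
        unfolding b(2) fb[symmetric] using f E by (intro image_finsum) auto
      ultimately show "(\<forall>n. \<pi> (f n) \<in> D n) \<and> finite {n. \<pi> (f n) \<noteq> \<zero>\<^bsub>A\<^esub>}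
          \<and> x = (\<Oplus>\<^bsub>A\<^esub>n\<in>{n. \<pi> (f n) \<noteq> \<zero>\<^bsub>A\<^esub>}. \<pi> (f n))"
        using f by (simp add: D)
    next
      fix h assume h: "(\<forall>n. h n \<in> D n) \<and> finite {n. h n \<noteq> \<zero>\<^bsub>A\<^esub>}
          \<and> x = (\<Oplus>\<^bsub>A\<^esub>n\<in>{n. h n \<noteq> \<zero>\<^bsub>A\<^esub>}. h n)"
      then have "\<forall>n. \<exists>y. y \<in> E n \<and> h n = \<pi> y" by (auto simp: D)
      then obtain g where g: "\<And>n. g n \<in> E n" "\<And>n. h n = \<pi> (g n)" by metis
      have S: "{n. h n \<noteq> \<zero>\<^bsub>A\<^esub>} = {n. g n \<noteq> \<zero>\<^bsub>B\<^esub>}" unfolding g(2) using zero_iff E g(1) by blast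
      let ?s = "\<Oplus>\<^bsub>B\<^esub>n\<in>{n. g n \<noteq> \<zero>\<^bsub>B\<^esub>}. g n"
      have fin: "finite {n. g n \<noteq> \<zero>\<^bsub>B\<^esub>}" using h S by simp
      have sB: "?s \<in> carrier B" using g(1) E by (intro B.finsum_closed) auto
      have "\<pi> b = (\<Oplus>\<^bsub>A\<^esub>n\<in>{n. g n \<noteq> \<zero>\<^bsub>B\<^esub>}. \<pi> (g n))"
        using h unfolding S b(2)[symmetric] g(2)[symmetric] by blast
      also have "\<dots> = \<pi> ?s" using g(1) E fin by (intro image_finsum) auto
      finally have "b = ?s" using chi b(1) sB by metis
      then have "g = f" using g(1) fin by (intro uniq conjI allI)
      then show "h = (\<lambda>n. \<pi> (f n))" using g(2) by auto
    qed
  qed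
  moreover have "chi \<in> C_algebra_hom A B"
    unfolding C_algebra_hom_def
    by (auto intro!: ring_hom_memI simp: carrier_image chi image_add image_mult image_smult
        image_one smult_B)
  moreover have "bij_betw chi (carrier A) (carrier B)"
    by (rule bij_betw_byWitness[of _ \<pi>]) (auto simp: carrier_image chi)
  moreover have "chi ` D n = E n" for n
    unfolding D image_image using chi E by force
  ultimately show ?thesis
    unfolding graded_algebra_iso_def using assms(1) by blast
qed

end

section \<open>The CBH algebra as a quotient of the noncommutative invariants\<close>

context finite_SL2
begin

definition nc_inv :: "nc_poly set" where
  "nc_inv = {f. \<forall>g\<in>G. nc_act g f = f}"

definition avg :: "nc_poly \<Rightarrow> nc_poly" where
  "avg p = scale (1 / of_nat (card G)) (\<Sum>g\<in>G. nc_act g p)"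

text \<open>The element \<open>p e\<close> of the smash product, \<open>e\<close> being the averaging idempotent.\<close>
definition times_idem :: "nc_poly \<Rightarrow> complex^2^2 \<Rightarrow> nc_poly" where
  "times_idem p = (\<lambda>g. if g \<in> G then scale (1 / of_nat (card G)) p else 0)"

lemma nc_inv_closed:
  "1 \<in> nc_inv" "0 \<in> nc_inv" "p \<in> nc_inv \<Longrightarrow> q \<in> nc_inv \<Longrightarrow> p + q \<in> nc_inv"
  "p \<in> nc_inv \<Longrightarrow> q \<in> nc_inv \<Longrightarrow> p - q \<in> nc_inv"
  "p \<in> nc_inv \<Longrightarrow> q \<in> nc_inv \<Longrightarrow> p * q \<in> nc_inv" "p \<in> nc_inv \<Longrightarrow> scale z p \<in> nc_inv"
  "p \<in> nc_inv \<Longrightarrow> hom_part nc_deg n p \<in> nc_inv"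
  by (simp_all add: nc_inv_def nc_act_add nc_act_diff nc_act_mult nc_act_scale
      flip: hom_part_nc_act)

lemma nc_inv_sum: "(\<And>i. i \<in> S \<Longrightarrow> f i \<in> nc_inv) \<Longrightarrow> (\<Sum>i\<in>S. f i) \<in> nc_inv"
  by (induction S rule: infinite_finite_induct) (auto simp: nc_inv_closed)

lemma sum_const_scale: "(\<Sum>g\<in>G. scale (1 / of_nat (card G)) p) = p"
proof (rule poly_mapping_eqI)
  fix m
  show "coeff (\<Sum>g\<in>G. scale (1 / of_nat (card G)) p) m = coeff p m"
    using card_G by (simp add: lookup_sum)
qed

lemma avg_in_nc_inv: "avg p \<in> nc_inv"
  unfolding nc_inv_def
proof (intro CollectI ballI)
  fix h assume h: "h \<in> G"
  show "nc_act h (avg p) = avg p"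
    using sum_G_left[OF h, of "\<lambda>g. nc_act g p"]
    by (simp add: avg_def nc_act_scale nc_act_sum nc_act_compose)
qed

lemma avg_id: "p \<in> nc_inv \<Longrightarrow> avg p = p"
  using sum_const_scale[of p] by (simp add: avg_def nc_inv_def scale_sum_right del: sum_constant)

lemma in_degs_avg: "in_degs nc_deg S p \<Longrightarrow> in_degs nc_deg S (avg p)"
  unfolding avg_def by (intro in_degs_scale in_degs_sum in_degs_nc_act)

lemma abelianize_avg: "(\<And>g. g \<in> G \<Longrightarrow> c_act g (abelianize p) = abelianize p) \<Longrightarrow> abelianize (avg p)
    = abelianize p"
  using sum_const_scale[of "abelianize p"]
  by (simp add: avg_def abelianize_scale abelianize_sum abelianize_nc_act scale_sum_right
      del: sum_constant)

lemma C_algebra_nc_inv: "C_algebra (poly_algebra nc_inv)"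
  by (rule C_algebra_poly_algebra) (simp_all add: nc_inv_closed)

lemma times_idem_carrier: "times_idem p \<in> carrier A"
  by (simp add: carrier_A times_idem_def)

lemma times_idem_add: "times_idem (p + q) = (\<lambda>k. times_idem p k + times_idem q k)"
  by (auto simp: times_idem_def scale_add_right)

lemma times_idem_diff: "times_idem (p - q) = (\<lambda>k. times_idem p k - times_idem q k)"
  by (auto simp: times_idem_def scale_diff_right)

lemma times_idem_scale: "times_idem (scale z p) = (\<lambda>k. scale z (times_idem p k))"
  by (auto simp: times_idem_def mult.commute)

lemma times_idem_0 [simp]: "times_idem 0 = (\<lambda>k. 0)"
  by (auto simp: times_idem_def)

lemma times_idem_lmul: "times_idem (p * q) = (\<lambda>k. p * times_idem q k)"
  by (auto simp: times_idem_def scale_mult_right)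

lemma in_degs_times_idem: "in_degs nc_deg S p \<Longrightarrow> in_degs nc_deg S (times_idem p g)"
  by (simp add: times_idem_def in_degs_scale)

lemma times_idem_1: "scale (of_nat (card G)) (times_idem p (mat 1)) = p"
  using card_G by (simp add: times_idem_def one_G)

lemma idem_eq: "smash_of_group (poly_algebra UNIV) (averaging_idempotent (SL2_sub G)) =
    times_idem 1"
  by (auto simp: smash_of_group_def averaging_idempotent_def times_idem_def)

text \<open>Group elements are absorbed by the idempotent after they have acted on the polynomial in
front of it.\<close>
lemma mult_times_idem:
  "a \<otimes>\<^bsub>A\<^esub> times_idem q = times_idem (\<Sum>g\<in>G. a g * nc_act g q)"
proof
  fix k
  show "(a \<otimes>\<^bsub>A\<^esub> times_idem q) k = times_idem (\<Sum>g\<in>G. a g * nc_act g q) k"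
  proof (cases "k \<in> G")
    case True
    then show ?thesis
      by (simp add: mult_A times_idem_carrier group_act_def)
        (simp add: times_idem_def mult_G_iff ginv nc_act_scale scale_mult_right scale_sum_right)
  next
    case False
    then show ?thesis
      using mult_A_carrier[OF times_idem_carrier[of q], of a] by (simp add: carrier_A
          times_idem_def)
  qed
qed

lemma times_idem_mult_avg: "times_idem p \<otimes>\<^bsub>A\<^esub> times_idem q = times_idem (p * avg q)"
  unfolding mult_times_idem avg_def
  by (simp add: times_idem_def scale_mult_left scale_mult_right scale_sum_right sum_distrib_left)

lemma times_idem_mult: "q \<in> nc_inv \<Longrightarrow> times_idem p \<otimes>\<^bsub>A\<^esub> times_idem q = times_idem (p * q)"
  by (simp add: times_idem_mult_avg avg_id)

text \<open>The invariant \<open>f\<close> with \<open>e a e = f e\<close>.\<close>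
definition corner :: "(complex^2^2 \<Rightarrow> nc_poly) \<Rightarrow> nc_poly" where
  "corner a = avg (\<Sum>g\<in>G. a g)"

lemma corner_eq: "times_idem 1 \<otimes>\<^bsub>A\<^esub> (a \<otimes>\<^bsub>A\<^esub> times_idem 1) = times_idem (corner a)"
  by (simp add: mult_times_idem[of a] times_idem_mult_avg corner_def)

lemma corner_in_nc_inv: "corner a \<in> nc_inv"
  by (simp add: corner_def avg_in_nc_inv)

lemma corner_times_idem: "p \<in> nc_inv \<Longrightarrow> corner (times_idem p) = p"
  using sum_const_scale[of p] by (simp add: corner_def times_idem_def avg_id)

lemma corner_diff: "corner (\<lambda>k. a k - b k) = corner a - corner b"
  by (simp add: corner_def avg_def nc_act_diff sum_subtractf scale_diff_right)

lemma in_degs_corner: "(\<And>g. in_degs nc_deg S (a g)) \<Longrightarrow> in_degs nc_deg S (corner a)"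
  unfolding corner_def by (intro in_degs_avg in_degs_sum)

end

context cbh
begin

abbreviation cls where "cls \<equiv> cbh_class G c"

text \<open>The surjection from the noncommutative invariants to the CBH algebra. It is defined for
all polynomials, and respects products whenever the second factor is invariant.\<close>
definition proj :: "nc_poly \<Rightarrow> (complex^2^2 \<Rightarrow> nc_poly) set" where
  "proj p = cls (times_idem p)"

sublocale I: ideal "cbh_ideal G c" A
  unfolding cbh_ideal_eq by (rule ideal_relator_span)

lemma cls_eq_iff:
  "a \<in> carrier A \<Longrightarrow> b \<in> carrier A \<Longrightarrow> cls a = cls b \<longleftrightarrow> (\<lambda>k. a k - b k) \<in> relator_span"
  using A.quotient_eq_iff_same_a_r_cos[OF I.is_ideal, of a b]
  by (simp add: cbh_class_def minus_A cbh_ideal_eq)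

lemma relator_span_corner: "x \<in> relator_span \<Longrightarrow> times_idem (corner x) \<in> relator_span"
  unfolding corner_eq[symmetric] by (intro relator_span_left relator_span_right
      times_idem_carrier)

abbreviation Q where "Q \<equiv> quotient_algebra A (cbh_ideal G c)"

lemma carrier_Q: "carrier Q = cls ` carrier A"
  by (auto simp: quotient_algebra_def FactRing_def A_RCOSETS_def' cbh_class_def)

lemma Q_ops:
  "a \<in> carrier A \<Longrightarrow> b \<in> carrier A \<Longrightarrow> cls a \<oplus>\<^bsub>Q\<^esub> cls b = cls (a \<oplus>\<^bsub>A\<^esub> b)"
  "a \<in> carrier A \<Longrightarrow> b \<in> carrier A \<Longrightarrow> cls a \<otimes>\<^bsub>Q\<^esub> cls b = cls (a \<otimes>\<^bsub>A\<^esub> b)"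
  "\<zero>\<^bsub>Q\<^esub> = cls \<zero>\<^bsub>A\<^esub>"
  by (simp_all add: quotient_algebra_def FactRing_def cbh_class_def I.a_rcos_sum I.rcoset_mult_add
      A.a_rcos_zero[OF I.is_ideal I.zero_closed])

lemma Q_smult:
  assumes a: "a \<in> carrier A"
  shows "z \<odot>\<^bsub>Q\<^esub> cls a = cls (z \<odot>\<^bsub>A\<^esub> a)"
proof -
  have self: "a \<in> cls a" using I.a_rcos_self[OF a] by (simp add: cbh_class_def)
  have "cls (z \<odot>\<^bsub>A\<^esub> x) = cls (z \<odot>\<^bsub>A\<^esub> a)" if x: "x \<in> cls a" for x
  proof -
    have xA: "x \<in> carrier A" using x I.a_elemrcos_carrier[OF a] by (simp add: cbh_class_def)
    have "cls a = cls x" using x a I.a_repr_independence' by (simp add: cbh_class_def)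
    then have "(\<lambda>k. scale z (x k - a k)) \<in> relator_span" using cls_eq_iff[OF xA a] by (intro
        relator_span_scale) auto
    then show ?thesis
      using xA a by (subst cls_eq_iff) (auto simp: A_simps carrier_A scale_diff_right)
  qed
  then have "(\<Union>x\<in>cls a. cls (z \<odot>\<^bsub>A\<^esub> x)) = cls (z \<odot>\<^bsub>A\<^esub> a)" using self by blast
  then show ?thesis by (simp add: quotient_algebra_def cbh_class_def)
qed

lemma CBH_simps:
  "add (CBH G c) = add Q" "mult (CBH G c) = mult Q" "zero (CBH G c) = zero Q"
  "smult (CBH G c) = smult Q" "one (CBH G c) = proj 1"
  by (simp_all add: CBH_def corner_algebra_def proj_def idem_eq)

lemma carrier_CBH: "carrier (CBH G c) = proj ` nc_inv"
proof -
  have "carrier (CBH G c) = {cls (times_idem 1) \<otimes>\<^bsub>Q\<^esub> x \<otimes>\<^bsub>Q\<^esub> cls (times_idem 1) | x. x \<in> carrier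
      Q}"
    by (simp add: CBH_def corner_algebra_def idem_eq)
  also have "\<dots> = (\<lambda>a. cls (times_idem 1) \<otimes>\<^bsub>Q\<^esub> cls a \<otimes>\<^bsub>Q\<^esub> cls (times_idem 1)) ` carrier A"
    unfolding carrier_Q by blast
  also have "\<dots> = (\<lambda>a. proj (corner a)) ` carrier A"
    by (intro image_cong refl)
      (simp add: Q_ops times_idem_carrier mult_A_carrier mult_A_assoc corner_eq proj_def)
  also have "\<dots> = proj ` nc_inv"
  proof
    show "(\<lambda>a. proj (corner a)) ` carrier A \<subseteq> proj ` nc_inv" using corner_in_nc_inv by auto
    show "proj ` nc_inv \<subseteq> (\<lambda>a. proj (corner a)) ` carrier A"
    proof
      fix x assume "x \<in> proj ` nc_inv"
      then obtain p where p: "p \<in> nc_inv" "x = proj p" by blast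
      show "x \<in> (\<lambda>a. proj (corner a)) ` carrier A"
        by (rule image_eqI[of _ _ "times_idem p"]) (simp_all add: p corner_times_idem
            times_idem_carrier)
    qed
  qed
  finally show ?thesis .
qed

sublocale CBH: algebra_image "poly_algebra nc_inv" "CBH G c" proj
  by (rule algebra_image.intro) (simp_all add: C_algebra_nc_inv carrier_CBH CBH_simps proj_def
      Q_ops Q_smult
      times_idem_carrier times_idem_mult times_idem_add times_idem_scale A_simps)

definition nc_inv_le :: "nat \<Rightarrow> nc_poly set" where
  "nc_inv_le n = {f \<in> nc_inv. in_degs nc_deg {..n} f}"

lemma filtered_nc_inv: "filtered_algebra (poly_algebra nc_inv) nc_inv_le"
proof (intro filtered_algebra.intro filtered_algebra_axioms.intro C_algebra_nc_inv)
  show "submodule (nc_inv_le n) complex_field (poly_algebra nc_inv)" for n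
  proof (rule CBH.B_module.submoduleI)
    show "\<ominus>\<^bsub>poly_algebra nc_inv\<^esub> f \<in> nc_inv_le n" if f: "f \<in> nc_inv_le n" for f
    proof -
      have m: "- f \<in> nc_inv_le n"
        using f nc_inv_closed(4)[OF nc_inv_closed(2), of f] by (auto simp: nc_inv_le_def
            in_degs_uminus)
      moreover have "\<ominus>\<^bsub>poly_algebra nc_inv\<^esub> f = - f"
        by (rule CBH.B.minus_equality) (use f m in \<open>auto simp: nc_inv_le_def\<close>)
      ultimately show ?thesis by simp
    qed
  qed (auto simp: nc_inv_le_def nc_inv_closed in_degs_add in_degs_scale)
  show "nc_inv_le n \<subseteq> nc_inv_le (Suc n)" for n
    by (auto simp: nc_inv_le_def elim: in_degs_mono)
  show "\<one>\<^bsub>poly_algebra nc_inv\<^esub> \<in> nc_inv_le 0"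
    using in_degs_nc_word[of "[]"] by (auto simp: nc_inv_le_def nc_inv_closed elim: in_degs_mono)
  show "f \<otimes>\<^bsub>poly_algebra nc_inv\<^esub> g \<in> nc_inv_le (m + n)"
    if "f \<in> nc_inv_le m" "g \<in> nc_inv_le n" for f g m n
    using that by (auto simp: nc_inv_le_def nc_inv_closed intro: in_degs_nc_mult)
  show "(\<Union>n. nc_inv_le n) = carrier (poly_algebra nc_inv)"
  proof -
    have "\<exists>n. in_degs nc_deg {..n} f" for f :: nc_poly
      using finite_nat_set_iff_bounded_le[of "nc_deg ` supp f"] by (auto simp: in_degs_def)
    then show ?thesis by (auto simp: nc_inv_le_def)
  qed
qed

lemma proj_eq_iff: "proj f = proj h \<longleftrightarrow> times_idem (f - h) \<in> relator_span"
  by (simp add: proj_def cls_eq_iff times_idem_carrier times_idem_diff)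

text \<open>Sandwiching between idempotents replaces a representative of a corner element by one of
the form \<open>f e\<close>.\<close>
lemma cls_eq_proj:
  assumes "a \<in> carrier A" "f \<in> nc_inv" "cls a = proj f"
  shows "proj (corner a) = proj f"
proof -
  have "(\<lambda>k. a k - times_idem f k) \<in> relator_span"
    using assms(3) cls_eq_iff[OF assms(1) times_idem_carrier] by (simp add: proj_def)
  from relator_span_corner[OF this] show ?thesis
    by (simp add: proj_eq_iff corner_diff corner_times_idem assms(2))
qed

text \<open>The filtration is defined through arbitrary representatives; passing from \<open>a\<close> to \<open>e a e =
f e\<close> does not raise the degree.\<close>
lemma CBH_filtration_eq: "CBH_filtration G c n = proj ` nc_inv_le n"
proof
  show "CBH_filtration G c n \<subseteq> proj ` nc_inv_le n"
  proof
    fix x assume "x \<in> CBH_filtration G c n"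
    then obtain f a where f: "f \<in> nc_inv" "x = proj f" and a: "a \<in> nc_smash_filtration G n" "x =
        cls a"
      unfolding CBH_filtration_def carrier_CBH by blast
    then have "x = proj (corner a)" using cls_eq_proj[of a f] by (simp add:
        nc_smash_filtration_def)
    moreover have "corner a \<in> nc_inv_le n"
      using a(1) by (auto simp: nc_inv_le_def corner_in_nc_inv nc_smash_filtration_def
          in_degs_def[of _ _ "a _"] intro!: in_degs_corner)
    ultimately show "x \<in> proj ` nc_inv_le n" by blast
  qed
  have "times_idem f \<in> nc_smash_filtration G n" if "f \<in> nc_inv_le n" for f
    using that in_degs_times_idem[of "{..n}" f]
    by (auto simp: nc_smash_filtration_def times_idem_carrier nc_inv_le_def in_degs_def)
  then show "proj ` nc_inv_le n \<subseteq> CBH_filtration G c n"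
    unfolding CBH_filtration_def carrier_CBH proj_def by (auto simp: nc_inv_le_def)
qed

theorem filtered_CBH: "filtered_algebra (CBH G c) (CBH_filtration G c)"
  using CBH.filtered_algebra_image[OF filtered_nc_inv] by (simp flip: CBH_filtration_eq)

text \<open>Sorting a word in front of the idempotent; the exchange of \<open>uv\<close> costs an element of the
ideal and the term \<open>xs c ys e\<close>, which is shorter by two letters.\<close>
lemma word_reduction:
  "\<exists>a\<in>carrier A. (\<forall>g. in_degs nc_deg {..<length xs} (a g)) \<and>
    (\<lambda>k. (nc_word xs - normal_form (abelianize (nc_word xs))) * times_idem 1 k - a k) \<in>
        relator_span"
proof (induction xs rule: swap_induct)
  case (1 a b)
  show ?case
    by (rule bexI[of _ "\<lambda>k. 0"])
      (auto simp: normal_form_abelianize_nc_word normal_word_def count_list_replicate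
          relator_span.zero carrier_A)
next
  case (2 xs ys)
  let ?e = "\<lambda>k. nc_word ys * times_idem 1 k"
  from 2 obtain a where a: "a \<in> carrier A"
    "\<And>g. in_degs nc_deg {..<length (xs @ [V, U] @ ys)} (a g)"
    "(\<lambda>k. (nc_word (xs @ [V, U] @ ys) - normal_form (abelianize (nc_word (xs @ [V, U] @ ys)))) *
        times_idem 1 k - a k) \<in> relator_span"
    by blast
  have e: "?e \<in> carrier A" by (simp add: lmul_carrier times_idem_carrier)
  have ab: "abelianize (nc_word (xs @ [U, V] @ ys)) = abelianize (nc_word (xs @ [V, U] @ ys))"
    by (simp add: abelianize_nc_word mult_ac)
  define N where "N = normal_form (abelianize (nc_word (xs @ [V, U] @ ys)))"
  let ?a = "\<lambda>k. a k + nc_word xs * central_act ?e k"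
  have "?a \<in> carrier A" using a(1) central_act_carrier[OF e] by (simp add: carrier_A)
  moreover have "in_degs nc_deg {..<length (xs @ [U, V] @ ys)} (?a g)" for g
  proof (rule in_degs_add)
    show "in_degs nc_deg {..<length (xs @ [U, V] @ ys)} (a g)" using a(2) by simp
    have one: "in_degs nc_deg {0} 1" using in_degs_nc_word[of "[]"] by simp
    have "in_degs nc_deg {length ys} (?e h)" for h
      by (rule in_degs_nc_mult[OF in_degs_nc_word in_degs_times_idem[OF one]]) simp
    then show "in_degs nc_deg {..<length (xs @ [U, V] @ ys)} (nc_word xs * central_act ?e g)"
      by (intro in_degs_nc_mult[OF in_degs_nc_word in_degs_central_act]) auto
  qed
  moreover have "(\<lambda>k. (nc_word (xs @ [U, V] @ ys) - normal_form (abelianize (nc_word (xs @ [U,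
      V] @ ys))))
      * times_idem 1 k - ?a k) \<in> relator_span"
    using relator_span_add[OF relator_span_lmul[OF e, of "nc_word xs"] a(3)]
    unfolding ab N_def[symmetric]
    by (simp add: nc_word_append nc_word_Cons relator_act_def comm_uv_def algebra_simps)
  ultimately show ?case by (intro bexI[of _ ?a] conjI allI)
qed

text \<open>By linearity, \<open>p e\<close> is congruent, up to terms of lower degree, to \<open>q e\<close>, where \<open>q\<close> is the
normal form of the image of \<open>p\<close> in commuting variables; and this image is 0.\<close>
lemma kernel_reduction:
  assumes p: "in_degs nc_deg {..n} p" and ab: "abelianize p = 0"
  shows "\<exists>a\<in>carrier A. (\<forall>g. in_degs nc_deg {..<n} (a g)) \<and> (\<lambda>k. p * times_idem 1 k - a k) \<in>
      relator_span"
proof -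
  have "\<forall>xs. \<exists>a. a \<in> carrier A \<and> (\<forall>g. in_degs nc_deg {..<length xs} (a g)) \<and>
      (\<lambda>k. (nc_word xs - normal_form (abelianize (nc_word xs))) * times_idem 1 k - a k) \<in>
          relator_span"
    using word_reduction by blast
  from choice[OF this] obtain a where a: "\<And>xs. a xs \<in> carrier A"
    "\<And>xs g. in_degs nc_deg {..<length xs} (a xs g)"
    "\<And>xs. (\<lambda>k. (nc_word xs - normal_form (abelianize (nc_word xs))) * times_idem 1 k - a xs k) \<in>
        relator_span"
    by blast
  let ?a = "\<lambda>k. \<Sum>w\<in>supp p. scale (coeff p w) (a (letters w) k)"
  have "?a \<in> carrier A" using a(1) by (simp add: carrier_A)
  moreover have "in_degs nc_deg {..<n} (?a g)" for g
  proof (intro in_degs_sum in_degs_scale in_degs_mono[OF a(2)])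
    fix w assume "w \<in> supp p"
    then show "{..<length (letters w)} \<subseteq> {..<n}" using p by (auto simp: in_degs_def nc_deg_def)
  qed
  moreover have "(\<lambda>k. \<Sum>w\<in>supp p. scale (coeff p w)
      ((nc_word (letters w) - normal_form (abelianize (nc_word (letters w)))) * times_idem 1 k -
          a (letters w) k)) \<in> relator_span"
    by (intro relator_span_sum relator_span_scale a(3))
  moreover have "(\<Sum>w\<in>supp p. scale (coeff p w)
      ((nc_word (letters w) - normal_form (abelianize (nc_word (letters w)))) * times_idem 1 k -
          a (letters w) k))
      = p * times_idem 1 k - ?a k" for k
  proof -
    have p': "p = (\<Sum>w\<in>supp p. scale (coeff p w) (nc_word (letters w)))"
      by (subst (1) poly_sum_monoms[of p]) (simp add: monom_eq_nc_word)
    have nf: "normal_form (sum f S) = (\<Sum>i\<in>S. normal_form (f i))" for f and S :: "word set"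
      by (simp add: normal_form_def lin_ext_sum)
    have "(\<Sum>w\<in>supp p. scale (coeff p w) (normal_form (abelianize (nc_word (letters w)))))
        = normal_form (abelianize (\<Sum>w\<in>supp p. scale (coeff p w) (nc_word (letters w))))"
      by (simp add: abelianize_sum abelianize_scale nf normal_form_scale)
    also have "\<dots> = 0" unfolding p'[symmetric] by (simp add: ab)
    finally have z: "(\<Sum>w\<in>supp p. scale (coeff p w) (normal_form (abelianize (nc_word (letters
        w))))) = 0" .
    have "(\<Sum>w\<in>supp p. scale (coeff p w)
      ((nc_word (letters w) - normal_form (abelianize (nc_word (letters w)))) * times_idem 1 k -
          a (letters w) k))
      = ((\<Sum>w\<in>supp p. scale (coeff p w) (nc_word (letters w)))
        - (\<Sum>w\<in>supp p. scale (coeff p w) (normal_form (abelianize (nc_word (letters w)))))) *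
            times_idem 1 k - ?a k"
      by (simp add: scale_diff_right sum_subtractf left_diff_distrib sum_distrib_right
          scale_mult_left)
    then show ?thesis unfolding z p'[symmetric] by simp
  qed
  ultimately show ?thesis by (intro bexI[of _ ?a] conjI allI) simp_all
qed

text \<open>The part of degree \<open>n\<close> is moved to lower degree by \<open>kernel_reduction\<close>, at the expense of
leaving \<open>A e\<close>; multiplication by \<open>e\<close> from both sides brings the representative back to the form
\<open>f' e\<close>.\<close>
lemma lower_degree:
  assumes f: "f \<in> nc_inv" "in_degs nc_deg {..n} f" and ab: "abelianize (hom_part nc_deg n f) = 0"
  shows "\<exists>f'\<in>nc_inv. in_degs nc_deg {..<n} f' \<and> proj f = proj f'"
proof -
  let ?h = "hom_part nc_deg n f"
  have h: "in_degs nc_deg {..n} ?h" by (rule in_degs_mono[OF in_degs_hom_part]) simp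
  from kernel_reduction[OF h ab] obtain a where a: "a \<in> carrier A"
    "\<And>g. in_degs nc_deg {..<n} (a g)" "(\<lambda>k. ?h * times_idem 1 k - a k) \<in> relator_span" by blast
  have r: "in_degs nc_deg {..<n} (f - ?h)"
    by (rule in_degs_mono[OF in_degs_remove[OF in_degs_diff[OF f(2) h], of n]])
      (auto simp: hom_part_diff hom_part_id[OF in_degs_hom_part])
  \<comment> \<open>A representative of lower degree, which need not be of the form \<open>f' e\<close> yet.\<close>
  let ?b = "\<lambda>k. a k + times_idem (f - ?h) k"
  have b: "?b \<in> carrier A" using a(1) times_idem_carrier[of "f - ?h"] by (simp add: carrier_A)
  have "(\<lambda>k. times_idem f k - ?b k) = (\<lambda>k. ?h * times_idem 1 k - a k)"
    using times_idem_lmul[of ?h 1] by (simp add: times_idem_diff algebra_simps)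
  then have "cls ?b = proj f"
    using a(3) cls_eq_iff[OF times_idem_carrier b, of f] by (simp add: proj_def)
  from cls_eq_proj[OF b f(1) this] have "proj f = proj (corner ?b)" by simp
  moreover have "in_degs nc_deg {..<n} (corner ?b)"
    by (intro in_degs_corner in_degs_add a in_degs_times_idem r)
  ultimately show ?thesis using corner_in_nc_inv by blast
qed

text \<open>Conversely, the leading symbol depends only on the class: this is the
Poincare-Birkhoff-Witt property.\<close>
lemma symbol_unique:
  assumes "in_degs nc_deg {..n} f" "in_degs nc_deg {..n} h" "proj f = proj h"
  shows "abelianize (hom_part nc_deg n f) = abelianize (hom_part nc_deg n h)"
proof -
  have "times_idem (f - h) \<in> cbh_ideal G c" using assms(3) by (simp add: proj_eq_iff cbh_ideal_eq)
  then have "abelianize (hom_part nc_deg n (times_idem (f - h) (mat 1))) = 0"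
    by (rule pbw) (intro in_degs_times_idem in_degs_diff assms)
  then have "abelianize (hom_part nc_deg n (scale (of_nat (card G)) (times_idem (f - h) (mat
      1)))) = 0"
    by (simp add: hom_part_scale abelianize_scale)
  then show ?thesis by (simp only: times_idem_1 hom_part_diff abelianize_diff) simp
qed

end

section \<open>The graded algebra of invariant polynomials\<close>

lemma carrier_invariants: "carrier (invariants \<Gamma>) = {f. \<forall>g\<in>\<Gamma>. c_act g f = f}"
  by (simp add: invariants_def)

lemma invariants_ops [simp]:
  "add (invariants \<Gamma>) = (+)" "mult (invariants \<Gamma>) = (*)" "zero (invariants \<Gamma>) = 0"
  "one (invariants \<Gamma>) = 1" "smult (invariants \<Gamma>) = scale"
  by (simp_all add: invariants_def)

lemma C_algebra_invariants: "C_algebra (invariants \<Gamma>)"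
  unfolding invariants_def
  by (rule C_algebra_poly_algebra) (simp_all add: c_act_add c_act_mult c_act_scale)

lemma invariants_closed:
  "f \<in> carrier (invariants \<Gamma>) \<Longrightarrow> h \<in> carrier (invariants \<Gamma>) \<Longrightarrow> f + h \<in> carrier (invariants \<Gamma>)"
  "f \<in> carrier (invariants \<Gamma>) \<Longrightarrow> h \<in> carrier (invariants \<Gamma>) \<Longrightarrow> f - h \<in> carrier (invariants \<Gamma>)"
  "f \<in> carrier (invariants \<Gamma>) \<Longrightarrow> h \<in> carrier (invariants \<Gamma>) \<Longrightarrow> f * h \<in> carrier (invariants \<Gamma>)"
  "f \<in> carrier (invariants \<Gamma>) \<Longrightarrow> scale z f \<in> carrier (invariants \<Gamma>)"
  "f \<in> carrier (invariants \<Gamma>) \<Longrightarrow> hom_part c_deg n f \<in> carrier (invariants \<Gamma>)"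
  "0 \<in> carrier (invariants \<Gamma>)" "1 \<in> carrier (invariants \<Gamma>)"
  by (simp_all add: carrier_invariants c_act_add c_act_diff c_act_mult c_act_scale
      flip: hom_part_c_act)

lemma invariants_sum:
  "(\<And>i. i \<in> S \<Longrightarrow> f i \<in> carrier (invariants \<Gamma>)) \<Longrightarrow> (\<Sum>i\<in>S. f i) \<in> carrier (invariants \<Gamma>)"
  by (induction S rule: infinite_finite_induct) (auto simp: invariants_closed)

lemma invariants_component_eq:
  "invariants_component \<Gamma> n = {f \<in> carrier (invariants \<Gamma>). in_degs c_deg {n} f}"
  by (simp add: invariants_component_def in_degs_def)

lemma finsum_eq_sum:
  fixes A :: "(complex, 'm \<Rightarrow>\<^sub>0 complex) module" (structure)
  assumes "ring A" and ops: "add A = (+)" "zero A = 0" and "finite S"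
    and "\<And>i. i \<in> S \<Longrightarrow> f i \<in> carrier A"
  shows "finsum A f S = (\<Sum>i\<in>S. f i)"
proof -
  interpret ring A by fact
  show ?thesis using assms(4,5)
  proof induction
    case empty
    then show ?case by (simp add: ops)
  next
    case (insert i S)
    then have "f \<in> S \<rightarrow> carrier A" by auto
    with insert show ?case by (simp add: finsum_insert ops)
  qed
qed

lemma finite_hom_parts: "finite {n. hom_part d n p \<noteq> 0}"
proof (rule finite_subset)
  show "{n. hom_part d n p \<noteq> 0} \<subseteq> d ` supp p"
  proof
    fix n assume "n \<in> {n. hom_part d n p \<noteq> 0}"
    then have "\<exists>m. coeff (hom_part d n p) m \<noteq> 0" by (metis lookup_zero mem_Collect_eq
        poly_mapping_eqI)
    then obtain m where "coeff (hom_part d n p) m \<noteq> 0" ..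
    then show "n \<in> d ` supp p" by (auto simp: coeff_hom_part in_keys_iff split: if_splits)
  qed
qed simp

lemma sum_hom_parts: "(\<Sum>n | hom_part d n p \<noteq> 0. hom_part d n p) = p"
proof -
  let ?K = "{n. hom_part d n p \<noteq> 0} \<union> d ` supp p"
  have "p = (\<Sum>n\<in>?K. hom_part d n p)"
    by (rule hom_part_decomposition) (auto simp: finite_hom_parts)
  also have "\<dots> = (\<Sum>n | hom_part d n p \<noteq> 0. hom_part d n p)"
    by (rule sum.mono_neutral_right) (auto simp: finite_hom_parts)
  finally show ?thesis by simp
qed

lemma hom_part_sum_components:
  assumes "finite {n. f n \<noteq> 0}" "\<And>n. in_degs d {n} (f n)"
  shows "hom_part d m (\<Sum>n | f n \<noteq> 0. f n) = f m"
proof -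
  have h: "hom_part d m (f n) = (if n = m then f n else 0)" for n
    using hom_part_id[OF assms(2)[of n]] hom_part_eq_0[OF assms(2)[of n], of m] by auto
  have "hom_part d m (\<Sum>n | f n \<noteq> 0. f n) = (\<Sum>n | f n \<noteq> 0. if n = m then f n else 0)"
    by (simp add: hom_part_sum h)
  also have "\<dots> = f m" using assms(1) by simp
  finally show ?thesis .
qed

theorem graded_invariants: "graded_algebra (invariants \<Gamma>) (invariants_component \<Gamma>)"
proof (intro graded_algebra.intro graded_algebra_axioms.intro C_algebra_invariants)
  interpret ring "invariants \<Gamma>" using C_algebra_invariants by (rule C_algebra.axioms(1))
  interpret mod: Module.module complex_field "invariants \<Gamma>"
    using C_algebra_invariants by (rule C_algebra.axioms(2))
  show "submodule (invariants_component \<Gamma> n) complex_field (invariants \<Gamma>)" for n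
  proof (rule mod.submoduleI)
    show "\<ominus>\<^bsub>invariants \<Gamma>\<^esub> f \<in> invariants_component \<Gamma> n" if f: "f \<in> invariants_component \<Gamma> n" for f
    proof -
      have m: "- f \<in> invariants_component \<Gamma> n"
        using f invariants_closed(2)[OF invariants_closed(6), of f]
        by (auto simp: invariants_component_eq in_degs_uminus)
      moreover have "\<ominus>\<^bsub>invariants \<Gamma>\<^esub> f = - f"
        by (rule minus_equality) (use f m in \<open>auto simp: invariants_component_eq\<close>)
      ultimately show ?thesis by simp
    qed
  qed (auto simp: invariants_component_eq invariants_closed in_degs_add in_degs_scale)
  show "\<one>\<^bsub>invariants \<Gamma>\<^esub> \<in> invariants_component \<Gamma> 0"
    by (simp add: invariants_component_eq invariants_closed) (simp add: in_degs_def)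
  show "f \<otimes>\<^bsub>invariants \<Gamma>\<^esub> h \<in> invariants_component \<Gamma> (m + n)"
    if "f \<in> invariants_component \<Gamma> m" "h \<in> invariants_component \<Gamma> n" for f h m n
    using that by (auto simp: invariants_component_eq invariants_closed intro: in_degs_mult[OF
        c_deg_add])
  fix x assume x: "x \<in> carrier (invariants \<Gamma>)"
  let ?P = "\<lambda>f. (\<forall>n. f n \<in> invariants_component \<Gamma> n) \<and> finite {n. f n \<noteq> \<zero>\<^bsub>invariants \<Gamma>\<^esub>}
      \<and> x = (\<Oplus>\<^bsub>invariants \<Gamma>\<^esub>n\<in>{n. f n \<noteq> \<zero>\<^bsub>invariants \<Gamma>\<^esub>}. f n)"
  have P: "?P f \<longleftrightarrow> (\<forall>n. f n \<in> invariants_component \<Gamma> n) \<and> finite {n. f n \<noteq> 0}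
      \<and> x = (\<Sum>n | f n \<noteq> 0. f n)" for f
  proof -
    have "(\<Oplus>\<^bsub>invariants \<Gamma>\<^esub>n\<in>{n. f n \<noteq> \<zero>\<^bsub>invariants \<Gamma>\<^esub>}. f n) = (\<Sum>n | f n \<noteq> 0. f n)"
      if "\<forall>n. f n \<in> invariants_component \<Gamma> n" "finite {n. f n \<noteq> 0}"
      using that by (subst finsum_eq_sum) (auto simp: ring_axioms invariants_component_eq)
    then show ?thesis by auto
  qed
  show "\<exists>!f. ?P f"
    unfolding P
  proof (rule ex1I[of _ "\<lambda>n. hom_part c_deg n x"])
    show "(\<forall>n. hom_part c_deg n x \<in> invariants_component \<Gamma> n) \<and> finite {n. hom_part c_deg n x \<noteq> 0}
      \<and> x = (\<Sum>n | hom_part c_deg n x \<noteq> 0. hom_part c_deg n x)"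
      using x by (simp add: invariants_component_eq invariants_closed in_degs_hom_part
          finite_hom_parts sum_hom_parts)
  next
    fix f assume f: "(\<forall>n. f n \<in> invariants_component \<Gamma> n) \<and> finite {n. f n \<noteq> 0}
      \<and> x = (\<Sum>n | f n \<noteq> 0. f n)"
    then have "hom_part c_deg m x = f m" for m
      using hom_part_sum_components[of f c_deg m] by (simp add: invariants_component_eq)
    then show "f = (\<lambda>n. hom_part c_deg n x)" by auto
  qed
qed

lemma graded_inclusion_invariants:
  assumes "\<Gamma>1 \<subseteq> \<Gamma>2"
  shows "graded_inclusion (invariants \<Gamma>2) (invariants_component \<Gamma>2)
    (invariants \<Gamma>1) (invariants_component \<Gamma>1)"
  unfolding graded_inclusion_def
proof (intro conjI graded_invariants allI)
  show sub: "carrier (invariants \<Gamma>2) \<subseteq> carrier (invariants \<Gamma>1)"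
    using assms by (auto simp: carrier_invariants)
  show "(\<lambda>x. x) \<in> C_algebra_hom (invariants \<Gamma>2) (invariants \<Gamma>1)"
    using sub by (auto simp: C_algebra_hom_def intro!: ring_hom_memI)
  show "invariants_component \<Gamma>2 n = carrier (invariants \<Gamma>2) \<inter> invariants_component \<Gamma>1 n" for n
    using sub by (auto simp: invariants_component_eq)
qed

section \<open>The associated graded algebra and the symbol map\<close>

context cbh
begin

abbreviation c_inv where "c_inv \<equiv> carrier (invariants G)"

text \<open>Averaging makes an arbitrary noncommutative lift invariant; it does not alter the image in
commuting variables, which was invariant already.\<close>
definition lift :: "c_poly \<Rightarrow> nc_poly" where
  "lift h = avg (normal_form h)"

lemma lift_in_nc_inv: "lift h \<in> nc_inv"
  by (simp add: lift_def avg_in_nc_inv)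

lemma abelianize_lift: "h \<in> c_inv \<Longrightarrow> abelianize (lift h) = h"
  by (simp add: lift_def abelianize_avg carrier_invariants)

lemma in_degs_lift: "in_degs c_deg S h \<Longrightarrow> in_degs nc_deg S (lift h)"
  unfolding lift_def by (intro in_degs_avg in_degs_normal_form)

abbreviation symbol where "symbol n f \<equiv> abelianize (hom_part nc_deg n f)"

lemma symbol_in_inv: "f \<in> nc_inv \<Longrightarrow> symbol n f \<in> c_inv"
  by (simp add: nc_inv_def carrier_invariants flip: abelianize_nc_act hom_part_nc_act)

lemma in_degs_symbol: "in_degs c_deg {n} (symbol n f)"
  by (intro in_degs_abelianize in_degs_hom_part)

text \<open>The coset of \<open>F (n - 1)\<close> in \<open>F n\<close> that consists of the elements with leading symbol \<open>h\<close>.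
Cosets are handled through this description only, and computing with them becomes computing with
symbols.\<close>
definition gr_coset :: "nat \<Rightarrow> c_poly \<Rightarrow> (complex^2^2 \<Rightarrow> nc_poly) set set" where
  "gr_coset n h = {proj f | f. f \<in> nc_inv_le n \<and> symbol n f = h}"

abbreviation lower where "lower \<equiv> below (CBH G c) (CBH_filtration G c)"

lemma lower_eq: "lower n = proj ` {f \<in> nc_inv. in_degs nc_deg {..<n} f}"
proof (cases n)
  case 0
  have "{f \<in> nc_inv. in_degs nc_deg {..<n} f} = {0}"
    using nc_inv_closed(2) by (auto simp: in_degs_def 0)
  then show ?thesis by (simp add: below_def 0 CBH.image_zero)
next
  case (Suc m)
  then show ?thesis by (simp add: below_def CBH_filtration_eq nc_inv_le_def lessThan_Suc_atMost)
qed

lemma nc_inv_leD: "f \<in> nc_inv_le n \<Longrightarrow> f \<in> nc_inv" "f \<in> nc_inv_le n \<Longrightarrow> in_degs nc_deg {..n} f"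
  by (simp_all add: nc_inv_le_def)

lemma gr_cosetI: "f \<in> nc_inv_le n \<Longrightarrow> symbol n f = h \<Longrightarrow> proj f \<in> gr_coset n h"
  by (auto simp: gr_coset_def)

lemma proj_add: "f \<in> nc_inv \<Longrightarrow> h \<in> nc_inv \<Longrightarrow> proj f \<oplus>\<^bsub>CBH G c\<^esub> proj h = proj (f + h)"
  using CBH.image_add by simp

lemma proj_mult: "f \<in> nc_inv \<Longrightarrow> h \<in> nc_inv \<Longrightarrow> proj f \<otimes>\<^bsub>CBH G c\<^esub> proj h = proj (f * h)"
  using CBH.image_mult by simp

lemma proj_smult: "f \<in> nc_inv \<Longrightarrow> z \<odot>\<^bsub>CBH G c\<^esub> proj f = proj (scale z f)"
  using CBH.image_smult by simp

text \<open>One inclusion holds because lower terms do not affect the symbol; for the other, the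
difference of two elements with the same symbol has lower degree by \<open>lower_degree\<close>.\<close>
lemma coset_eq_gr_coset:
  assumes f: "f \<in> nc_inv_le n"
  shows "lower n +>\<^bsub>CBH G c\<^esub> proj f = gr_coset n (symbol n f)"
proof
  have fi: "f \<in> nc_inv" using f by (rule nc_inv_leD)
  show "lower n +>\<^bsub>CBH G c\<^esub> proj f \<subseteq> gr_coset n (symbol n f)"
  proof
    fix x assume "x \<in> lower n +>\<^bsub>CBH G c\<^esub> proj f"
    then obtain b where b: "b \<in> nc_inv" "in_degs nc_deg {..<n} b"
      "x = proj b \<oplus>\<^bsub>CBH G c\<^esub> proj f" by (auto simp: a_r_coset_def' lower_eq)
    have "symbol n (b + f) = symbol n f"
      by (simp add: hom_part_add hom_part_eq_0[OF b(2)])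
    moreover have "b + f \<in> nc_inv_le n"
      using b f by (auto simp: nc_inv_le_def nc_inv_closed intro!: in_degs_add elim: in_degs_mono)
    ultimately show "x \<in> gr_coset n (symbol n f)"
      using b(1) fi by (simp add: b(3) proj_add gr_cosetI)
  qed
  show "gr_coset n (symbol n f) \<subseteq> lower n +>\<^bsub>CBH G c\<^esub> proj f"
  proof
    fix x assume "x \<in> gr_coset n (symbol n f)"
    then obtain h where h: "h \<in> nc_inv_le n" "symbol n h = symbol n f" "x = proj h"
      by (auto simp: gr_coset_def)
    have hf: "h - f \<in> nc_inv" "in_degs nc_deg {..n} (h - f)" "symbol n (h - f) = 0"
      using h f by (auto simp: nc_inv_le_def nc_inv_closed in_degs_diff hom_part_diff
          abelianize_diff)
    from lower_degree[OF this] obtain d where d: "d \<in> nc_inv" "in_degs nc_deg {..<n} d"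
      "proj (h - f) = proj d" by blast
    have "x = proj d \<oplus>\<^bsub>CBH G c\<^esub> proj f"
      using hf(1) fi by (simp add: proj_add h(3) flip: d(3))
    then show "x \<in> lower n +>\<^bsub>CBH G c\<^esub> proj f" using d by (auto simp: a_r_coset_def' lower_eq)
  qed
qed

lemma coset_of_gr_coset: "x \<in> gr_coset n h \<Longrightarrow> lower n +>\<^bsub>CBH G c\<^esub> x = gr_coset n h"
  using coset_eq_gr_coset by (auto simp: gr_coset_def)

lemma lift_in_nc_inv_le: "in_degs c_deg {n} h \<Longrightarrow> lift h \<in> nc_inv_le n"
  by (auto simp: nc_inv_le_def lift_in_nc_inv intro: in_degs_mono[OF in_degs_lift])

lemma symbol_lift: "h \<in> c_inv \<Longrightarrow> in_degs c_deg {n} h \<Longrightarrow> symbol n (lift h) = h"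
  by (simp add: hom_part_id in_degs_lift abelianize_lift)

lemma lift_in_gr_coset: "h \<in> c_inv \<Longrightarrow> in_degs c_deg {n} h \<Longrightarrow> proj (lift h) \<in> gr_coset n h"
  by (intro gr_cosetI lift_in_nc_inv_le symbol_lift)

lemma proj_in_gr_coset:
  assumes "f \<in> nc_inv_le n" "proj f \<in> gr_coset n h"
  shows "symbol n f = h"
  using assms symbol_unique[of n f] by (auto simp: gr_coset_def nc_inv_le_def)

lemma gr_coset_inject:
  assumes "h \<in> c_inv" "in_degs c_deg {n} h" "gr_coset n h = gr_coset n h'"
  shows "h = h'"
  using proj_in_gr_coset[OF lift_in_nc_inv_le[OF assms(2)], of h'] lift_in_gr_coset[OF assms(1,2)]
    symbol_lift[OF assms(1,2)] assms(3) by simp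

lemma lower_eq_gr_coset: "lower n = gr_coset n 0"
proof -
  have "(0 :: nc_poly) \<in> nc_inv_le n" by (simp add: nc_inv_le_def nc_inv_closed)
  from coset_eq_gr_coset[OF this] have "lower n +>\<^bsub>CBH G c\<^esub> proj 0 = gr_coset n 0" by simp
  moreover have "lower n +>\<^bsub>CBH G c\<^esub> proj 0 = lower n"
    by (auto simp: a_r_coset_def' lower_eq proj_add nc_inv_closed)
  ultimately show ?thesis by simp
qed

text \<open>The inverse of the symbol map.\<close>
definition gr_of :: "c_poly \<Rightarrow> nat \<Rightarrow> (complex^2^2 \<Rightarrow> nc_poly) set set" where
  "gr_of h = (\<lambda>n. gr_coset n (hom_part c_deg n h))"

abbreviation GR where "GR \<equiv> gr (CBH G c) (CBH_filtration G c)"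

lemma gr_of_eq_lower: "h \<in> c_inv \<Longrightarrow> gr_of h n = lower n \<longleftrightarrow> hom_part c_deg n h = 0"
  using gr_coset_inject[OF invariants_closed(5) in_degs_hom_part, of h n 0]
  by (auto simp: gr_of_def lower_eq_gr_coset)

lemma carrier_GR: "carrier GR = gr_of ` c_inv"
proof
  show "gr_of ` c_inv \<subseteq> carrier GR"
  proof
    fix X assume "X \<in> gr_of ` c_inv"
    then obtain h where h: "h \<in> c_inv" "X = gr_of h" by blast
    have "\<exists>x\<in>CBH_filtration G c n. X n = lower n +>\<^bsub>CBH G c\<^esub> x" for n
    proof
      let ?f = "lift (hom_part c_deg n h)"
      have f: "?f \<in> nc_inv_le n" by (rule lift_in_nc_inv_le[OF in_degs_hom_part])
      show "proj ?f \<in> CBH_filtration G c n" using f by (simp add: CBH_filtration_eq)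
      show "X n = lower n +>\<^bsub>CBH G c\<^esub> proj ?f"
        using h by (simp add: coset_eq_gr_coset[OF f] symbol_lift invariants_closed
            in_degs_hom_part gr_of_def)
    qed
    moreover have "{n. X n \<noteq> lower n} = {n. hom_part c_deg n h \<noteq> 0}"
      using h gr_of_eq_lower by auto
    ultimately show "X \<in> carrier GR" by (simp add: gr_def finite_hom_parts)
  qed
  show "carrier GR \<subseteq> gr_of ` c_inv"
  proof
    fix X assume X: "X \<in> carrier GR"
    have "\<forall>n. \<exists>f. f \<in> nc_inv_le n \<and> X n = lower n +>\<^bsub>CBH G c\<^esub> proj f"
      using X unfolding gr_def CBH_filtration_eq by (simp add: image_iff) blast
    from choice[OF this] obtain f where f: "\<And>n. f n \<in> nc_inv_le n"
      "\<And>n. X n = lower n +>\<^bsub>CBH G c\<^esub> proj (f n)" by blast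
    define h where "h = (\<Sum>n | symbol n (f n) \<noteq> 0. symbol n (f n))"
    have Xn: "X n = gr_coset n (symbol n (f n))" for n using f by (simp add: coset_eq_gr_coset)
    have "{n. symbol n (f n) \<noteq> 0} \<subseteq> {n. X n \<noteq> lower n}"
      using gr_coset_inject[OF symbol_in_inv[OF nc_inv_leD(1)[OF f(1)]] in_degs_symbol]
      unfolding Xn lower_eq_gr_coset by blast
    then have "finite {n. symbol n (f n) \<noteq> 0}" using X by (auto simp: gr_def elim: finite_subset)
    then have "hom_part c_deg n h = symbol n (f n)" for n
      unfolding h_def by (intro hom_part_sum_components in_degs_symbol)
    then have "X = gr_of h" by (intro HOL.ext) (simp add: gr_of_def Xn)
    moreover have "h \<in> c_inv"
      unfolding h_def by (intro invariants_sum symbol_in_inv nc_inv_leD(1)[OF f(1)])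
    ultimately show "X \<in> gr_of ` c_inv" by blast
  qed
qed

lemma gr_of_add:
  assumes f: "f \<in> c_inv" and h: "h \<in> c_inv"
  shows "gr_of f \<oplus>\<^bsub>GR\<^esub> gr_of h = gr_of (f + h)"
proof
  fix n
  let ?f = "hom_part c_deg n f" and ?h = "hom_part c_deg n h"
  have f': "?f \<in> c_inv" "in_degs c_deg {n} ?f" using f by (auto simp: invariants_closed
      in_degs_hom_part)
  have "gr_coset n ?f <+>\<^bsub>CBH G c\<^esub> gr_coset n ?h = gr_coset n (?f + ?h)"
  proof
    show "gr_coset n ?f <+>\<^bsub>CBH G c\<^esub> gr_coset n ?h \<subseteq> gr_coset n (?f + ?h)"
    proof
      fix x assume "x \<in> gr_coset n ?f <+>\<^bsub>CBH G c\<^esub> gr_coset n ?h"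
      then obtain p q where "p \<in> nc_inv_le n" "symbol n p = ?f" "q \<in> nc_inv_le n" "symbol n q =
          ?h"
        "x = proj p \<oplus>\<^bsub>CBH G c\<^esub> proj q" by (auto simp: set_add_def' gr_coset_def)
      then show "x \<in> gr_coset n (?f + ?h)"
        by (auto simp: proj_add nc_inv_le_def nc_inv_closed hom_part_add abelianize_add
            intro!: gr_cosetI in_degs_add)
    qed
    show "gr_coset n (?f + ?h) \<subseteq> gr_coset n ?f <+>\<^bsub>CBH G c\<^esub> gr_coset n ?h"
    proof
      fix x assume "x \<in> gr_coset n (?f + ?h)"
      then obtain p where p: "p \<in> nc_inv_le n" "symbol n p = ?f + ?h" "x = proj p"
        by (auto simp: gr_coset_def)
      have l: "lift ?f \<in> nc_inv_le n" "symbol n (lift ?f) = ?f"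
        using f' by (auto simp: lift_in_nc_inv_le symbol_lift)
      have "p - lift ?f \<in> nc_inv_le n" "symbol n (p - lift ?f) = ?h"
        using p l by (auto simp: nc_inv_le_def nc_inv_closed in_degs_diff hom_part_diff
            abelianize_diff)
      then have "proj (p - lift ?f) \<in> gr_coset n ?h" by (rule gr_cosetI)
      moreover have "x = proj (lift ?f) \<oplus>\<^bsub>CBH G c\<^esub> proj (p - lift ?f)"
        using p l by (simp add: proj_add nc_inv_le_def nc_inv_closed)
      ultimately show "x \<in> gr_coset n ?f <+>\<^bsub>CBH G c\<^esub> gr_coset n ?h"
        using lift_in_gr_coset[OF f'] by (auto simp: set_add_def')
    qed
  qed
  then show "(gr_of f \<oplus>\<^bsub>GR\<^esub> gr_of h) n = gr_of (f + h) n"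
    by (simp add: gr_def gr_of_def hom_part_add)
qed

lemma gr_of_smult:
  assumes h: "h \<in> c_inv"
  shows "z \<odot>\<^bsub>GR\<^esub> gr_of h = gr_of (scale z h)"
proof
  fix n
  let ?h = "hom_part c_deg n h"
  have "lower n +>\<^bsub>CBH G c\<^esub> (z \<odot>\<^bsub>CBH G c\<^esub> x) = gr_coset n (scale z ?h)" if "x \<in> gr_coset n ?h"
      for x
    using that by (auto simp: gr_coset_def[of n ?h] nc_inv_le_def proj_smult nc_inv_closed
        hom_part_scale abelianize_scale intro!: coset_of_gr_coset gr_cosetI in_degs_scale)
  moreover have "gr_coset n ?h \<noteq> {}"
    using lift_in_gr_coset[of ?h n] h by (auto simp: invariants_closed in_degs_hom_part)
  ultimately show "(z \<odot>\<^bsub>GR\<^esub> gr_of h) n = gr_of (scale z h) n"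
    by (simp add: gr_def gr_of_def hom_part_scale)
qed

text \<open>Whatever representatives are chosen, the symbol of the sum of products is the degree \<open>n\<close>
part of \<open>f * h\<close>, by the convolution formula for homogeneous parts.\<close>
lemma gr_of_mult:
  assumes f: "f \<in> c_inv" and h: "h \<in> c_inv"
  shows "gr_of f \<otimes>\<^bsub>GR\<^esub> gr_of h = gr_of (f * h)"
proof
  fix n
  have prod: "lower n +>\<^bsub>CBH G c\<^esub> (\<Oplus>\<^bsub>CBH G c\<^esub>i\<in>{..n}. x i \<otimes>\<^bsub>CBH G c\<^esub> y (n - i)) = gr_of (f * h) n"
    if x: "\<forall>i. x i \<in> gr_of f i" and y: "\<forall>i. y i \<in> gr_of h i" for x y
  proof -
    have "\<forall>i. \<exists>p. p \<in> nc_inv_le i \<and> symbol i p = hom_part c_deg i f \<and> x i = proj p"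
      using x by (auto simp: gr_of_def gr_coset_def)
    from choice[OF this] obtain p where p: "\<And>i. p i \<in> nc_inv_le i"
      "\<And>i. symbol i (p i) = hom_part c_deg i f" "\<And>i. x i = proj (p i)" by blast
    have "\<forall>i. \<exists>p. p \<in> nc_inv_le i \<and> symbol i p = hom_part c_deg i h \<and> y i = proj p"
      using y by (auto simp: gr_of_def gr_coset_def)
    from choice[OF this] obtain q where q: "\<And>i. q i \<in> nc_inv_le i"
      "\<And>i. symbol i (q i) = hom_part c_deg i h" "\<And>i. y i = proj (q i)" by blast
    have pq: "p i * q (n - i) \<in> nc_inv" "in_degs nc_deg {..n} (p i * q (n - i))"
      "symbol n (p i * q (n - i)) = hom_part c_deg i f * hom_part c_deg (n - i) h" if "i \<le> n"
          for i
    proof -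
      note d = nc_inv_leD(2)[OF p(1)] nc_inv_leD(2)[OF q(1)]
      show "p i * q (n - i) \<in> nc_inv" using p(1) q(1) by (simp add: nc_inv_le_def nc_inv_closed)
      show "in_degs nc_deg {..n} (p i * q (n - i))"
        by (rule in_degs_nc_mult[OF d]) (use that in auto)
      show "symbol n (p i * q (n - i)) = hom_part c_deg i f * hom_part c_deg (n - i) h"
        using hom_part_mult_top[OF nc_deg_add d, of i "n - i"] that
        by (simp add: abelianize_mult p(2) q(2))
    qed
    have "(\<Oplus>\<^bsub>CBH G c\<^esub>i\<in>{..n}. x i \<otimes>\<^bsub>CBH G c\<^esub> y (n - i))
        = (\<Oplus>\<^bsub>CBH G c\<^esub>i\<in>{..n}. proj (p i * q (n - i)))"
      using p(1) q(1) by (simp add: p(3) q(3) proj_mult nc_inv_le_def)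
    also have "\<dots> = proj (\<Oplus>\<^bsub>poly_algebra nc_inv\<^esub>i\<in>{..n}. p i * q (n - i))"
      using pq(1) by (intro CBH.image_finsum) auto
    also have "(\<Oplus>\<^bsub>poly_algebra nc_inv\<^esub>i\<in>{..n}. p i * q (n - i)) = (\<Sum>i\<le>n. p i * q (n - i))"
      using pq(1) by (intro finsum_eq_sum CBH.B.ring_axioms) auto
    finally have eq: "(\<Oplus>\<^bsub>CBH G c\<^esub>i\<in>{..n}. x i \<otimes>\<^bsub>CBH G c\<^esub> y (n - i)) = proj (\<Sum>i\<le>n. p i * q (n -
        i))" .
    have "(\<Sum>i\<le>n. p i * q (n - i)) \<in> nc_inv_le n"
      using pq by (auto simp: nc_inv_le_def intro!: nc_inv_sum in_degs_sum)
    moreover have "symbol n (\<Sum>i\<le>n. p i * q (n - i)) = hom_part c_deg n (f * h)"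
      using pq(3) by (simp add: hom_part_sum abelianize_sum hom_part_mult[OF c_deg_add])
    ultimately show ?thesis unfolding eq gr_of_def by (simp add: coset_eq_gr_coset)
  qed
  \<comment> \<open>The union in the definition of the product is not empty, since the cosets have
      representatives.\<close>
  define x where "x i = proj (lift (hom_part c_deg i f))" for i
  define y where "y i = proj (lift (hom_part c_deg i h))" for i
  have "\<forall>i. x i \<in> gr_of f i" "\<forall>i. y i \<in> gr_of h i"
    using f h by (auto simp: x_def y_def gr_of_def intro!: lift_in_gr_coset invariants_closed
        in_degs_hom_part)
  then have ne: "\<exists>x y. (\<forall>i. x i \<in> gr_of f i) \<and> (\<forall>i. y i \<in> gr_of h i)" by blast
  have "(gr_of f \<otimes>\<^bsub>GR\<^esub> gr_of h) n = \<Union>{lower n +>\<^bsub>CBH G c\<^esub> (\<Oplus>\<^bsub>CBH G c\<^esub>i\<in>{..n}. x i \<otimes>\<^bsub>CBH G c\<^esub> y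
      (n - i)) | x y.
      (\<forall>i. x i \<in> gr_of f i) \<and> (\<forall>i. y i \<in> gr_of h i)}" by (simp add: gr_def)
  also have "{lower n +>\<^bsub>CBH G c\<^esub> (\<Oplus>\<^bsub>CBH G c\<^esub>i\<in>{..n}. x i \<otimes>\<^bsub>CBH G c\<^esub> y (n - i)) | x y.
      (\<forall>i. x i \<in> gr_of f i) \<and> (\<forall>i. y i \<in> gr_of h i)} = {gr_of (f * h) n}"
    using ne prod by blast
  finally show "(gr_of f \<otimes>\<^bsub>GR\<^esub> gr_of h) n = gr_of (f * h) n" by simp
qed

lemma gr_of_one: "\<one>\<^bsub>GR\<^esub> = gr_of 1"
proof
  fix n
  have deg: "in_degs c_deg {0} 1" by (simp add: in_degs_def)
  have deg': "in_degs nc_deg {0} 1" by (simp add: in_degs_def)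
  have "1 \<in> nc_inv_le 0" by (simp add: nc_inv_le_def nc_inv_closed) (simp add: in_degs_def)
  from coset_eq_gr_coset[OF this] have "lower 0 +>\<^bsub>CBH G c\<^esub> \<one>\<^bsub>CBH G c\<^esub> = gr_coset 0 1"
    by (simp add: CBH_simps hom_part_id[OF deg'])
  then show "\<one>\<^bsub>GR\<^esub> n = gr_of 1 n"
    using hom_part_id[OF deg] hom_part_eq_0[OF deg, of n]
    by (auto simp: gr_def gr_of_def lower_eq_gr_coset)
qed

lemma gr_of_zero: "\<zero>\<^bsub>GR\<^esub> = gr_of 0"
  by (rule HOL.ext) (simp add: gr_def gr_of_def lower_eq_gr_coset)

sublocale GR: algebra_image "invariants G" GR gr_of
  by (rule algebra_image.intro) (simp_all add: C_algebra_invariants carrier_GR gr_of_add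
      gr_of_mult
      gr_of_smult gr_of_zero gr_of_one)

lemma gr_component_eq: "gr_component (CBH G c) (CBH_filtration G c) n = gr_of `
    invariants_component G n"
proof -
  have "(\<forall>m. m \<noteq> n \<longrightarrow> hom_part c_deg m h = 0) \<longleftrightarrow> in_degs c_deg {n} h" for h
  proof
    assume z: "\<forall>m. m \<noteq> n \<longrightarrow> hom_part c_deg m h = 0"
    have "hom_part c_deg n h = h"
      by (rule hom_part_inject[of c_deg]) (use z in \<open>metis hom_part_0 hom_part_eq_0 hom_part_id
          in_degs_hom_part singletonD\<close>)
    then show "in_degs c_deg {n} h" by (metis in_degs_hom_part)
  qed (auto intro: hom_part_eq_0)
  then have "(\<forall>m. m \<noteq> n \<longrightarrow> gr_of h m = lower m) \<longleftrightarrow> in_degs c_deg {n} h" if "h \<in> c_inv" for h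
    using gr_of_eq_lower[OF that] by simp
  then show ?thesis
    unfolding gr_component_def carrier_GR invariants_component_eq by blast
qed

lemma c_smash_idem:
  "smash_of_algebra (poly_algebra UNIV) (SL2_sub G) h \<otimes>\<^bsub>c_smash G\<^esub>
    smash_of_group (poly_algebra UNIV) (averaging_idempotent (SL2_sub G))
    = (\<lambda>g. if g \<in> G then scale (1 / of_nat (card G)) h else 0)"
proof
  fix k
  let ?e = "\<lambda>g. if g \<in> G then scale (1 / of_nat (card G)) 1 else 0"
  have e: "smash_of_group (poly_algebra UNIV) (averaging_idempotent (SL2_sub G)) = ?e"
    by (auto simp: smash_of_group_def averaging_idempotent_def)
  have act: "c_act g (?e k) = ?e k" for g k by (simp add: c_act_scale)
  have "(smash_of_algebra (poly_algebra UNIV) (SL2_sub G) h \<otimes>\<^bsub>c_smash G\<^esub> ?e) k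
      = (\<Sum>g\<in>G. smash_of_algebra (poly_algebra UNIV) (SL2_sub G) h g * c_act g (?e (ginv g ** k)))"
    unfolding c_smash_def by (rule smash_mult_sum) simp_all
  also have "\<dots> = (\<Sum>g\<in>G. if g = mat 1 then h * ?e k else 0)"
    unfolding act by (rule sum.cong) (auto simp: smash_of_algebra_def)
  finally have "(smash_of_algebra (poly_algebra UNIV) (SL2_sub G) h \<otimes>\<^bsub>c_smash G\<^esub> ?e) k
      = (\<Sum>g\<in>G. if g = mat 1 then h * ?e k else 0)" .
  then show "(smash_of_algebra (poly_algebra UNIV) (SL2_sub G) h \<otimes>\<^bsub>c_smash G\<^esub>
    smash_of_group (poly_algebra UNIV) (averaging_idempotent (SL2_sub G))) k
    = (if k \<in> G then scale (1 / of_nat (card G)) h else 0)"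
    unfolding e by (simp add: finite_G one_G scale_mult_right)
qed

text \<open>Existence uses representatives \<open>f e\<close>. Uniqueness has to deal with arbitrary
representatives in the smash product, which is why \<open>pbw\<close> is needed for the whole ideal and not
only for its part in the corner.\<close>
lemma CBH_symbol_gr_of:
  assumes h: "h \<in> c_inv"
  shows "CBH_symbol G c (gr_of h) = h"
  unfolding CBH_symbol_def c_smash_idem
proof (rule the_equality)
  show "h \<in> c_inv \<and> (\<forall>n. \<exists>a\<in>nc_smash_filtration G n. cls a \<in> gr_of h n \<and>
      principal_symbol n a = (\<lambda>g. if g \<in> G then scale (1 / of_nat (card G)) (hom_part c_deg n h)
          else 0))"
  proof (intro conjI h allI)
    fix n
    let ?h = "hom_part c_deg n h"
    have h': "?h \<in> c_inv" "in_degs c_deg {n} ?h" using h by (auto simp: invariants_closed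
        in_degs_hom_part)
    show "\<exists>a\<in>nc_smash_filtration G n. cls a \<in> gr_of h n \<and>
      principal_symbol n a = (\<lambda>g. if g \<in> G then scale (1 / of_nat (card G)) ?h else 0)"
    proof (intro bexI[of _ "times_idem (lift ?h)"] conjI)
      show "times_idem (lift ?h) \<in> nc_smash_filtration G n"
        using in_degs_times_idem[OF in_degs_lift[OF h'(2)]] times_idem_carrier[of "lift ?h"]
        by (auto simp: nc_smash_filtration_def in_degs_def)
      show "cls (times_idem (lift ?h)) \<in> gr_of h n"
        using lift_in_gr_coset[OF h'] by (simp add: proj_def gr_of_def)
      show "principal_symbol n (times_idem (lift ?h))
          = (\<lambda>g. if g \<in> G then scale (1 / of_nat (card G)) ?h else 0)"
        using symbol_lift[OF h']
        by (auto simp: principal_symbol_def times_idem_def hom_part_scale abelianize_scale)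
    qed
  qed
next
  fix f assume f: "f \<in> c_inv \<and> (\<forall>n. \<exists>a\<in>nc_smash_filtration G n. cls a \<in> gr_of h n \<and>
      principal_symbol n a = (\<lambda>g. if g \<in> G then scale (1 / of_nat (card G)) (hom_part c_deg n f)
          else 0))"
  show "f = h"
  proof (rule hom_part_inject[of c_deg])
    fix n
    from f obtain a where a: "a \<in> nc_smash_filtration G n" "cls a \<in> gr_of h n"
      "principal_symbol n a (mat 1) = scale (1 / of_nat (card G)) (hom_part c_deg n f)"
      using one_G by fastforce
    from a(2) obtain p where p: "p \<in> nc_inv_le n" "symbol n p = hom_part c_deg n h" "cls a =
        proj p"
      by (auto simp: gr_of_def gr_coset_def)
    have aA: "a \<in> carrier A" and da: "in_degs nc_deg {..n} (a g)" for g
      using a(1) by (auto simp: nc_smash_filtration_def in_degs_def)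
    have "(\<lambda>k. a k - times_idem p k) \<in> cbh_ideal G c"
      using p(3) cls_eq_iff[OF aA times_idem_carrier] by (simp add: proj_def cbh_ideal_eq)
    then have "symbol n (a (mat 1) - times_idem p (mat 1)) = 0"
      by (rule pbw) (intro in_degs_diff da in_degs_times_idem nc_inv_leD(2)[OF p(1)])
    then have "symbol n (a (mat 1)) = symbol n (times_idem p (mat 1))"
      by (simp add: hom_part_diff abelianize_diff)
    also have "\<dots> = scale (1 / of_nat (card G)) (hom_part c_deg n h)"
      by (simp add: times_idem_def one_G hom_part_scale abelianize_scale p(2))
    finally have eq: "scale (1 / of_nat (card G)) (hom_part c_deg n f)
        = scale (1 / of_nat (card G)) (hom_part c_deg n h)"
      using a(3) by (simp add: principal_symbol_def)
    show "hom_part c_deg n f = hom_part c_deg n h"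
      using arg_cong[OF eq, of "scale (of_nat (card G))"] card_G by simp
  qed
qed

theorem CBH_filtered_deformation:
  "filtered_deformation (CBH G c) (CBH_filtration G c) (CBH_symbol G c)
    (invariants G) (invariants_component G)"
  unfolding filtered_deformation_def
  by (intro conjI filtered_CBH GR.graded_algebra_iso_inverse graded_invariants CBH_symbol_gr_of
      gr_component_eq)

end

section \<open>Finite subgroups and central elements\<close>

lemma SL2_inverse:
  assumes "g \<in> carrier SL2"
  shows "\<exists>h\<in>carrier SL2. g ** h = mat 1 \<and> h ** g = mat 1"
proof -
  have "invertible g" using assms by (simp add: invertible_det_nz SL2_def)
  then obtain h where h: "g ** h = mat 1" "h ** g = mat 1" by (auto simp: invertible_def)
  have "det g * det h = 1" using arg_cong[OF h(1), of det] by (simp add: det_mul det_I)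
  then have "det h = 1" using assms by (simp add: SL2_def)
  then show ?thesis using h by (auto simp: SL2_def)
qed

lemma finite_SL2I:
  assumes "subgroup G SL2" "finite G"
  shows "finite_SL2 G"
proof -
  interpret subgroup G SL2 by fact
  have SL2: "g \<in> carrier SL2" if "g \<in> G" for g using that subset by auto
  interpret S: group SL2
  proof (rule groupI)
    show "\<exists>y\<in>carrier SL2. y \<otimes>\<^bsub>SL2\<^esub> x = \<one>\<^bsub>SL2\<^esub>" if "x \<in> carrier SL2" for x
      using SL2_inverse[OF that] by (auto simp: SL2_def)
  qed (simp_all add: SL2_def det_mul det_I matrix_mul_assoc)
  show ?thesis
  proof
    show "\<exists>h\<in>G. g ** h = mat 1 \<and> h ** g = mat 1" if g: "g \<in> G" for g
      using m_inv_closed[OF g] S.r_inv[OF SL2[OF g]] S.l_inv[OF SL2[OF g]]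
      by (intro bexI[of _ "inv\<^bsub>SL2\<^esub> g"]) (simp_all add: SL2_def)
    show "mat 1 \<in> G" using one_closed by (simp add: SL2_def)
    show "g ** h \<in> G" if "g \<in> G" "h \<in> G" for g h using m_closed[OF that] by (simp add: SL2_def)
    show "det g = 1" if "g \<in> G" for g using SL2[OF that] by (simp add: SL2_def)
  qed (rule assms)
qed

text \<open>Commutation of \<open>c\<close> with the group element \<open>h\<close>, read off at \<open>h g h\<close>, where each of the two
products has a single contribution.\<close>
lemma group_algebra_center_class:
  assumes "finite_SL2 G" and c: "c \<in> algebra_center (group_algebra (SL2_sub G))"
    and g: "g \<in> G" and h: "h \<in> G"
  shows "c (g ** h) = c (h ** g)"
proof -
  interpret finite_SL2 G by fact
  let ?B = "group_algebra (SL2_sub G)"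
  let ?d = "\<lambda>x. if x = h then 1 else (0::complex)"
  have mult: "(x \<otimes>\<^bsub>?B\<^esub> y) k = (\<Sum>(a, b) \<in> {(a, b) \<in> G \<times> G. a ** b = k}. x a * y b)" for x y k
    by (simp add: group_algebra_def)
  have "?d \<in> carrier ?B" using h by (simp add: group_algebra_def)
  then have "(c \<otimes>\<^bsub>?B\<^esub> ?d) (h ** g ** h) = (?d \<otimes>\<^bsub>?B\<^esub> c) (h ** g ** h)"
    using c by (simp add: algebra_center_def)
  moreover have fin: "finite {(a, b). (a, b) \<in> G \<times> G \<and> a ** b = h ** g ** h}"
    by (rule finite_subset[of _ "G \<times> G"]) (auto simp: finite_G)
  have "(c \<otimes>\<^bsub>?B\<^esub> ?d) (h ** g ** h) = (\<Sum>(a, b) \<in> {(h ** g, h)}. c a * ?d b)"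
    unfolding mult
  proof (rule sum.mono_neutral_right[OF fin])
    show "\<forall>i\<in>{(a, b) \<in> G \<times> G. a ** b = h ** g ** h} - {(h ** g, h)}. (case i of (a, b) \<Rightarrow> c a *
        ?d b) = 0"
      using h cancel_G(3) by (auto split: if_splits) (metis cancel_G(3))
  qed (use g h mult_G in auto)
  moreover have "(?d \<otimes>\<^bsub>?B\<^esub> c) (h ** g ** h) = (\<Sum>(a, b) \<in> {(h, g ** h)}. ?d a * c b)"
    unfolding mult
  proof (rule sum.mono_neutral_right[OF fin])
    show "\<forall>i\<in>{(a, b) \<in> G \<times> G. a ** b = h ** g ** h} - {(h, g ** h)}. (case i of (a, b) \<Rightarrow> ?d a *
        c b) = 0"
      using h by (auto split: if_splits) (metis cancel_G(1) matrix_mul_assoc)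
  qed (use g h mult_G in \<open>auto simp: matrix_mul_assoc\<close>)
  ultimately show ?thesis by simp
qed

lemma cbhI:
  assumes "subgroup G SL2" "finite G" "c \<in> algebra_center (group_algebra (SL2_sub G))"
  shows "cbh G c"
proof -
  interpret finite_SL2 G using assms by (intro finite_SL2I)
  show ?thesis
    using assms group_algebra_center_class[OF finite_SL2_axioms]
    by unfold_locales (auto simp: algebra_center_def group_algebra_def)
qed

section \<open>The embedding\<close>

locale cbh_pair = sub: cbh G1 c + super: cbh G2 c for G1 G2 c +
  assumes sub: "G1 \<subseteq> G2"
begin

lemma c_outside_sub: "g \<notin> G1 \<Longrightarrow> c g = 0"
  by (rule sub.c_outside)

lemma ginv_mult_in_sub_iff: "g \<in> G1 \<Longrightarrow> sub.ginv g ** k \<in> G1 \<longleftrightarrow> k \<in> G1"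
  by (simp add: sub.mult_G_iff sub.ginv)

lemma sub_carrier: "a \<in> carrier (nc_smash G1) \<Longrightarrow> a \<in> carrier (nc_smash G2)"
  using sub by (auto simp: sub.carrier_A super.carrier_A)

text \<open>The projection of the smash product with \<open>G2\<close> onto that with \<open>G1\<close> which discards the group
elements outside \<open>G1\<close>. It is left linear over the smaller smash product, in which the relator
and the words \<open>v\<^sup>a u\<^sup>b\<close> live; therefore it maps \<open>v\<^sup>a u\<^sup>b r y\<close> to an element of the same form.\<close>
definition restrict :: "(complex^2^2 \<Rightarrow> nc_poly) \<Rightarrow> complex^2^2 \<Rightarrow> nc_poly" where
  "restrict a = (\<lambda>k. if k \<in> G1 then a k else 0)"

lemma restrict_carrier: "restrict a \<in> carrier (nc_smash G1)"
  by (simp add: restrict_def sub.carrier_A)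

lemma central_act_eq: "super.central_act y k = sub.central_act y k"
  unfolding super.central_act_def sub.central_act_def super.group_act_def sub.group_act_def
  by (rule sum.mono_neutral_right[OF super.finite_G sub]) (simp add: c_outside_sub)

lemma relator_act_eq: "super.relator_act y = sub.relator_act y"
  by (simp add: super.relator_act_def sub.relator_act_def central_act_eq)

lemma relator_act_restrict: "sub.relator_act (restrict y) = restrict (sub.relator_act y)"
proof
  fix k
  show "sub.relator_act (restrict y) k = restrict (sub.relator_act y) k"
    by (cases "k \<in> G1")
      (simp_all add: sub.relator_act_def sub.central_act_def sub.group_act_def restrict_def
          ginv_mult_in_sub_iff)
qed

lemma restrict_relator_span: "x \<in> super.relator_span \<Longrightarrow> restrict x \<in> sub.relator_span"
proof (induction rule: super.relator_span.induct)
  case zero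
  show ?case using sub.relator_span.zero by (simp add: restrict_def)
next
  case (step x y a b)
  from sub.relator_span.step[OF step(3) restrict_carrier[of y], of a b]
  have "(\<lambda>k. restrict x k + nc_word (normal_word a b) * restrict (super.relator_act y) k) \<in>
      sub.relator_span"
    by (simp add: relator_act_restrict relator_act_eq)
  moreover have "(\<lambda>k. restrict x k + nc_word (normal_word a b) * restrict (super.relator_act y) k)
      = restrict (\<lambda>k. x k + nc_word (normal_word a b) * super.relator_act y k)"
    by (auto simp: restrict_def)
  ultimately show ?case by simp
qed

lemma sub_relator_span_subset: "x \<in> sub.relator_span \<Longrightarrow> x \<in> super.relator_span"
proof (induction rule: sub.relator_span.induct)
  case (step x y a b)
  then show ?case using super.relator_span.step[OF step(3) sub_carrier[OF step(2)], of a b] by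
      (simp add: relator_act_eq)
qed (rule super.relator_span.zero)

lemma nc_inv_sub: "f \<in> super.nc_inv \<Longrightarrow> f \<in> sub.nc_inv"
  using sub by (auto simp: super.nc_inv_def sub.nc_inv_def)

lemma times_idem_in_relator_span_iff:
  shows "super.times_idem f \<in> super.relator_span \<longleftrightarrow> sub.times_idem f \<in> sub.relator_span"
proof
  assume "super.times_idem f \<in> super.relator_span"
  then have "restrict (super.times_idem f) \<in> sub.relator_span" by (rule restrict_relator_span)
  \<comment> \<open>The factor is the quotient of the normalizations of the two idempotents.\<close>
  then have "(\<lambda>k. scale (of_nat (card G2) / of_nat (card G1)) (restrict (super.times_idem f) k))
      \<in> sub.relator_span"
    by (rule sub.relator_span_scale)
  moreover have "(\<lambda>k. scale (of_nat (card G2) / of_nat (card G1)) (restrict (super.times_idem f)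
      k))
      = sub.times_idem f"
    using subsetD[OF sub] super.card_G
    by (auto simp: restrict_def super.times_idem_def sub.times_idem_def)
  ultimately show "sub.times_idem f \<in> sub.relator_span" by simp
next
  assume "sub.times_idem f \<in> sub.relator_span"
  then have "sub.times_idem f \<otimes>\<^bsub>nc_smash G2\<^esub> super.times_idem 1 \<in> super.relator_span"
    by (intro super.relator_span_right sub_relator_span_subset super.times_idem_carrier)
  also have "sub.times_idem f \<otimes>\<^bsub>nc_smash G2\<^esub> super.times_idem 1
      = super.times_idem (\<Sum>g\<in>G2. sub.times_idem f g)"
    by (simp add: super.mult_times_idem)
  also have "(\<Sum>g\<in>G2. sub.times_idem f g) = (\<Sum>g\<in>G1. sub.times_idem f g)"
    by (rule sum.mono_neutral_right[OF super.finite_G sub]) (simp add: sub.times_idem_def)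
  also have "\<dots> = f"
    using sub.sum_const_scale[of f] by (simp add: sub.times_idem_def)
  finally show "super.times_idem f \<in> super.relator_span" .
qed

lemma proj_eq_iff: "super.proj f = super.proj h \<longleftrightarrow> sub.proj f = sub.proj h"
  by (simp add: super.proj_eq_iff sub.proj_eq_iff times_idem_in_relator_span_iff)

text \<open>The choice of \<open>f\<close> is immaterial by \<open>proj_eq_iff\<close>, which says that \<open>f e\<close> represents zero
for both groups or for neither.\<close>
definition embed where
  "embed x = sub.proj (SOME f. f \<in> super.nc_inv \<and> super.proj f = x)"

lemma embed_proj: "f \<in> super.nc_inv \<Longrightarrow> embed (super.proj f) = sub.proj f"
proof -
  assume f: "f \<in> super.nc_inv"
  let ?f = "SOME h. h \<in> super.nc_inv \<and> super.proj h = super.proj f"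
  have "?f \<in> super.nc_inv \<and> super.proj ?f = super.proj f" by (rule someI[of _ f]) (simp add: f)
  then show ?thesis by (simp add: embed_def proj_eq_iff)
qed

lemma embed_hom: "embed \<in> C_algebra_hom (CBH G2 c) (CBH G1 c)"
  unfolding C_algebra_hom_def
proof (intro CollectI conjI ring_hom_memI allI ballI)
  show "embed \<one>\<^bsub>CBH G2 c\<^esub> = \<one>\<^bsub>CBH G1 c\<^esub>"
    by (simp add: super.CBH_simps sub.CBH_simps embed_proj super.nc_inv_closed)
qed (auto simp: super.carrier_CBH sub.carrier_CBH embed_proj super.proj_add super.proj_mult
    super.proj_smult sub.proj_add sub.proj_mult sub.proj_smult super.nc_inv_closed nc_inv_sub)

text \<open>If \<open>f e\<close> for the smaller group is congruent to some \<open>h e\<close> with \<open>h\<close> of degree at most \<open>n\<close>,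
then averaging \<open>h\<close> over the larger group gives a representative of degree at most \<open>n\<close> for the
latter.\<close>
lemma embed_filtration:
  "embed ` CBH_filtration G2 c n = embed ` carrier (CBH G2 c) \<inter> CBH_filtration G1 c n"
proof
  show "embed ` CBH_filtration G2 c n \<subseteq> embed ` carrier (CBH G2 c) \<inter> CBH_filtration G1 c n"
    unfolding super.CBH_filtration_eq super.carrier_CBH sub.CBH_filtration_eq
    by (auto simp: super.nc_inv_le_def sub.nc_inv_le_def embed_proj nc_inv_sub)
  show "embed ` carrier (CBH G2 c) \<inter> CBH_filtration G1 c n \<subseteq> embed ` CBH_filtration G2 c n"
  proof
    fix x assume "x \<in> embed ` carrier (CBH G2 c) \<inter> CBH_filtration G1 c n"
    then obtain f h where f: "f \<in> super.nc_inv" "x = sub.proj f"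
      and h: "h \<in> sub.nc_inv_le n" "x = sub.proj h"
      unfolding super.carrier_CBH sub.CBH_filtration_eq by (auto simp: embed_proj)
    let ?h = "super.avg h"
    have "sub.times_idem (f - h) \<in> sub.relator_span" using f(2) h(2) sub.proj_eq_iff[of f h] by
        simp
    then have "super.times_idem 1 \<otimes>\<^bsub>nc_smash G2\<^esub> super.times_idem (f - h) \<in> super.relator_span"
      by (intro super.relator_span_left super.times_idem_carrier) (simp add:
          times_idem_in_relator_span_iff)
    then have "super.times_idem (super.avg (f - h)) \<in> super.relator_span"
      by (simp add: super.times_idem_mult_avg)
    moreover have "super.avg (f - h) = f - ?h"
      using super.avg_id[OF f(1)]
      by (simp add: super.avg_def nc_act_diff sum_subtractf scale_diff_right)
    ultimately have "super.proj f = super.proj ?h" by (simp add: super.proj_eq_iff)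
    moreover have "?h \<in> super.nc_inv_le n"
      using h(1) by (simp add: super.nc_inv_le_def sub.nc_inv_le_def super.avg_in_nc_inv
          super.in_degs_avg)
    ultimately have "super.proj f \<in> CBH_filtration G2 c n" unfolding super.CBH_filtration_eq by
        blast
    then show "x \<in> embed ` CBH_filtration G2 c n"
      using f embed_proj[OF f(1)] by (metis imageI)
  qed
qed

lemma filtered_embedding_embed:
  "filtered_embedding (CBH G2 c) (CBH_filtration G2 c) (CBH G1 c) (CBH_filtration G1 c) embed"
  unfolding filtered_embedding_def
  by (intro conjI super.filtered_CBH sub.filtered_CBH embed_hom allI embed_filtration)
    (auto simp: inj_on_def super.carrier_CBH embed_proj proj_eq_iff)

lemma invariants_sub: "h \<in> carrier (invariants G2) \<Longrightarrow> h \<in> carrier (invariants G1)"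
  using sub by (auto simp: carrier_invariants)

text \<open>Both cosets are determined by the symbol of a common representative \<open>f\<close>.\<close>
lemma gr_map_gr_of:
  assumes h: "h \<in> carrier (invariants G2)"
  shows "gr_map (CBH G1 c) (CBH_filtration G1 c) embed (super.gr_of h) = sub.gr_of h"
proof
  fix n
  let ?h = "hom_part c_deg n h"
  have h': "?h \<in> carrier (invariants G2)" "in_degs c_deg {n} ?h"
    using h by (auto simp: invariants_closed in_degs_hom_part)
  have "sub.lower n +>\<^bsub>CBH G1 c\<^esub> embed x = sub.gr_coset n ?h" if "x \<in> super.gr_coset n ?h" for x
    using that
    by (auto simp: super.gr_coset_def super.nc_inv_le_def sub.nc_inv_le_def embed_proj nc_inv_sub
        intro!: sub.coset_of_gr_coset sub.gr_cosetI)
  moreover have "super.gr_coset n ?h \<noteq> {}" using super.lift_in_gr_coset[OF h'] by auto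
  ultimately show "gr_map (CBH G1 c) (CBH_filtration G1 c) embed (super.gr_of h) n = sub.gr_of h
      n"
    by (simp add: gr_map_def super.gr_of_def sub.gr_of_def)
qed

theorem embed_deforms_inclusion:
  "filtered_deformation_of_inclusion
     (CBH G2 c) (CBH_filtration G2 c) (CBH G1 c) (CBH_filtration G1 c)
     embed (CBH_symbol G1 c)
     (invariants G2) (invariants_component G2) (invariants G1) (invariants_component G1)"
proof -
  have "CBH_symbol G1 c ` gr_map (CBH G1 c) (CBH_filtration G1 c) embed `
      carrier (gr (CBH G2 c) (CBH_filtration G2 c))
      = (\<lambda>h. CBH_symbol G1 c (gr_map (CBH G1 c) (CBH_filtration G1 c) embed (super.gr_of h)))
        ` carrier (invariants G2)"
    by (simp add: super.carrier_GR image_image)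
  also have "\<dots> = (\<lambda>h. h) ` carrier (invariants G2)"
    by (rule image_cong[OF refl]) (simp add: gr_map_gr_of sub.CBH_symbol_gr_of invariants_sub)
  finally show ?thesis
    unfolding filtered_deformation_of_inclusion_def
    by (simp add: graded_inclusion_invariants[OF sub] sub.CBH_filtered_deformation
        filtered_embedding_embed)
qed

end

theorem proposition1p7:
  fixes G1 G2 :: "(complex^2^2) set" and c :: "complex^2^2 \<Rightarrow> complex"
  assumes "subgroup G1 SL2" and "finite G1"
    and "subgroup G2 SL2" and "finite G2"
    and "G1 \<lhd> SL2_sub G2"
    and "c \<in> algebra_center (group_algebra (SL2_sub G1)) \<inter>
             algebra_center (group_algebra (SL2_sub G2))"
  shows "\<exists>\<phi>. filtered_deformation_of_inclusion
           (CBH G2 c) (CBH_filtration G2 c) (CBH G1 c) (CBH_filtration G1 c)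
           \<phi> (CBH_symbol G1 c)
           (invariants G2) (invariants_component G2) (invariants G1) (invariants_component G1)"
proof -
  interpret sub: cbh G1 c using assms by (intro cbhI) auto
  interpret super: cbh G2 c using assms by (intro cbhI) auto
  have "subgroup G1 (SL2_sub G2)" using assms(5) by (rule normal.axioms(1))
  then have "G1 \<subseteq> G2" using subgroup.subset by fastforce
  then interpret cbh_pair G1 G2 c by unfold_locales
  show ?thesis using embed_deforms_inclusion by blast
qed

end
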